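(* As $n\to\infty$, the metric spaces $\mathcal{UCP}_{\mathcal{K}}(C(S^1)_{(n)})$ converge to $\mathcal{UCP}_{\mathcal{K}}(C(S^1))$ in the Gromov-Hausdorff distance.
   Context: $\mathcal{K}$ is a complex separable Hilbert space and $\{k_p:p\in\mathbb{N}\}$ is a fixed dense subset of its closed unit ball. For a closed operator system $E$, $\mathcal{UCP}_{\mathcal{K}}(E)$ is the set of all unital completely positive maps $E\to\mathcal{B}(\mathcal{K})$. $C(S^1)$ is the $C^*$-algebra of continuous functions on the unit circle, and the Fejér-Riesz operator system $C(S^1)_{(n)}\subseteq C(S^1)$ ($n\ge1$) consists of the functions $f(z)=\sum_{k=-(n-1)}^{n-1}a_kz^k$, $a_k\in\mathbb{C}$. Both act on $L^2(S^1)$ by multiplication. Let $D=-i\frac{d}{d\theta}$ on $L^2(S^1)$ and $\|f\|_1=\|[D,f]\|$. The metrics used are as follows. With $\mathcal{E}=C^\infty(S^1)$ for $E=C(S^1)$, and $\mathcal{E}=C(S^1)_{(n)}$ for $E=C(S^1)_{(n)}$ (that is, for the operator system spectral triples $(C^\infty(S^1),L^2(S^1),D)$ and $(C(S^1)_{(n)},L^2(S^1),D)$), $\mathcal{UCP}_{\mathcal{K}}(E)$ carries the metric $$d_E(\phi,\psi)=\sup\Big\{\sum_{p=1}^\infty\frac{1}{2^p}|\langle(\phi-\psi)(f)k_p,k_p\rangle| : f\in\mathcal{E},\ \|f\|\le1,\ \|f\|_1\le1\Big\}.$$ The Gromov-Hausdorff distance between compact metric spaces is the infimum of the Hausdorff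 distances between their images under isometric embeddings into a common compact metric space. *)

theory Defs
  imports "HOL-Analysis.Analysis"
begin

section \<open>Complex Hilbert spaces and bounded operators\<close>

text \<open>
  A complex inner product space, compatible with the real structure of the library. The inner
  product is linear in the first argument. A complex separable Hilbert space is a type of sort
  \<open>{complex_inner, polish_space}\<close>, as \<^class>\<open>polish_space\<close> is completeness plus second countability.
\<close>

class complex_inner = real_inner +
  fixes scaleC :: "complex \<Rightarrow> 'a \<Rightarrow> 'a" (infixr \<open>*\<^sub>C\<close> 75)
    and cinner :: "'a \<Rightarrow> 'a \<Rightarrow> complex"
  assumes scaleC_add_right: "c *\<^sub>C (x + y) = c *\<^sub>C x + c *\<^sub>C y"
    and scaleC_add_left: "(b + c) *\<^sub>C x = b *\<^sub>C x + c *\<^sub>C x"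
    and scaleC_scaleC: "b *\<^sub>C c *\<^sub>C x = (b * c) *\<^sub>C x"
    and scaleC_of_real: "complex_of_real r *\<^sub>C x = r *\<^sub>R x"
    and cinner_commute: "cinner x y = cnj (cinner y x)"
    and cinner_add_left: "cinner (x + y) z = cinner x z + cinner y z"
    and cinner_scaleC_left: "cinner (c *\<^sub>C x) y = c * cinner x y"
    and Re_cinner: "Re (cinner x y) = inner x y"

instantiation complex :: complex_inner
begin

definition scaleC_complex :: "complex \<Rightarrow> complex \<Rightarrow> complex"
  where "scaleC_complex c x = c * x"

definition cinner_complex :: "complex \<Rightarrow> complex \<Rightarrow> complex"
  where "cinner_complex x y = x * cnj y"

instance
  by standard (auto simp: scaleC_complex_def cinner_complex_def algebra_simps scaleR_conv_of_real
      inner_complex_def)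

end

text \<open>Elements of \<open>'k \<Rightarrow>\<^sub>L 'k\<close> are bounded and real linear; this singles out the algebra of bounded
  complex linear operators.\<close>

definition bounded_operators :: "('k::complex_inner \<Rightarrow>\<^sub>L 'k) set"
  where "bounded_operators = {T. \<forall>c x. blinfun_apply T (c *\<^sub>C x) = c *\<^sub>C blinfun_apply T x}"


section \<open>Functions on the circle\<close>

typedef circle = "sphere (0::complex) 1"
  by (rule exI[of _ 1]) simp

instantiation circle :: metric_space
begin

definition dist_circle :: "circle \<Rightarrow> circle \<Rightarrow> real"
  where "dist_circle z w = dist (Rep_circle z) (Rep_circle w)"

definition uniformity_circle :: "(circle \<times> circle) filter"
  where "uniformity_circle = (INF e\<in>{0 <..}. principal {(z, w). dist z w < e})"

definition open_circle :: "circle set \<Rightarrow> bool"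
  where "open_circle U \<longleftrightarrow> (\<forall>z\<in>U. \<forall>\<^sub>F (z', w) in uniformity. z' = z \<longrightarrow> w \<in> U)"

instance
  by standard
    (auto simp: dist_circle_def uniformity_circle_def open_circle_def Rep_circle_inject
      dist_triangle2)

end

definition circle_pt :: "real \<Rightarrow> circle"
  where "circle_pt \<theta> = Abs_circle (cis \<theta>)"

definition circle_continuous :: "(circle \<Rightarrow> complex) set"
  where "circle_continuous = {f. continuous_on UNIV f}"

definition circle_smooth :: "(circle \<Rightarrow> complex) set"
  where "circle_smooth = {f. \<exists>F :: nat \<Rightarrow> real \<Rightarrow> complex.
    (\<forall>\<theta>. F 0 \<theta> = f (circle_pt \<theta>)) \<and>
    (\<forall>m \<theta>. (F m has_vector_derivative F (Suc m) \<theta>) (at \<theta>))}"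

text \<open>Intended for \<open>n \<ge> 1\<close>.\<close>

definition fejer_riesz :: "nat \<Rightarrow> (circle \<Rightarrow> complex) set"
  where "fejer_riesz n = {f. \<exists>a :: int \<Rightarrow> complex.
    \<forall>z. f z = (\<Sum>k = - (int n - 1)..int n - 1. a k * Rep_circle z powi k)}"

definition sup_norm :: "(circle \<Rightarrow> complex) \<Rightarrow> real"
  where "sup_norm f = (SUP z. cmod (f z))"


section \<open>The Hilbert space \<open>L\<^sup>2\<close> of the circle and the operator \<open>D\<close>\<close>

definition arc_measure :: "circle measure"
  where "arc_measure = distr (restrict_space lborel {0..<2 * pi}) borel circle_pt"

text \<open>Vectors of \<open>L\<^sup>2\<close> are represented by square integrable Borel functions; everything below is
  invariant under changes on null sets.\<close>

definition L2_circle :: "(circle \<Rightarrow> complex) set"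
  where "L2_circle = {\<xi> \<in> borel_measurable arc_measure.
    integrable arc_measure (\<lambda>z. (cmod (\<xi> z))\<^sup>2)}"

definition L2_inner :: "(circle \<Rightarrow> complex) \<Rightarrow> (circle \<Rightarrow> complex) \<Rightarrow> complex"
  where "L2_inner \<xi> \<eta> = (\<integral>z. \<xi> z * cnj (\<eta> z) \<partial>arc_measure)"

definition L2_norm :: "(circle \<Rightarrow> complex) \<Rightarrow> real"
  where "L2_norm \<xi> = sqrt (\<integral>z. (cmod (\<xi> z))\<^sup>2 \<partial>arc_measure)"

text \<open>
  The graph of the self-adjoint operator \<open>D = -\<i> d/d\<theta>\<close>: the domain consists of the \<open>\<xi>\<close> having an
  absolutely continuous representative \<open>g\<close> on the circle with square integrable derivative
  \<open>\<i> \<zeta>\<close>, and then \<open>D \<xi> = \<zeta>\<close>. The case \<open>\<theta> = 2\<pi>\<close> is the periodicity condition on \<open>g\<close>.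
\<close>

definition D_graph :: "((circle \<Rightarrow> complex) \<times> (circle \<Rightarrow> complex)) set"
  where "D_graph = {(\<xi>, \<zeta>). \<xi> \<in> L2_circle \<and> \<zeta> \<in> L2_circle \<and>
    (\<exists>g. (AE z in arc_measure. \<xi> z = g z) \<and>
      (\<forall>\<theta>\<in>{0..2 * pi}. g (circle_pt \<theta>) =
        g (circle_pt 0) + \<i> * (LINT t:{0..\<theta>}|lborel. \<zeta> (circle_pt t))))}"

text \<open>The seminorm \<open>\<parallel>[D, f]\<parallel>\<close>: the operator norm of \<open>\<xi> \<mapsto> D (f \<xi>) - f D \<xi>\<close>, with \<open>f\<close> acting
  by multiplication.\<close>

definition lip_norm :: "(circle \<Rightarrow> complex) \<Rightarrow> ennreal"
  where "lip_norm f =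
    (SUP (\<xi>, \<zeta>, \<eta>) \<in> {(\<xi>, \<zeta>, \<eta>).
        (\<xi>, \<zeta>) \<in> D_graph \<and> (\<lambda>z. f z * \<xi> z, \<eta>) \<in> D_graph \<and> L2_norm \<xi> \<le> 1}.
      ennreal (L2_norm (\<lambda>z. \<eta> z - f z * \<zeta> z)))"


section \<open>Unital completely positive maps\<close>

text \<open>Positivity of an \<open>m \<times> m\<close> matrix of functions and of operators means positivity
  \<open>\<langle>T x, x\<rangle> \<ge> 0\<close> of the operator \<open>T\<close> it defines on the \<open>m\<close>-fold direct sum of \<open>L\<^sup>2\<close> (by
  multiplication), respectively of \<open>'k\<close>.\<close>

definition positive_fun_matrix :: "nat \<Rightarrow> (nat \<Rightarrow> nat \<Rightarrow> circle \<Rightarrow> complex) \<Rightarrow> bool"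
  where "positive_fun_matrix m F \<longleftrightarrow>
    (\<forall>\<xi>. (\<forall>i<m. \<xi> i \<in> L2_circle) \<longrightarrow>
      (\<Sum>i<m. \<Sum>j<m. L2_inner (\<lambda>z. F i j z * \<xi> j z) (\<xi> i)) \<in> \<real>\<^sub>\<ge>\<^sub>0)"

definition positive_op_matrix :: "nat \<Rightarrow> (nat \<Rightarrow> nat \<Rightarrow> 'k \<Rightarrow>\<^sub>L 'k::complex_inner) \<Rightarrow> bool"
  where "positive_op_matrix m T \<longleftrightarrow>
    (\<forall>x. (\<Sum>i<m. \<Sum>j<m. cinner (blinfun_apply (T i j) (x j)) (x i)) \<in> \<real>\<^sub>\<ge>\<^sub>0)"

definition completely_positive ::
    "(circle \<Rightarrow> complex) set \<Rightarrow> ((circle \<Rightarrow> complex) \<Rightarrow> 'k \<Rightarrow>\<^sub>L 'k::complex_inner) \<Rightarrow> bool"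
  where "completely_positive E \<phi> \<longleftrightarrow>
    (\<forall>m F. (\<forall>i<m. \<forall>j<m. F i j \<in> E) \<longrightarrow> positive_fun_matrix m F \<longrightarrow>
      positive_op_matrix m (\<lambda>i j. \<phi> (F i j)))"

text \<open>Extensionality makes maps on \<open>E\<close> equal as soon as they agree on \<open>E\<close>.\<close>

definition ucp_maps ::
    "(circle \<Rightarrow> complex) set \<Rightarrow> ((circle \<Rightarrow> complex) \<Rightarrow> 'k \<Rightarrow>\<^sub>L 'k::complex_inner) set"
  where "ucp_maps E = {\<phi> \<in> E \<rightarrow>\<^sub>E bounded_operators.
    (\<forall>f\<in>E. \<forall>g\<in>E. \<phi> (\<lambda>z. f z + g z) = \<phi> f + \<phi> g) \<and>
    (\<forall>f\<in>E. \<forall>c x. blinfun_apply (\<phi> (\<lambda>z. c * f z)) x = c *\<^sub>C blinfun_apply (\<phi> f) x) \<and>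
    \<phi> (\<lambda>_. 1) = id_blinfun \<and>
    completely_positive E \<phi>}"

text \<open>\<open>A\<close> is the domain of the Lipschitz seminorm (written \<open>\<E>\<close> in the definition of \<open>d\<^sub>E\<close>); the
  sum over \<open>p \<ge> 1\<close> is written with \<open>Suc p\<close>.\<close>

definition ucp_dist ::
    "(nat \<Rightarrow> 'k::complex_inner) \<Rightarrow> (circle \<Rightarrow> complex) set \<Rightarrow>
     ((circle \<Rightarrow> complex) \<Rightarrow> 'k \<Rightarrow>\<^sub>L 'k) \<Rightarrow> ((circle \<Rightarrow> complex) \<Rightarrow> 'k \<Rightarrow>\<^sub>L 'k) \<Rightarrow> real"
  where "ucp_dist k A \<phi> \<psi> =
    (SUP f \<in> {f \<in> A. sup_norm f \<le> 1 \<and> lip_norm f \<le> 1}.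
      \<Sum>p. 1 / 2 ^ Suc p * cmod (cinner (blinfun_apply (\<phi> f - \<psi> f) (k (Suc p))) (k (Suc p))))"


section \<open>Gromov-Hausdorff distance\<close>

definition hausdorff_distance :: "('a \<Rightarrow> 'a \<Rightarrow> real) \<Rightarrow> 'a set \<Rightarrow> 'a set \<Rightarrow> ennreal"
  where "hausdorff_distance d A B =
    max (SUP a\<in>A. INF b\<in>B. ennreal (d a b)) (SUP b\<in>B. INF a\<in>A. ennreal (d a b))"

definition isometric_embedding ::
    "'a set \<Rightarrow> ('a \<Rightarrow> 'a \<Rightarrow> real) \<Rightarrow> 'b set \<Rightarrow> ('b \<Rightarrow> 'b \<Rightarrow> real) \<Rightarrow> ('a \<Rightarrow> 'b) \<Rightarrow> bool"
  where "isometric_embedding M d N e f \<longleftrightarrow>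
    f \<in> M \<rightarrow> N \<and> inj_on f M \<and> (\<forall>x\<in>M. \<forall>y\<in>M. e (f x) (f y) = d x y)"

text \<open>
  The ambient space \<open>(Z, e)\<close> ranges over the compact metric spaces whose carrier is a set of real
  sequences. The metric \<open>e\<close> is arbitrary and a compact metric space has at most continuum many
  points, so up to isometry these are all the compact metric spaces. The value is \<open>\<infinity>\<close> if there is
  no common ambient space.
\<close>

definition gromov_hausdorff_distance ::
    "'a set \<Rightarrow> ('a \<Rightarrow> 'a \<Rightarrow> real) \<Rightarrow> 'b set \<Rightarrow> ('b \<Rightarrow> 'b \<Rightarrow> real) \<Rightarrow> ennreal"
  where "gromov_hausdorff_distance M d N d' =
    Inf {hausdorff_distance e (f ` M) (g ` N) | (Z :: (nat \<Rightarrow> real) set) e f g.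
      Metric_space Z e \<and> compact_space (Metric_space.mtopology Z e) \<and>
      isometric_embedding M d Z e f \<and> isometric_embedding N d' Z e g}"

end

theory Submission
  imports Defs
begin

text \<open>
  Restriction sends a unital completely positive map \<open>\<phi>\<close> on \<open>C(S\<^sup>1)\<close> to one on the trigonometric
  polynomials \<open>C(S\<^sup>1)\<^bsub>(n)\<^esub>\<close>. In the opposite direction, composition with the Fejer mean \<open>K\<^sub>n\<close> sends a map
  \<open>\<psi>\<close> on \<open>C(S\<^sup>1)\<^bsub>(n)\<^esub>\<close> to \<open>\<psi> \<circ> K\<^sub>n\<close>. This is unital and completely positive because \<open>K\<^sub>n\<close> averages
  against the positive Fejer kernel of mass one, and a matrix of functions is positive iff it is
  positive semidefinite at each point (\<open>positive_fun_matrix_iff_pointwise\<close>,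
  \<open>fejer_mean_positive_fun_matrix\<close>).

  The two operations are almost inverse for the metrics. For smooth \<open>f\<close> the commutator \<open>[D, f]\<close> is
  multiplication by \<open>-\<i> f'\<close>, so \<open>\<parallel>[D, f]\<parallel> \<le> 1\<close> means \<open>|f'| \<le> 1\<close>
  (\<open>lip_norm_le_1_if_derivative_le_1\<close>, \<open>derivative_le_1_if_lip_norm_le_1\<close>). As \<open>K\<^sub>n\<close> commutes with
  differentiation and does not increase the sup norm, it maps the Lipschitz ball of \<open>C\<^sup>\<infinity>(S\<^sup>1)\<close> into that of
  \<open>C(S\<^sup>1)\<^bsub>(n)\<^esub>\<close>. The Fejer kernel has second moment \<open>2 / n\<close>, so \<open>\<parallel>f - K\<^sub>n f\<parallel> \<le> \<gamma>\<^sub>n = 9 / \<surd>n\<close> on the ball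
  (\<open>fejer_mean_approximates_lipschitz\<close>). Restriction shrinks distances, because the
  Lipschitz ball becomes smaller; it does so by at most \<open>2 \<gamma>\<^sub>n\<close>, and each \<open>\<psi>\<close> is within \<open>\<gamma>\<^sub>n\<close> of the
  restriction of \<open>\<psi> \<circ> K\<^sub>n\<close>, because \<open>|\<langle>\<phi>(f) x, x\<rangle>| \<le> \<parallel>f\<parallel> \<parallel>x\<parallel>\<^sup>2\<close>.

  A map with these two properties bounds the Gromov-Hausdorff distance by \<open>2 \<gamma>\<^sub>n\<close>: glue the spaces along
  bridges, and embed the resulting totally bounded space into a compact set of sequences
  (\<open>gromov_hausdorff_le_if_almost_isometry\<close>, \<open>totally_bounded_embeds_in_compact\<close>). Total boundedness
  holds for trigonometric polynomials because they form a finite-dimensional space, and it passes to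
  \<open>C(S\<^sup>1)\<close> along the restrictions.
\<close>

section \<open>Comparing metric spaces along an almost isometry\<close>

lemma (in Metric_space) mtotally_bounded_if_finite_fibres:
  assumes "\<And>\<epsilon>. \<epsilon> > 0 \<Longrightarrow>
    \<exists>h :: 'a \<Rightarrow> 'b. finite (h ` M) \<and> (\<forall>x\<in>M. \<forall>y\<in>M. h x = h y \<longrightarrow> d x y < \<epsilon>)"
  shows "mtotally_bounded M"
  unfolding mtotally_bounded_def
proof (intro allI impI)
  fix \<epsilon> :: real assume "\<epsilon> > 0"
  then obtain h :: "'a \<Rightarrow> 'b" where fin: "finite (h ` M)"
    and h: "\<And>x y. \<lbrakk>x \<in> M; y \<in> M; h x = h y\<rbrakk> \<Longrightarrow> d x y < \<epsilon>"
    using assms by meson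
  obtain K where K: "K \<subseteq> M" "finite K" "h ` M = h ` K"
    using finite_subset_image[OF fin subset_refl] by metis
  have "M \<subseteq> (\<Union>x\<in>K. mball x \<epsilon>)"
  proof
    fix y assume y: "y \<in> M"
    then obtain x where "x \<in> K" "h y = h x" using K by blast
    with h[of x y] K y show "y \<in> (\<Union>x\<in>K. mball x \<epsilon>)" by (auto simp: in_mball)
  qed
  with K show "\<exists>K. finite K \<and> K \<subseteq> M \<and> M \<subseteq> (\<Union>x\<in>K. mball x \<epsilon>)" by blast
qed

text \<open>A uniform Cauchy sequence converges uniformly, and uniform limits of bounded sequences are bounded.\<close>

lemma complete_bounded_sequences: "complete (UNIV :: (nat \<Rightarrow>\<^sub>C real) set)"
  unfolding complete_def
proof (intro allI impI)
  fix f :: "nat \<Rightarrow> nat \<Rightarrow>\<^sub>C real"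
  assume "(\<forall>n. f n \<in> UNIV) \<and> Cauchy f"
  then have "\<forall>e>0. \<exists>N. \<forall>m n x. N \<le> m \<and> N \<le> n \<and> True \<longrightarrow> dist (f m x) (f n x) < e"
    using dist_fun_lt_imp_dist_val_lt unfolding Cauchy_def by metis
  then obtain g where "uniform_limit UNIV f g sequentially"
    unfolding uniform_limit_sequentially_iff uniformly_convergent_eq_cauchy[symmetric] by auto
  then show "\<exists>l\<in>UNIV. f \<longlonglongrightarrow> l"
    using uniform_limit_bcontfunE[OF _ sequentially_bot] by (metis UNIV_I)
qed

text \<open>Kuratowski's embedding: a point is sent to its distances from a dense sequence. The sup metric
  on bounded sequences is complete, so the closure of a totally bounded image is compact.\<close>

lemma totally_bounded_embeds_in_compact:
  fixes M :: "'a set"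
  assumes "Metric_space M d" "Metric_space.mtotally_bounded M d M"
  shows "\<exists>(Z :: (nat \<Rightarrow> real) set) e F. Metric_space Z e \<and>
    compact_space (Metric_space.mtopology Z e) \<and> isometric_embedding M d Z e F"
proof -
  interpret Metric_space M d by fact
  have "\<exists>K. finite K \<and> K \<subseteq> M \<and> M \<subseteq> (\<Union>x\<in>K. mball x (1 / Suc m))" for m
    using assms(2) unfolding mtotally_bounded_def by simp
  then obtain K where K: "\<And>m. finite (K m)" "\<And>m. K m \<subseteq> M"
    and cover: "\<And>m. M \<subseteq> (\<Union>x\<in>K m. mball x (1 / Suc m))"
    by metis
  define D where "D = (\<Union>m. K m)"
  define w where "w = from_nat_into D"
  have D: "countable D" "D \<subseteq> M" using K by (auto simp: D_def intro: countable_finite)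
  have wM: "w i \<in> M" if "x \<in> M" for i x
  proof -
    have "D \<noteq> {}" using cover[of 0] that by (fastforce simp: D_def)
    with D show ?thesis using from_nat_into[of D i] by (auto simp: w_def)
  qed
  have dense: "\<exists>i. d (w i) x < \<epsilon>" if x: "x \<in> M" and \<epsilon>: "\<epsilon> > 0" for x \<epsilon>
  proof -
    obtain m where m: "1 / Suc m < \<epsilon>" using nat_approx_posE[OF \<epsilon>] by blast
    obtain y where "y \<in> K m" "d y x < 1 / Suc m" using cover[of m] x by (auto simp: in_mball)
    moreover from this obtain i where "w i = y"
      using from_nat_into_surj[OF D(1)] by (auto simp: D_def w_def)
    ultimately show ?thesis using m by (metis less_trans)
  qed
  have bdd: "(\<lambda>i. d x (w i)) \<in> bcontfun" if x: "x \<in> M" for x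
  proof -
    obtain B where "\<forall>x\<in>M. \<forall>y\<in>M. d x y \<le> B"
      using mtotally_bounded_imp_mbounded[OF assms(2)] unfolding mbounded_alt by blast
    then show ?thesis unfolding bcontfun_def bounded_iff using x wM[OF x] by fastforce
  qed
  define F where "F x = Bcontfun (\<lambda>i. d x (w i))" for x
  have F: "apply_bcontfun (F x) i = d x (w i)" if "x \<in> M" for x i
    using Bcontfun_inverse[OF bdd[OF that]] by (simp add: F_def)
  have iso: "dist (F x) (F y) = d x y" if x: "x \<in> M" and y: "y \<in> M" for x y
  proof (rule antisym)
    show "dist (F x) (F y) \<le> d x y"
    proof (rule dist_bound)
      fix i show "dist (F x i) (F y i) \<le> d x y"
        using triangle[OF x y wM[OF x, of i]] triangle[OF y x wM[OF x, of i]] commute[of x y]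
        by (simp add: F x y dist_real_def abs_le_iff)
    qed
    show "d x y \<le> dist (F x) (F y)"
    proof (rule field_le_epsilon)
      fix \<epsilon> :: real assume "\<epsilon> > 0"
      then obtain i where i: "d (w i) x < \<epsilon> / 2" using dense[OF x, of "\<epsilon> / 2"] by auto
      have "d x y \<le> d x (w i) + d y (w i)"
        using triangle[OF x wM[OF x, of i] y] commute[of "w i" y] by simp
      also have "\<dots> \<le> 2 * d x (w i) + dist (F x i) (F y i)" by (simp add: F x y dist_real_def)
      also have "\<dots> \<le> \<epsilon> + dist (F x) (F y)"
        using i dist_bounded[of "F x" i "F y"] commute[of x "w i"] by simp
      finally show "d x y \<le> dist (F x) (F y) + \<epsilon>" by simp
    qed
  qed
  define C where "C = closure (F ` M)"
  have "\<exists>k. finite k \<and> C \<subseteq> (\<Union>x\<in>k. ball x \<epsilon>)" if "\<epsilon> > 0" for \<epsilon> :: real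
  proof -
    obtain L where L: "finite L" "L \<subseteq> M" "M \<subseteq> (\<Union>x\<in>L. mball x (\<epsilon> / 2))"
      using assms(2) \<open>\<epsilon> > 0\<close> unfolding mtotally_bounded_def by (meson half_gt_zero)
    have "F ` M \<subseteq> (\<Union>x\<in>F ` L. cball x (\<epsilon> / 2))"
    proof (rule image_subsetI)
      fix y assume "y \<in> M"
      then obtain x where "x \<in> L" "y \<in> mball x (\<epsilon> / 2)" using L(3) by blast
      then show "F y \<in> (\<Union>x\<in>F ` L. cball x (\<epsilon> / 2))" using iso[of x y]
        by (intro UN_I[of "F x"]) (auto simp: in_mball)
    qed
    moreover have "closed (\<Union>x\<in>F ` L. cball x (\<epsilon> / 2))" using L(1) by (intro closed_UN) auto
    ultimately have "C \<subseteq> (\<Union>x\<in>F ` L. cball x (\<epsilon> / 2))"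
      unfolding C_def by (rule closure_minimal)
    also have "\<dots> \<subseteq> (\<Union>x\<in>F ` L. ball x \<epsilon>)" using \<open>\<epsilon> > 0\<close> by (auto simp: dist_commute)
    finally show ?thesis using L(1) by blast
  qed
  moreover have "complete C"
    unfolding C_def by (rule complete_closed_subset[OF _ subset_UNIV complete_bounded_sequences]) simp
  ultimately have comp: "compact C" unfolding compact_eq_totally_bounded by blast
  define Z where "Z = apply_bcontfun ` C"
  define e where "e a b = dist (Bcontfun a) (Bcontfun b)" for a b :: "nat \<Rightarrow> real"
  have e: "e (apply_bcontfun u) (apply_bcontfun v) = dist u v" for u v
    by (simp add: e_def apply_bcontfun_inverse)
  interpret Z: Metric_space Z e
    by unfold_locales
      (auto simp: Z_def e dist_commute dist_triangle apply_bcontfun_inject, simp_all add: e_def dist_commute)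
  have "\<exists>l\<in>Z. \<exists>r. strict_mono r \<and> limitin Z.mtopology (\<sigma> \<circ> r) l sequentially"
    if "range \<sigma> \<subseteq> Z" for \<sigma> :: "nat \<Rightarrow> nat \<Rightarrow> real"
  proof -
    have "\<exists>u\<in>C. \<sigma> i = apply_bcontfun u" for i using that by (auto simp: Z_def)
    then obtain u where u: "\<And>i. u i \<in> C" "\<And>i. \<sigma> i = apply_bcontfun (u i)" by metis
    obtain l r where l: "l \<in> C" "strict_mono r" "(u \<circ> r) \<longlonglongrightarrow> l"
      using comp u(1) unfolding compact_def by metis
    have "limitin Z.mtopology (\<sigma> \<circ> r) (apply_bcontfun l) sequentially"
      unfolding Z.limitin_metric
      using l u by (auto simp: Z_def e tendsto_iff)
    then show ?thesis using l by (auto simp: Z_def)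
  qed
  then have "compact_space Z.mtopology" unfolding Z.compact_space_sequentially by metis
  moreover have "isometric_embedding M d Z e (apply_bcontfun \<circ> F)"
    unfolding isometric_embedding_def
  proof (intro conjI)
    show "apply_bcontfun \<circ> F \<in> M \<rightarrow> Z" using closure_subset by (fastforce simp: Z_def C_def)
    show "inj_on (apply_bcontfun \<circ> F) M"
      using iso zero by (intro inj_onI) (metis apply_bcontfun_inject comp_apply dist_self)
  qed (simp add: e iso)
  ultimately show ?thesis using Z.Metric_space_axioms by blast
qed

text \<open>A map \<open>r\<close> with distortion at most \<open>2 \<epsilon>\<close> glues \<open>X\<close> to \<open>Y\<close> by a bridge of length \<open>\<epsilon>\<close> from each
  \<open>x\<close> to \<open>r x\<close>. The distance across is the cheapest way to walk, cross a bridge and walk on.\<close>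

lemma gromov_hausdorff_le_if_almost_isometry:
  fixes X :: "'a set" and Y :: "'b set"
  assumes X: "Metric_space X dX" "Metric_space.mtotally_bounded X dX X"
    and Y: "Metric_space Y dY" "Metric_space.mtotally_bounded Y dY Y"
    and r: "\<And>x. x \<in> X \<Longrightarrow> r x \<in> Y"
    and \<epsilon>: "\<epsilon> > 0"
    and distortion: "\<And>x x'. \<lbrakk>x \<in> X; x' \<in> X\<rbrakk> \<Longrightarrow> \<bar>dY (r x) (r x') - dX x x'\<bar> \<le> 2 * \<epsilon>"
    and dense: "\<And>y. y \<in> Y \<Longrightarrow> \<exists>x\<in>X. dY (r x) y \<le> \<epsilon>"
  shows "gromov_hausdorff_distance Y dY X dX \<le> ennreal (2 * \<epsilon>)"
proof -
  interpret X: Metric_space X dX by fact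
  interpret Y: Metric_space Y dY by fact
  \<comment> \<open>Inserting \<open>x\<close> keeps the infimum nonempty, hence nonnegative, for arguments outside \<open>X\<close>.\<close>
  define \<rho> where "\<rho> x y = (INF x'\<in>insert x X. dX x x' + \<epsilon> + dY (r x') y)" for x y
  have \<rho>_le: "\<rho> x y \<le> dX x x' + \<epsilon> + dY (r x') y" if "x' \<in> X" for x x' y
    unfolding \<rho>_def using that \<epsilon>
    by (intro cINF_lower) (auto simp: bdd_below_def intro!: exI[of _ 0] add_nonneg_nonneg)
  have le_\<rho>: "c \<le> \<rho> x y"
    if "x \<in> X" "\<And>x'. x' \<in> X \<Longrightarrow> c \<le> dX x x' + \<epsilon> + dY (r x') y" for c x y
    unfolding \<rho>_def using that by (intro cINF_greatest) auto
  have near: "\<exists>x'\<in>X. dX x x' + \<epsilon> + dY (r x') y < \<rho> x y + \<delta>" if "x \<in> X" "\<delta> > 0" for x y \<delta>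
  proof (rule ccontr)
    assume "\<not> ?thesis"
    then have "\<rho> x y + \<delta> \<le> \<rho> x y" using that(1) by (intro le_\<rho>) (auto simp: not_less)
    then show False using that by simp
  qed
  define d where "d u v = (case (u, v) of
      (Inl x, Inl x') \<Rightarrow> dX x x' | (Inr y, Inr y') \<Rightarrow> dY y y'
    | (Inl x, Inr y) \<Rightarrow> \<rho> x y | (Inr y, Inl x) \<Rightarrow> \<rho> x y)" for u v :: "'a + 'b"
  have d[simp]: "d (Inl x) (Inl x') = dX x x'" "d (Inr y) (Inr y') = dY y y'"
      "d (Inl x) (Inr y) = \<rho> x y" "d (Inr y) (Inl x) = \<rho> x y" for x x' y y'
    by (simp_all add: d_def)
  have \<rho>_pos: "\<epsilon> \<le> \<rho> x y" if "x \<in> X" "y \<in> Y" for x y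
    using that r by (intro le_\<rho>) (auto intro: add_increasing2)
  \<comment> \<open>The triangle inequality by the positions of the three points; only \<open>tri3\<close> and \<open>tri4\<close>, which cross
    two bridges, need the distortion bound, and they use up exactly its \<open>2 \<epsilon>\<close>.\<close>
  have tri1: "\<rho> x y \<le> dX x x' + \<rho> x' y" if "x \<in> X" "x' \<in> X" "y \<in> Y" for x x' y
  proof -
    have "\<rho> x y - dX x x' \<le> \<rho> x' y"
    proof (rule le_\<rho>)
      fix z assume z: "z \<in> X"
      show "\<rho> x y - dX x x' \<le> dX x' z + \<epsilon> + dY (r z) y"
        using \<rho>_le[OF z, of x y] X.triangle[OF that(1,2) z] by simp
    qed fact
    then show ?thesis by simp
  qed
  have tri2: "\<rho> x y' \<le> \<rho> x y + dY y y'" if "x \<in> X" "y \<in> Y" "y' \<in> Y" for x y y'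
  proof -
    have "\<rho> x y' - dY y y' \<le> \<rho> x y"
    proof (rule le_\<rho>)
      fix z assume z: "z \<in> X"
      show "\<rho> x y' - dY y y' \<le> dX x z + \<epsilon> + dY (r z) y"
        using \<rho>_le[OF z, of x y'] Y.triangle[OF r[OF z] that(2,3)] by simp
    qed fact
    then show ?thesis by simp
  qed
  have tri3: "dX x x' \<le> \<rho> x y + \<rho> x' y" if x: "x \<in> X" "x' \<in> X" and y: "y \<in> Y" for x x' y
  proof (rule field_le_epsilon)
    fix \<delta> :: real assume \<delta>: "\<delta> > 0"
    obtain z where z: "z \<in> X" "dX x z + \<epsilon> + dY (r z) y < \<rho> x y + \<delta> / 2"
      using near[OF x(1) half_gt_zero[OF \<delta>], of y] by blast
    obtain z' where z': "z' \<in> X" "dX x' z' + \<epsilon> + dY (r z') y < \<rho> x' y + \<delta> / 2"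
      using near[OF x(2) half_gt_zero[OF \<delta>], of y] by blast
    have "dX x x' \<le> dX x z + dX z z' + dX x' z'"
      using X.triangle[OF that(1) z(1) that(2)] X.triangle[OF z(1) z'(1) that(2)]
        X.commute[of x' z'] by simp
    moreover have "dX z z' \<le> dY (r z) (r z') + 2 * \<epsilon>" using distortion[OF z(1) z'(1)] by simp
    moreover have "dY (r z) (r z') \<le> dY (r z) y + dY (r z') y"
      using Y.triangle[OF r[OF z(1)] that(3) r[OF z'(1)]] Y.commute[of y] by simp
    ultimately show "dX x x' \<le> \<rho> x y + \<rho> x' y + \<delta>" using z z' by simp
  qed
  have tri4: "dY y y' \<le> \<rho> x y + \<rho> x y'" if x: "x \<in> X" and y: "y \<in> Y" "y' \<in> Y" for x y y'
  proof (rule field_le_epsilon)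
    fix \<delta> :: real assume \<delta>: "\<delta> > 0"
    obtain z where z: "z \<in> X" "dX x z + \<epsilon> + dY (r z) y < \<rho> x y + \<delta> / 2"
      using near[OF x half_gt_zero[OF \<delta>], of y] by blast
    obtain z' where z': "z' \<in> X" "dX x z' + \<epsilon> + dY (r z') y' < \<rho> x y' + \<delta> / 2"
      using near[OF x half_gt_zero[OF \<delta>], of y'] by blast
    have "dY y y' \<le> dY (r z) y + dY (r z) (r z') + dY (r z') y'"
      using Y.triangle[OF that(2) r[OF z(1)] that(3)] Y.triangle[OF r[OF z(1)] r[OF z'(1)] that(3)]
        Y.commute[of y] by simp
    moreover have "dY (r z) (r z') \<le> dX z z' + 2 * \<epsilon>" using distortion[OF z(1) z'(1)] by simp
    moreover have "dX z z' \<le> dX x z + dX x z'"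
      using X.triangle[OF z(1) that(1) z'(1)] X.commute[of z] by simp
    ultimately show "dY y y' \<le> \<rho> x y + \<rho> x y' + \<delta>" using z z' by simp
  qed
  interpret W: Metric_space "X <+> Y" d
  proof
    fix u v w :: "'a + 'b"
    have \<rho>_nonneg: "0 \<le> \<rho> x y" for x y
      unfolding \<rho>_def using \<epsilon> by (intro cINF_greatest) (auto intro!: add_nonneg_nonneg)
    show "0 \<le> d u v" by (cases u; cases v) (auto simp: \<rho>_nonneg)
    show "d u v = d v u" by (cases u; cases v) (auto simp: X.commute Y.commute)
    assume u: "u \<in> X <+> Y" and v: "v \<in> X <+> Y"
    show "d u v = 0 \<longleftrightarrow> u = v" using u v \<rho>_pos \<epsilon> by (auto; fastforce)
    assume w: "w \<in> X <+> Y"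
    show "d u w \<le> d u v + d v w"
      using u v w tri1 tri2 tri3 tri4 X.triangle Y.triangle X.commute Y.commute
      by (auto simp: add.commute; metis add.commute)
  qed
  have tb: "W.mtotally_bounded (X <+> Y)"
    unfolding W.mtotally_bounded_def
  proof (intro allI impI)
    fix \<delta> :: real assume "\<delta> > 0"
    obtain K where K: "finite K" "K \<subseteq> X" "X \<subseteq> (\<Union>x\<in>K. X.mball x \<delta>)"
      using X(2) \<open>\<delta> > 0\<close> unfolding X.mtotally_bounded_def by meson
    obtain L where L: "finite L" "L \<subseteq> Y" "Y \<subseteq> (\<Union>x\<in>L. Y.mball x \<delta>)"
      using Y(2) \<open>\<delta> > 0\<close> unfolding Y.mtotally_bounded_def by meson
    have "X <+> Y \<subseteq> (\<Union>u\<in>K <+> L. W.mball u \<delta>)"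
    proof
      fix u assume "u \<in> X <+> Y"
      then show "u \<in> (\<Union>u\<in>K <+> L. W.mball u \<delta>)"
      proof
        fix x assume u: "u = Inl x" "x \<in> X"
        then obtain z where "z \<in> K" "x \<in> X.mball z \<delta>" using K(3) by blast
        then show ?thesis using u K(2) by (intro UN_I[of "Inl z"]) (auto simp: W.in_mball X.in_mball)
      next
        fix y assume u: "u = Inr y" "y \<in> Y"
        then obtain z where "z \<in> L" "y \<in> Y.mball z \<delta>" using L(3) by blast
        then show ?thesis using u L(2) by (intro UN_I[of "Inr z"]) (auto simp: W.in_mball Y.in_mball)
      qed
    qed
    moreover have "finite (K <+> L)" "K <+> L \<subseteq> X <+> Y" using K L by auto
    ultimately show "\<exists>K. finite K \<and> K \<subseteq> X <+> Y \<and> X <+> Y \<subseteq> (\<Union>u\<in>K. W.mball u \<delta>)" by blast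
  qed
  obtain Z :: "(nat \<Rightarrow> real) set" and e F where Z: "Metric_space Z e"
      "compact_space (Metric_space.mtopology Z e)" and F: "isometric_embedding (X <+> Y) d Z e F"
    using totally_bounded_embeds_in_compact[OF W.Metric_space_axioms tb] by blast
  have FX: "isometric_embedding X dX Z e (F \<circ> Inl)" and FY: "isometric_embedding Y dY Z e (F \<circ> Inr)"
    using F unfolding isometric_embedding_def by (auto simp: inj_on_def Pi_iff) (metis InlI InrI d)+
  have eF: "e (F (Inr y)) (F (Inl x)) = \<rho> x y" if "x \<in> X" "y \<in> Y" for x y
    using F that unfolding isometric_embedding_def by (metis InlI InrI d(4))
  have "gromov_hausdorff_distance Y dY X dX \<le> hausdorff_distance e ((F \<circ> Inr) ` Y) ((F \<circ> Inl) ` X)"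
    unfolding gromov_hausdorff_distance_def using Z FX FY by (intro Inf_lower) blast
  also have "\<dots> \<le> ennreal (2 * \<epsilon>)"
    unfolding hausdorff_distance_def
  proof (intro max.boundedI SUP_least)
    fix a assume "a \<in> (F \<circ> Inr) ` Y"
    then obtain y where y: "y \<in> Y" "a = F (Inr y)" by auto
    then obtain x where x: "x \<in> X" "dY (r x) y \<le> \<epsilon>" using dense by blast
    have "\<rho> x y \<le> 2 * \<epsilon>" using \<rho>_le[of x x y] x by simp
    then have "ennreal (e a (F (Inl x))) \<le> ennreal (2 * \<epsilon>)" using eF x y by (simp add: ennreal_leI)
    then show "(INF b\<in>(F \<circ> Inl) ` X. ennreal (e a b)) \<le> ennreal (2 * \<epsilon>)"
      using x(1) by (intro INF_lower2[of "F (Inl x)"]) auto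
  next
    fix b assume "b \<in> (F \<circ> Inl) ` X"
    then obtain x where x: "x \<in> X" "b = F (Inl x)" by auto
    have "\<rho> x (r x) \<le> 2 * \<epsilon>" using \<rho>_le[of x x "r x"] x r \<epsilon> by simp
    then have "ennreal (e (F (Inr (r x))) b) \<le> ennreal (2 * \<epsilon>)" using eF x r by (simp add: ennreal_leI)
    then show "(INF a\<in>(F \<circ> Inr) ` Y. ennreal (e a b)) \<le> ennreal (2 * \<epsilon>)"
      using x(1) r by (intro INF_lower2[of "F (Inr (r x))"]) auto
  qed
  finally show ?thesis .
qed

text \<open>A metric in the sense of \<^locale>\<open>Metric_space\<close> is nonnegative and symmetric on the whole type, hence the
  value \<open>0\<close> outside \<open>M\<close>.\<close>

definition dist_on :: "'a set \<Rightarrow> ('a \<Rightarrow> 'a \<Rightarrow> real) \<Rightarrow> 'a \<Rightarrow> 'a \<Rightarrow> real"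
  where "dist_on M d x y = (if x \<in> M \<and> y \<in> M then d x y else 0)"

lemma Metric_space_dist_on:
  assumes "\<And>x y. \<lbrakk>x \<in> M; y \<in> M\<rbrakk> \<Longrightarrow> 0 \<le> d x y"
    and "\<And>x y. \<lbrakk>x \<in> M; y \<in> M\<rbrakk> \<Longrightarrow> d x y = d y x"
    and "\<And>x y. \<lbrakk>x \<in> M; y \<in> M\<rbrakk> \<Longrightarrow> d x y = 0 \<longleftrightarrow> x = y"
    and "\<And>x y z. \<lbrakk>x \<in> M; y \<in> M; z \<in> M\<rbrakk> \<Longrightarrow> d x z \<le> d x y + d y z"
  shows "Metric_space M (dist_on M d)"
  using assms by unfold_locales (auto simp: dist_on_def)

lemma gromov_hausdorff_distance_dist_on:
  "gromov_hausdorff_distance M (dist_on M d) N (dist_on N d') = gromov_hausdorff_distance M d N d'"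
  by (simp add: gromov_hausdorff_distance_def isometric_embedding_def dist_on_def cong: conj_cong)

text \<open>The fibres of a finite approximation of \<open>r x\<close> have small diameter.\<close>

lemma totally_bounded_if_almost_isometries:
  fixes X :: "'a set" and dY :: "nat \<Rightarrow> 'b \<Rightarrow> 'b \<Rightarrow> real"
  assumes X: "Metric_space X dX"
    and Y: "\<And>n. Metric_space (Y n) (dY n)" "\<And>n. Metric_space.mtotally_bounded (Y n) (dY n) (Y n)"
    and r: "\<And>n x. x \<in> X \<Longrightarrow> r n x \<in> Y n"
    and \<epsilon>: "\<epsilon> \<longlonglongrightarrow> 0"
    and distortion: "\<And>n x x'. \<lbrakk>x \<in> X; x' \<in> X\<rbrakk> \<Longrightarrow> dX x x' \<le> dY n (r n x) (r n x') + \<epsilon> n"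
  shows "Metric_space.mtotally_bounded X dX X"
proof -
  interpret X: Metric_space X dX by fact
  show ?thesis
  proof (rule X.mtotally_bounded_if_finite_fibres)
    fix \<delta> :: real assume \<delta>: "\<delta> > 0"
    then obtain n where n: "\<epsilon> n < \<delta> / 2"
      using order_tendstoD(2)[OF \<epsilon>, of "\<delta> / 2"] by (auto simp: eventually_sequentially)
    interpret Y: Metric_space "Y n" "dY n" by fact
    obtain K where K: "finite K" "K \<subseteq> Y n" "Y n \<subseteq> (\<Union>x\<in>K. Y.mball x (\<delta> / 4))"
      using Y(2)[of n] \<delta> unfolding Y.mtotally_bounded_def by (meson divide_pos_pos zero_less_numeral)
    have "\<exists>z\<in>K. dY n z (r n x) < \<delta> / 4" if "x \<in> X" for x
      using r[OF that, of n] K(3) unfolding Y.in_mball[symmetric] by (fastforce simp: Y.in_mball)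
    then obtain h where h: "\<And>x. x \<in> X \<Longrightarrow> h x \<in> K" "\<And>x. x \<in> X \<Longrightarrow> dY n (h x) (r n x) < \<delta> / 4"
      by metis
    have "dX x y < \<delta>" if "x \<in> X" "y \<in> X" "h x = h y" for x y
      using Y.triangle[of "r n x" "h x" "r n y"] r[OF that(1), of n] r[OF that(2), of n]
        h[OF that(1)] h[OF that(2)] that(3) K(2) n distortion[OF that(1,2), of n]
        Y.commute[of "r n x" "h x"] by fastforce
    moreover have "finite (h ` X)" using h(1) K(1) by (meson finite_subset image_subsetI)
    ultimately show "\<exists>h :: 'a \<Rightarrow> 'b. finite (h ` X) \<and> (\<forall>x\<in>X. \<forall>y\<in>X. h x = h y \<longrightarrow> dX x y < \<delta>)"
      by blast
  qed
qed


section \<open>Arc length on the circle\<close>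

lemma Rep_circle_pt [simp]: "Rep_circle (circle_pt t) = cis t"
  by (simp add: circle_pt_def Abs_circle_inverse)

lemma norm_Rep_circle [simp]: "cmod (Rep_circle z) = 1"
  using Rep_circle[of z] by simp

lemma Rep_circle_nonzero [simp]: "Rep_circle z \<noteq> 0"
  by (metis norm_Rep_circle norm_zero zero_neq_one)

lemma circle_pt_eq_iff: "circle_pt s = circle_pt t \<longleftrightarrow> cis s = cis t"
  by (metis Rep_circle_inject Rep_circle_pt)

lemma continuous_Rep_circle: "continuous_on S Rep_circle"
  unfolding continuous_on_iff dist_circle_def by blast

lemma continuous_circle_pt: "continuous_on S circle_pt"
  unfolding continuous_on_iff dist_circle_def Rep_circle_pt
  using continuous_on_cis[OF continuous_on_id, of S] unfolding continuous_on_iff by blast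

lemma continuous_comp_circle_pt:
  assumes "continuous_on UNIV f"
  shows "continuous_on S (\<lambda>t. f (circle_pt t))"
  by (rule continuous_on_compose2[OF assms continuous_circle_pt]) simp

lemma circle_pt_2pi [simp]: "circle_pt (2 * pi) = circle_pt 0"
  by (simp add: circle_pt_eq_iff)

definition angle :: "circle \<Rightarrow> real"
  where "angle z = Arg2pi (Rep_circle z)"

lemma angle_range: "0 \<le> angle z" "angle z < 2 * pi"
  by (simp_all add: angle_def Arg2pi_ge_0 Arg2pi_lt_2pi)

lemma circle_pt_angle [simp]: "circle_pt (angle z) = z"
proof -
  have "Rep_circle (circle_pt (angle z)) = Rep_circle z"
    using Arg2pi_eq[of "Rep_circle z"] by (simp add: angle_def cis_conv_exp)
  then show ?thesis by (simp only: Rep_circle_inject)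
qed

lemma angle_circle_pt: "0 \<le> t \<Longrightarrow> t < 2 * pi \<Longrightarrow> angle (circle_pt t) = t"
  unfolding angle_def by (rule Arg2pi_unique[of 1]) (simp_all add: cis_conv_exp)

lemma ex_circle_pt: "\<exists>t. z = circle_pt t \<and> 0 \<le> t \<and> t < 2 * pi"
  using angle_range circle_pt_angle by metis

lemma compact_UNIV_circle: "compact (UNIV :: circle set)"
proof -
  have "(UNIV :: circle set) = circle_pt ` {0..2 * pi}"
    using ex_circle_pt by (force simp: image_iff)
  then show ?thesis using compact_continuous_image[OF continuous_circle_pt compact_Icc] by metis
qed

lemma measurable_circle_pt [measurable]: "circle_pt \<in> borel_measurable borel"
  by (rule borel_measurable_continuous_onI[OF continuous_circle_pt])

lemma measurable_angle [measurable]: "angle \<in> borel_measurable borel"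
proof (rule borel_measurable_continuous_countable_exceptions)
  show "continuous_on (- {circle_pt 0}) angle"
    unfolding angle_def
  proof (rule continuous_on_compose2[OF _ continuous_Rep_circle])
    show "Rep_circle ` (- {circle_pt 0}) \<subseteq> - \<real>\<^sub>\<ge>\<^sub>0"
    proof (clarsimp)
      fix z assume "Rep_circle z \<in> \<real>\<^sub>\<ge>\<^sub>0" "z \<noteq> circle_pt 0"
      then have "Rep_circle z = 1"
        using norm_Rep_circle[of z] by (auto simp del: norm_Rep_circle elim!: nonneg_Reals_cases)
      with \<open>z \<noteq> circle_pt 0\<close> show False by (metis Rep_circle_inject Rep_circle_pt cis_zero)
    qed
    show "continuous_on (- \<real>\<^sub>\<ge>\<^sub>0) Arg2pi"
      using continuous_at_Arg2pi by (intro continuous_at_imp_continuous_on) auto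
  qed
qed simp

lemma sets_arc_measure [measurable_cong, simp]: "sets arc_measure = sets borel"
  and space_arc_measure [simp]: "space arc_measure = UNIV"
  by (simp_all add: arc_measure_def)

lemma measurable_circle_pt_arc: "circle_pt \<in> restrict_space lborel {0..<2 * pi} \<rightarrow>\<^sub>M borel"
  by (rule measurable_restrict_space1) simp

text \<open>The closed interval \<open>[0, 2\<pi>]\<close> counts the point \<open>1\<close> twice, on a null set.\<close>

lemma AE_indicator_closed_interval:
  "AE t in lborel. indicator {0..<2 * pi} t *\<^sub>R u t = indicator {0..2 * pi} t *\<^sub>R (u t :: 'b::real_vector)"
  using AE_lborel_singleton[of "2 * pi"] by eventually_elim (auto simp: indicator_def)

lemma
  fixes u :: "circle \<Rightarrow> 'b::{banach, second_countable_topology}"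
  assumes [measurable]: "u \<in> borel_measurable borel"
  shows integral_arc_measure:
      "(\<integral>z. u z \<partial>arc_measure) = (LINT t:{0..2 * pi}|lborel. u (circle_pt t))"
    and integrable_arc_measure:
      "integrable arc_measure u \<longleftrightarrow> set_integrable lborel {0..2 * pi} (\<lambda>t. u (circle_pt t))"
proof -
  note [measurable] = measurable_circle_pt_arc
  have "(\<integral>z. u z \<partial>arc_measure) = (LINT t:{0..<2 * pi}|lborel. u (circle_pt t))"
    unfolding arc_measure_def by (simp add: integral_distr integral_restrict_space set_lebesgue_integral_def)
  also have "\<dots> = (LINT t:{0..2 * pi}|lborel. u (circle_pt t))"
    unfolding set_lebesgue_integral_def
    by (rule integral_cong_AE[OF _ _ AE_indicator_closed_interval]) simp_all
  finally show "(\<integral>z. u z \<partial>arc_measure) = (LINT t:{0..2 * pi}|lborel. u (circle_pt t))" .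
  have "integrable arc_measure u \<longleftrightarrow> set_integrable lborel {0..<2 * pi} (\<lambda>t. u (circle_pt t))"
    unfolding arc_measure_def
    by (simp add: integrable_distr_eq integrable_restrict_space set_integrable_def)
  also have "\<dots> \<longleftrightarrow> set_integrable lborel {0..2 * pi} (\<lambda>t. u (circle_pt t))"
    unfolding set_integrable_def
    by (rule integrable_cong_AE[OF _ _ AE_indicator_closed_interval]) simp_all
  finally show "integrable arc_measure u \<longleftrightarrow> set_integrable lborel {0..2 * pi} (\<lambda>t. u (circle_pt t))" .
qed

lemma AE_arc_measureD:
  assumes "AE z in arc_measure. P z"
  shows "AE t in lborel. t \<in> {0..<2 * pi} \<longrightarrow> P (circle_pt t)"
  using AE_distrD[OF measurable_circle_pt_arc assms[unfolded arc_measure_def]]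
  by (simp add: AE_restrict_space_iff)

lemma finite_arc_measure: "finite_measure arc_measure"
proof
  have "emeasure arc_measure UNIV = emeasure lborel {0..<2 * pi}"
    unfolding arc_measure_def
    by (subst emeasure_distr[OF measurable_circle_pt_arc])
      (simp_all add: emeasure_restrict_space space_restrict_space)
  then show "emeasure arc_measure (space arc_measure) \<noteq> \<infinity>" by simp
qed

lemma L2_circle_measurable: "\<xi> \<in> L2_circle \<Longrightarrow> \<xi> \<in> borel_measurable borel"
  using measurable_cong_sets[OF sets_arc_measure refl] by (auto simp: L2_circle_def)

lemma bounded_in_L2_circle:
  assumes [measurable]: "\<xi> \<in> borel_measurable borel" and "\<And>z. cmod (\<xi> z) \<le> B"
  shows "\<xi> \<in> L2_circle"
proof -
  interpret finite_measure arc_measure by (rule finite_arc_measure)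
  have "integrable arc_measure (\<lambda>z. (cmod (\<xi> z))\<^sup>2)"
    by (rule integrable_const_bound[of _ "B\<^sup>2"]) (auto intro!: AE_I2 power_mono assms)
  then show ?thesis by (simp add: L2_circle_def)
qed

lemma L2_circle_integrable:
  assumes "\<xi> \<in> L2_circle"
  shows "set_integrable lborel {0..2 * pi} (\<lambda>t. \<xi> (circle_pt t))"
proof -
  interpret finite_measure arc_measure by (rule finite_arc_measure)
  note [measurable] = L2_circle_measurable[OF assms]
  have "integrable arc_measure \<xi>"
  proof (rule Bochner_Integration.integrable_bound)
    show "integrable arc_measure (\<lambda>z. 1 + (cmod (\<xi> z))\<^sup>2)"
      using assms by (auto simp: L2_circle_def)
    have "x \<le> 1 + x\<^sup>2" for x :: real
      using zero_le_power2[of "x - 1 / 2"] by (simp add: power2_eq_square algebra_simps)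
    then show "AE z in arc_measure. norm (\<xi> z) \<le> norm (1 + (cmod (\<xi> z))\<^sup>2)"
      by (intro AE_I2) simp
  qed simp
  then show ?thesis by (simp add: integrable_arc_measure)
qed

lemma L2_circle_inner_integrable:
  assumes "\<xi> \<in> L2_circle" "\<eta> \<in> L2_circle"
    and [measurable]: "f \<in> borel_measurable borel" and f: "\<And>z. cmod (f z) \<le> B"
  shows "integrable arc_measure (\<lambda>z. f z * \<xi> z * cnj (\<eta> z))"
proof (rule Bochner_Integration.integrable_bound)
  have [measurable]: "\<xi> \<in> borel_measurable borel" "\<eta> \<in> borel_measurable borel"
      "cnj \<in> borel_measurable borel"
    using assms L2_circle_measurable
    by (auto intro: borel_measurable_continuous_onI[OF continuous_on_cnj[OF continuous_on_id]])
  show "integrable arc_measure (\<lambda>z. B * ((cmod (\<xi> z))\<^sup>2 + (cmod (\<eta> z))\<^sup>2))"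
    using assms by (auto simp: L2_circle_def)
  have "x * y \<le> x\<^sup>2 + y\<^sup>2" for x y :: real
    using zero_le_power2[of "x - y"] zero_le_power2[of x] zero_le_power2[of y]
    unfolding power2_diff by linarith
  moreover have "0 \<le> B" using f[of undefined] norm_ge_zero[of "f undefined"] by linarith
  ultimately show "AE z in arc_measure. norm (f z * \<xi> z * cnj (\<eta> z))
      \<le> norm (B * ((cmod (\<xi> z))\<^sup>2 + (cmod (\<eta> z))\<^sup>2))"
    by (intro AE_I2) (auto simp: norm_mult mult.assoc intro!: mult_mono f)
  show "(\<lambda>z. f z * \<xi> z * cnj (\<eta> z)) \<in> borel_measurable arc_measure" by measurable
qed

lemma circle_bounded:
  assumes "continuous_on UNIV (f :: circle \<Rightarrow> complex)"
  obtains B where "\<And>z. cmod (f z) \<le> B"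
  using compact_imp_bounded[OF compact_continuous_image[OF assms compact_UNIV_circle]]
  unfolding bounded_iff by auto

lemma set_lborel_integral_continuous:
  fixes u :: "real \<Rightarrow> 'b::euclidean_space"
  assumes "continuous_on {a..b} u"
  shows "set_integrable lborel {a..b} u" "(LINT t:{a..b}|lborel. u t) = integral {a..b} u"
proof -
  show "set_integrable lborel {a..b} u"
    unfolding set_integrable_def by (rule borel_integrable_compact[OF compact_Icc assms])
  then show "(LINT t:{a..b}|lborel. u t) = integral {a..b} u"
    by (rule set_borel_integral_eq_integral)
qed

lemma integral_arc_measure_angle:
  fixes w :: "real \<Rightarrow> 'b::euclidean_space"
  assumes "continuous_on UNIV w"
  shows "(\<integral>z. w (angle z) \<partial>arc_measure) = integral {0..2 * pi} w"
proof -
  have [measurable]: "w \<in> borel_measurable borel" by (rule borel_measurable_continuous_onI[OF assms])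
  have "(\<integral>z. w (angle z) \<partial>arc_measure) = (LINT t:{0..2 * pi}|lborel. w (angle (circle_pt t)))"
    by (rule integral_arc_measure) measurable
  also have "\<dots> = (LINT t:{0..2 * pi}|lborel. w t)"
    unfolding set_lebesgue_integral_def
  proof (rule integral_cong_AE)
    show "AE t in lborel. indicator {0..2 * pi} t *\<^sub>R w (angle (circle_pt t)) = indicator {0..2 * pi} t *\<^sub>R w t"
      using AE_lborel_singleton[of "2 * pi"]
      by eventually_elim (auto simp: indicator_def angle_circle_pt)
  qed measurable
  also have "\<dots> = integral {0..2 * pi} w"
    by (rule set_lborel_integral_continuous) (rule continuous_on_subset[OF assms subset_UNIV])
  finally show ?thesis .
qed


section \<open>Bump functions detect signs\<close>

text \<open>The square makes the profile continuously differentiable, so that a bump lies in the domain of \<open>D\<close>.\<close>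

definition bump_profile :: "real \<Rightarrow> real \<Rightarrow> real \<Rightarrow> real"
  where "bump_profile a c t = (max 0 ((t - a) * (c - t)))\<^sup>2"

lemma continuous_bump_profile: "continuous_on S (bump_profile a c)"
  unfolding bump_profile_def[abs_def] by (intro continuous_intros)

lemma bump_profile_eq_0: "t \<le> a \<or> c \<le> t \<Longrightarrow> a \<le> c \<Longrightarrow> bump_profile a c t = 0"
  by (auto simp: bump_profile_def mult_le_0_iff intro!: max_absorb1)

lemma bump_profile_pos: "a < t \<Longrightarrow> t < c \<Longrightarrow> 0 < bump_profile a c t"
  by (auto simp: bump_profile_def)

definition bump :: "real \<Rightarrow> real \<Rightarrow> circle \<Rightarrow> real"
  where "bump a c z = bump_profile a c (angle z)"

lemma measurable_bump [measurable]: "bump a c \<in> borel_measurable borel"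
proof -
  have [measurable]: "bump_profile a c \<in> borel_measurable borel"
    by (rule borel_measurable_continuous_onI[OF continuous_bump_profile])
  show ?thesis unfolding bump_def[abs_def] by measurable
qed

lemma bump_bounded:
  assumes "0 < a" "a < c" "c < 2 * pi"
  obtains B where "\<And>z. \<bar>bump a c z\<bar> \<le> B"
proof -
  have "bounded (bump_profile a c ` {0..2 * pi})"
    by (intro compact_imp_bounded compact_continuous_image continuous_bump_profile compact_Icc)
  then obtain B where "\<forall>t\<in>{0..2 * pi}. \<bar>bump_profile a c t\<bar> \<le> B" unfolding bounded_iff by auto
  moreover have "angle z \<in> {0..2 * pi}" for z using angle_range[of z] by simp
  ultimately show ?thesis using that[of B] by (simp add: bump_def)
qed

lemma bump_in_L2_circle:
  assumes "0 < a" "a < c" "c < 2 * pi"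
  shows "(\<lambda>z. w * of_real (bump a c z)) \<in> L2_circle"
proof -
  obtain B where "\<And>z. \<bar>bump a c z\<bar> \<le> B" using bump_bounded[OF assms] by blast
  then show ?thesis
    by (intro bounded_in_L2_circle[of _ "cmod w * B"]) (auto simp: norm_mult intro!: mult_left_mono)
qed

text \<open>A continuous function that is negative somewhere is negative on an interval inside
  \<open>(0, 2\<pi>)\<close>, and a bump supported in that interval makes the integral negative.\<close>

lemma nonneg_if_bump_integrals_nonneg:
  fixes \<Phi> :: "real \<Rightarrow> real"
  assumes cont: "continuous_on UNIV \<Phi>"
    and int: "\<And>a c. \<lbrakk>0 < a; a < c; c < 2 * pi\<rbrakk> \<Longrightarrow>
      0 \<le> integral {0..2 * pi} (\<lambda>t. \<Phi> t * (bump_profile a c t)\<^sup>2)"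
    and t: "0 \<le> t" "t < 2 * pi"
  shows "0 \<le> \<Phi> t"
proof (rule ccontr)
  assume neg: "\<not> 0 \<le> \<Phi> t"
  have "open {s. \<Phi> s < 0}" by (intro open_Collect_less continuous_intros cont)
  then obtain \<delta> where \<delta>: "\<delta> > 0" "ball t \<delta> \<subseteq> {s. \<Phi> s < 0}"
    using neg unfolding open_contains_ball by (auto simp: not_le)
  define \<epsilon> where "\<epsilon> = min \<delta> (2 * pi - t)"
  define a c where "a = t + \<epsilon> / 4" and "c = t + \<epsilon> / 2"
  have \<epsilon>: "\<epsilon> > 0" "\<epsilon> \<le> \<delta>" "\<epsilon> \<le> 2 * pi - t" using \<delta> t by (auto simp: \<epsilon>_def)
  have ac: "0 < a" "a < c" "c < 2 * pi" using \<epsilon> t by (auto simp: a_def c_def)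
  have neg': "\<Phi> s < 0" if "a \<le> s" "s \<le> c" for s
  proof -
    have "s \<in> ball t \<delta>" using that \<epsilon> by (auto simp: a_def c_def dist_real_def)
    then show ?thesis using \<delta>(2) by auto
  qed
  define w where "w s = - (\<Phi> s * (bump_profile a c s)\<^sup>2)" for s
  have w_cont: "continuous_on {0..2 * pi} w"
    unfolding w_def
    by (intro continuous_intros continuous_bump_profile continuous_on_subset[OF cont]) simp
  have w_nonneg: "0 \<le> w s" for s
  proof (cases "a < s \<and> s < c")
    case True
    then show ?thesis using neg'[of s] by (simp add: w_def mult_nonpos_nonneg)
  next
    case False
    then show ?thesis using bump_profile_eq_0[of s a c] ac by (auto simp: w_def)
  qed
  have "integral {0..2 * pi} w \<le> 0" using int[OF ac] by (simp add: w_def[abs_def])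
  moreover have "0 \<le> integral {0..2 * pi} w"
    using w_nonneg by (intro integral_nonneg integrable_continuous_interval w_cont) simp
  ultimately have "integral {0..2 * pi} w = 0" by simp
  then have "\<forall>s\<in>{0..2 * pi}. w s = 0"
    using w_nonneg by (subst (asm) integral_eq_0_iff) (auto intro!: w_cont)
  moreover have "(a + c) / 2 \<in> {0..2 * pi}" using ac by simp
  ultimately have "w ((a + c) / 2) = 0" by blast
  moreover have "\<Phi> ((a + c) / 2) * (bump_profile a c ((a + c) / 2))\<^sup>2 < 0"
    using ac bump_profile_pos[of a "(a + c) / 2" c] by (intro mult_neg_pos neg') auto
  ultimately show False by (auto simp: w_def)
qed

text \<open>Tested on the vectors \<open>x \<cdot> b\<close> with \<open>x\<close> constant and \<open>b\<close> a bump, positivity of the matrix of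
  multiplication operators becomes positivity at each point.\<close>

lemma positive_fun_matrix_iff_pointwise:
  assumes cont: "\<And>i j. \<lbrakk>i < m; j < m\<rbrakk> \<Longrightarrow> continuous_on UNIV (F i j)"
  shows "positive_fun_matrix m F \<longleftrightarrow>
    (\<forall>z x. (\<Sum>i<m. \<Sum>j<m. F i j z * x j * cnj (x i)) \<in> \<real>\<^sub>\<ge>\<^sub>0)"
proof -
  have F_int: "integrable arc_measure (\<lambda>z. F i j z * \<xi> j z * cnj (\<xi> i z))"
    if ij: "i < m" "j < m" and \<xi>: "\<And>i. i < m \<Longrightarrow> \<xi> i \<in> L2_circle" for i j \<xi>
  proof -
    obtain B where "\<And>z. cmod (F i j z) \<le> B" using circle_bounded[OF cont[OF ij]] by blast
    then show ?thesis
      using \<xi> ij borel_measurable_continuous_onI[OF cont[OF ij]]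
      by (intro L2_circle_inner_integrable) auto
  qed
  have inner: "(\<Sum>i<m. \<Sum>j<m. L2_inner (\<lambda>z. F i j z * \<xi> j z) (\<xi> i))
      = (\<integral>z. (\<Sum>i<m. \<Sum>j<m. F i j z * \<xi> j z * cnj (\<xi> i z)) \<partial>arc_measure)"
    if "\<And>i. i < m \<Longrightarrow> \<xi> i \<in> L2_circle" for \<xi>
  proof -
    note F = F_int[where \<xi> = \<xi>, OF _ _ that]
    have "(\<integral>z. (\<Sum>i<m. \<Sum>j<m. F i j z * \<xi> j z * cnj (\<xi> i z)) \<partial>arc_measure)
        = (\<Sum>i<m. \<integral>z. (\<Sum>j<m. F i j z * \<xi> j z * cnj (\<xi> i z)) \<partial>arc_measure)"
      using F by (intro Bochner_Integration.integral_sum Bochner_Integration.integrable_sum) auto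
    also have "\<dots> = (\<Sum>i<m. \<Sum>j<m. \<integral>z. F i j z * \<xi> j z * cnj (\<xi> i z) \<partial>arc_measure)"
      using F by (intro sum.cong refl Bochner_Integration.integral_sum) auto
    finally show ?thesis by (simp add: L2_inner_def)
  qed
  show ?thesis
  proof (intro iffI allI)
    assume pw: "\<forall>z x. (\<Sum>i<m. \<Sum>j<m. F i j z * x j * cnj (x i)) \<in> \<real>\<^sub>\<ge>\<^sub>0"
    show "positive_fun_matrix m F"
      unfolding positive_fun_matrix_def
    proof (intro allI impI)
      fix \<xi> assume \<xi>: "\<forall>i<m. \<xi> i \<in> L2_circle"
      define Q where "Q z = (\<Sum>i<m. \<Sum>j<m. F i j z * \<xi> j z * cnj (\<xi> i z))" for z
      have Q: "Q z \<in> \<real>\<^sub>\<ge>\<^sub>0" for z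
        using pw[rule_format, of z "\<lambda>i. \<xi> i z"] by (simp add: Q_def)
      then have "(\<integral>z. Q z \<partial>arc_measure) = (\<integral>z. of_real (Re (Q z)) \<partial>arc_measure)"
        by (intro Bochner_Integration.integral_cong) (auto simp: complex_nonneg_Reals_iff complex_eq_iff)
      also have "\<dots> = of_real (\<integral>z. Re (Q z) \<partial>arc_measure)" by (rule integral_complex_of_real)
      also have "\<dots> \<in> \<real>\<^sub>\<ge>\<^sub>0"
        using Q by (auto simp: complex_nonneg_Reals_iff intro!: integral_nonneg_AE)
      finally show "(\<Sum>i<m. \<Sum>j<m. L2_inner (\<lambda>z. F i j z * \<xi> j z) (\<xi> i)) \<in> \<real>\<^sub>\<ge>\<^sub>0"
        using inner[of \<xi>] \<xi> by (simp add: Q_def)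
    qed
  next
    fix z x assume pos: "positive_fun_matrix m F"
    define Q where "Q z = (\<Sum>i<m. \<Sum>j<m. F i j z * x j * cnj (x i))" for z
    have Q_cont: "continuous_on UNIV Q" unfolding Q_def by (intro continuous_intros cont) auto
    have int: "(\<integral>z. Q z * of_real ((bump a c z)\<^sup>2) \<partial>arc_measure) \<in> \<real>\<^sub>\<ge>\<^sub>0"
      and Q_int: "integrable arc_measure (\<lambda>z. Q z * of_real ((bump a c z)\<^sup>2))"
      if "0 < a" "a < c" "c < 2 * pi" for a c
    proof -
      define \<xi> where "\<xi> i z = x i * of_real (bump a c z)" for i :: nat and z
      have \<xi>: "\<xi> i \<in> L2_circle" for i unfolding \<xi>_def by (rule bump_in_L2_circle[OF that])
      have eq: "(\<Sum>i<m. \<Sum>j<m. F i j z * \<xi> j z * cnj (\<xi> i z)) = Q z * of_real ((bump a c z)\<^sup>2)" for z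
        by (simp add: Q_def \<xi>_def sum_distrib_left power2_eq_square mult_ac)
      have "(\<Sum>i<m. \<Sum>j<m. L2_inner (\<lambda>z. F i j z * \<xi> j z) (\<xi> i)) \<in> \<real>\<^sub>\<ge>\<^sub>0"
        using pos \<xi> unfolding positive_fun_matrix_def by blast
      then show "(\<integral>z. Q z * of_real ((bump a c z)\<^sup>2) \<partial>arc_measure) \<in> \<real>\<^sub>\<ge>\<^sub>0"
        by (simp only: inner[of \<xi>, OF \<xi>] eq)
      show "integrable arc_measure (\<lambda>z. Q z * of_real ((bump a c z)\<^sup>2))"
        unfolding eq[symmetric] using F_int \<xi> by (intro Bochner_Integration.integrable_sum) auto
    qed
    have Q_circle: "continuous_on UNIV (\<lambda>t. Q (circle_pt t))"
      by (rule continuous_comp_circle_pt[OF Q_cont])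
    have Q_profile: "integral {0..2 * pi} (\<lambda>t. Re (Q (circle_pt t)) * (bump_profile a c t)\<^sup>2)
          = Re (\<integral>z. Q z * of_real ((bump a c z)\<^sup>2) \<partial>arc_measure)"
        "integral {0..2 * pi} (\<lambda>t. Im (Q (circle_pt t)) * (bump_profile a c t)\<^sup>2)
          = Im (\<integral>z. Q z * of_real ((bump a c z)\<^sup>2) \<partial>arc_measure)"
      if "0 < a" "a < c" "c < 2 * pi" for a c
    proof -
      have "(\<integral>z. Re (Q z) * (bump a c z)\<^sup>2 \<partial>arc_measure)
          = integral {0..2 * pi} (\<lambda>t. Re (Q (circle_pt t)) * (bump_profile a c t)\<^sup>2)"
        using integral_arc_measure_angle[of "\<lambda>t. Re (Q (circle_pt t)) * (bump_profile a c t)\<^sup>2"]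
        by (simp add: bump_def continuous_intros Q_circle continuous_bump_profile)
      then show "integral {0..2 * pi} (\<lambda>t. Re (Q (circle_pt t)) * (bump_profile a c t)\<^sup>2)
          = Re (\<integral>z. Q z * of_real ((bump a c z)\<^sup>2) \<partial>arc_measure)"
        using integral_Re[OF Q_int[OF that]] by simp
      have "(\<integral>z. Im (Q z) * (bump a c z)\<^sup>2 \<partial>arc_measure)
          = integral {0..2 * pi} (\<lambda>t. Im (Q (circle_pt t)) * (bump_profile a c t)\<^sup>2)"
        using integral_arc_measure_angle[of "\<lambda>t. Im (Q (circle_pt t)) * (bump_profile a c t)\<^sup>2"]
        by (simp add: bump_def continuous_intros Q_circle continuous_bump_profile)
      then show "integral {0..2 * pi} (\<lambda>t. Im (Q (circle_pt t)) * (bump_profile a c t)\<^sup>2)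
          = Im (\<integral>z. Q z * of_real ((bump a c z)\<^sup>2) \<partial>arc_measure)"
        using integral_Im[OF Q_int[OF that]] by simp
    qed
    obtain t where t: "z = circle_pt t" "0 \<le> t" "t < 2 * pi" using ex_circle_pt by blast
    have "0 \<le> Re (Q z)"
      unfolding t(1) using int
      by (intro nonneg_if_bump_integrals_nonneg[where \<Phi> = "\<lambda>t. Re (Q (circle_pt t))", OF _ _ t(2,3)])
        (auto simp: Q_profile complex_nonneg_Reals_iff intro!: continuous_intros Q_circle)
    moreover have "0 \<le> Im (Q z)"
      unfolding t(1) using int
      by (intro nonneg_if_bump_integrals_nonneg[where \<Phi> = "\<lambda>t. Im (Q (circle_pt t))", OF _ _ t(2,3)])
        (auto simp: Q_profile complex_nonneg_Reals_iff intro!: continuous_intros Q_circle)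
    moreover have "0 \<le> - Im (Q z)"
      unfolding t(1) using int
      by (intro nonneg_if_bump_integrals_nonneg[where \<Phi> = "\<lambda>t. - Im (Q (circle_pt t))", OF _ _ t(2,3)])
        (auto simp: Q_profile complex_nonneg_Reals_iff intro!: continuous_intros Q_circle)
    ultimately show "(\<Sum>i<m. \<Sum>j<m. F i j z * x j * cnj (x i)) \<in> \<real>\<^sub>\<ge>\<^sub>0"
      by (simp add: complex_nonneg_Reals_iff Q_def)
  qed
qed


section \<open>The commutator with D is multiplication by the derivative\<close>

lemma continuous_indefinite_integral:
  fixes \<zeta> :: "real \<Rightarrow> complex"
  assumes "set_integrable lborel {0..T} \<zeta>"
  shows "continuous_on {0..T} (\<lambda>\<theta>. LINT t:{0..\<theta>}|lborel. \<zeta> t)"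
proof -
  have "continuous_on {0..T} (\<lambda>\<theta>. integral {0..\<theta>} \<zeta>)"
    by (rule indefinite_integral_continuous_1, rule set_borel_integral_eq_integral(1), rule assms)
  moreover have "(LINT t:{0..\<theta>}|lborel. \<zeta> t) = integral {0..\<theta>} \<zeta>" if "\<theta> \<in> {0..T}" for \<theta>
    using that by (intro set_borel_integral_eq_integral(2) set_integrable_subset[OF assms]) auto
  ultimately show ?thesis by (metis (mono_tags, lifting) continuous_on_eq)
qed

lemma continuous_bounded_on_interval:
  fixes f :: "real \<Rightarrow> complex"
  assumes "continuous_on {a..b} f"
  obtains B where "\<And>t. t \<in> {a..b} \<Longrightarrow> cmod (f t) \<le> B"
proof -
  have "bounded (f ` {a..b})" by (intro compact_imp_bounded compact_continuous_image assms compact_Icc)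
  then obtain B where "\<forall>t\<in>{a..b}. cmod (f t) \<le> B" by (auto simp: bounded_iff)
  then show ?thesis using that by blast
qed

text \<open>Both sides are the integral of \<open>g(s) \<zeta>(t)\<close> over the triangle \<open>t \<le> s\<close> up to the boundary
  term, by Fubini; \<open>\<zeta>\<close> is only integrable, so its indefinite integral need not be differentiable
  everywhere.\<close>

lemma integral_by_parts_indefinite:
  fixes f g \<zeta> :: "real \<Rightarrow> complex"
  assumes \<theta>: "0 \<le> \<theta>" and \<zeta>: "set_integrable lborel {0..\<theta>} \<zeta>"
    and f: "\<And>t. (f has_vector_derivative g t) (at t)" and g: "continuous_on UNIV g"
  shows "f \<theta> * (LINT t:{0..\<theta>}|lborel. \<zeta> t)
    = (LINT t:{0..\<theta>}|lborel. f t * \<zeta> t + g t * (LINT s:{0..t}|lborel. \<zeta> s))"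
proof -
  define I where "I = {0..\<theta>}"
  define z where "z t = indicator I t *\<^sub>R \<zeta> t" for t
  define w where "w t = indicator I t *\<^sub>R g t" for t
  have z: "integrable lborel z" using \<zeta> by (simp add: z_def[abs_def] I_def set_integrable_def)
  have g_on: "continuous_on S g" for S by (rule continuous_on_subset[OF g]) simp
  have w: "integrable lborel w"
    using set_lborel_integral_continuous(1)[OF g_on, of 0 \<theta>] by (simp add: w_def[abs_def] I_def set_integrable_def)
  have f_cont: "continuous_on S f" for S
    by (rule continuous_at_imp_continuous_on) (use f has_vector_derivative_continuous in blast)
  note [measurable] = borel_measurable_integrable[OF z] borel_measurable_integrable[OF w]
  define h where "h s t = (if t \<le> s then w s * z t else 0)" for s t
  have prod: "integrable (lborel \<Otimes>\<^sub>M lborel) (\<lambda>(s, t). w s * z t)"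
  proof (rule lborel_pair.Fubini_integrable)
    show "integrable lborel (\<lambda>x. LINT y|lborel. norm (case (x, y) of (s, t) \<Rightarrow> w s * z t))"
      using w by (simp add: norm_mult)
    show "AE x in lborel. integrable lborel (\<lambda>y. case (x, y) of (s, t) \<Rightarrow> w s * z t)"
      using z by simp
  qed simp
  have h: "integrable (lborel \<Otimes>\<^sub>M lborel) (\<lambda>(s, t). h s t)"
    by (rule Bochner_Integration.integrable_bound[OF prod]) (auto simp: h_def)
  have inner_t: "(LINT t|lborel. h s t) = w s * (LINT t:{0..s}|lborel. \<zeta> t)" for s
  proof (cases "s \<in> I")
    case True
    have "(LINT t|lborel. h s t) = (LINT t|lborel. w s * (indicator {0..s} t *\<^sub>R \<zeta> t))"
      using True by (intro Bochner_Integration.integral_cong) (auto simp: h_def z_def I_def indicator_def)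
    then show ?thesis by (simp only: set_lebesgue_integral_def integral_mult_right_zero)
  next
    case False
    then have "h s t = 0" for t by (simp add: h_def w_def)
    then show ?thesis using False by (simp add: w_def)
  qed
  have inner_s: "(LINT s|lborel. h s t) = z t * (f \<theta> - f t)" for t
  proof (cases "t \<in> I")
    case True
    have "(LINT s|lborel. h s t) = (LINT s|lborel. z t * (indicator {t..\<theta>} s *\<^sub>R g s))"
      using True by (intro Bochner_Integration.integral_cong) (auto simp: h_def w_def I_def indicator_def)
    also have "\<dots> = z t * (LINT s:{t..\<theta>}|lborel. g s)"
      by (simp only: set_lebesgue_integral_def integral_mult_right_zero)
    also have "(LINT s:{t..\<theta>}|lborel. g s) = integral {t..\<theta>} g"
      by (rule set_lborel_integral_continuous[OF g_on])
    also have "\<dots> = f \<theta> - f t"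
      using True by (intro integral_unique[OF fundamental_theorem_of_calculus])
        (auto simp: I_def intro: has_vector_derivative_at_within[OF f])
    finally show ?thesis .
  next
    case False
    then have "h s t = 0" for s by (simp add: h_def z_def)
    then show ?thesis using False by (simp add: z_def)
  qed
  have fubini: "(LINT t|lborel. z t * (f \<theta> - f t)) = (LINT s|lborel. w s * (LINT t:{0..s}|lborel. \<zeta> t))"
    using lborel_pair.Fubini_integral[OF h] by (simp add: inner_t inner_s)
  have int_gZ: "set_integrable lborel I (\<lambda>s. g s * (LINT t:{0..s}|lborel. \<zeta> t))"
    unfolding I_def by (intro set_lborel_integral_continuous continuous_intros g_on
        continuous_indefinite_integral \<zeta>)
  obtain B where B: "\<And>t. t \<in> I \<Longrightarrow> cmod (f t) \<le> B"
    using continuous_bounded_on_interval[OF f_cont] unfolding I_def by blast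
  have [measurable]: "f \<in> borel_measurable borel" by (rule borel_measurable_continuous_onI[OF f_cont])
  have f_le: "cmod (f t * z t) \<le> cmod (of_real B * z t)" for t
  proof (cases "t \<in> I")
    case True
    then show ?thesis using B[of t] by (simp add: norm_mult mult_right_mono)
  qed (simp add: z_def)
  have int_fz: "integrable lborel (\<lambda>t. f t * z t)"
    by (rule Bochner_Integration.integrable_bound[OF integrable_mult_right[OF z, of "of_real B"]])
      (use f_le in simp_all)
  then have int_f\<zeta>: "set_integrable lborel I (\<lambda>t. f t * \<zeta> t)"
    by (simp add: set_integrable_def z_def)
  have "f \<theta> * (LINT t:I|lborel. \<zeta> t) = (LINT t|lborel. f \<theta> * z t)"
    by (simp only: set_lebesgue_integral_def z_def integral_mult_right_zero)
  also have "\<dots> = (LINT t|lborel. f t * z t + z t * (f \<theta> - f t))"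
    by (simp add: algebra_simps)
  also have "\<dots> = (LINT t|lborel. f t * z t) + (LINT t|lborel. z t * (f \<theta> - f t))"
    using int_fz z by (intro Bochner_Integration.integral_add) (auto simp: algebra_simps)
  also have "(LINT t|lborel. f t * z t) = (LINT t:I|lborel. f t * \<zeta> t)"
    by (simp add: set_lebesgue_integral_def z_def)
  also have "(LINT t|lborel. z t * (f \<theta> - f t)) = (LINT s:I|lborel. g s * (LINT t:{0..s}|lborel. \<zeta> t))"
    unfolding fubini by (simp add: set_lebesgue_integral_def w_def)
  finally show ?thesis using set_integral_add(2)[OF int_f\<zeta> int_gZ] by (simp add: I_def)
qed

text \<open>The sets over which \<open>u\<close>, extended by zero, integrates to zero form a Dynkin system containing the
  half-lines \<open>(-\<infinity>, \<theta>]\<close>, hence all Borel sets.\<close>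

lemma AE_zero_if_indefinite_integral_zero:
  fixes u :: "real \<Rightarrow> complex"
  assumes u: "set_integrable lborel {0..T} u" and T: "0 \<le> T"
    and zero: "\<And>\<theta>. \<theta> \<in> {0..T} \<Longrightarrow> (LINT t:{0..\<theta>}|lborel. u t) = 0"
  shows "AE t in lborel. t \<in> {0..T} \<longrightarrow> u t = 0"
proof -
  define v where "v t = indicator {0..T} t *\<^sub>R u t" for t
  have v: "integrable lborel v" using u by (simp add: v_def[abs_def] set_integrable_def)
  have v_on: "set_integrable lborel A v" if "A \<in> sets borel" for A
    unfolding set_integrable_def using that v by (intro integrable_mult_indicator) auto
  have le: "(LINT t:{..\<theta>}|lborel. v t) = 0" for \<theta>
  proof (cases "0 \<le> \<theta>")
    case True
    have "(LINT t:{..\<theta>}|lborel. v t) = (LINT t:{0..min \<theta> T}|lborel. u t)"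
      unfolding set_lebesgue_integral_def v_def
      by (intro Bochner_Integration.integral_cong) (auto simp: indicator_def)
    then show ?thesis using zero[of "min \<theta> T"] True T by simp
  next
    case False
    then show ?thesis
      unfolding set_lebesgue_integral_def v_def
      by (intro integral_eq_zero_AE AE_I2) (auto simp: indicator_def)
  qed
  have all: "(LINT t|lborel. v t) = 0"
    using zero[of T] T by (simp add: v_def set_lebesgue_integral_def)
  have "(LINT t:A|lborel. v t) = 0" if "A \<in> sets lborel" for A
  proof -
    have "Int_stable (range (\<lambda>a::real. {..a}))" by (auto simp: Int_stable_def)
    moreover have "range (\<lambda>a::real. {..a}) \<subseteq> Pow UNIV" by simp
    moreover have "A \<in> sigma_sets UNIV (range (\<lambda>a::real. {..a}))"
      using that by (simp add: borel_eq_atMost)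
    ultimately show ?thesis
    proof (induction rule: sigma_sets_induct_disjoint)
      case (basic A) then show ?case using le by auto
    next
      case empty then show ?case by (simp add: set_lebesgue_integral_def)
    next
      case (compl A)
      then have A: "A \<in> sets borel" by (simp add: borel_eq_atMost)
      have "(LINT t:A \<union> - A|lborel. v t) = (LINT t:A|lborel. v t) + (LINT t:- A|lborel. v t)"
        using A by (intro set_integral_Un v_on) auto
      then show ?case using compl all by (simp add: Compl_eq_Diff_UNIV set_lebesgue_integral_def)
    next
      case (union A)
      then have A: "A i \<in> sets borel" for i by (auto simp: borel_eq_atMost)
      have "(LINT t:(\<Union>i. A i)|lborel. v t) = (\<Sum>i. LINT t:A i|lborel. v t)"
        using A union(1) by (intro lebesgue_integral_countable_add v_on) (auto simp: disjoint_family_on_def)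
      then show ?case using union by simp
    qed
  qed
  then have "AE t in lborel. v t = 0" by (rule sigma_finite_measure.density_zero[OF lborel.sigma_finite_measure_axioms v])
  then show ?thesis by eventually_elim (auto simp: v_def)
qed

text \<open>The absolute difference is a nonnegative continuous function with integral zero.\<close>

lemma eq_on_interval_if_AE_eq:
  fixes G H :: "real \<Rightarrow> complex"
  assumes "continuous_on {0..T} G" "continuous_on {0..T} H" and T: "0 < T"
    and ae: "AE t in lborel. t \<in> {0..<T} \<longrightarrow> G t = H t"
  shows "\<forall>t\<in>{0..T}. G t = H t"
proof -
  define w where "w t = cmod (G t - H t)" for t
  have w: "continuous_on {0..T} w" unfolding w_def by (intro continuous_intros assms)
  have "(LINT t:{0..T}|lborel. w t) = 0"
    unfolding set_lebesgue_integral_def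
  proof (rule integral_eq_zero_AE)
    show "AE t in lborel. indicator {0..T} t *\<^sub>R w t = 0"
      using ae AE_lborel_singleton[of T] by eventually_elim (auto simp: w_def indicator_def)
  qed
  then have "integral {0..T} w = 0" using set_lborel_integral_continuous(2)[OF w] by simp
  then have "\<forall>t\<in>{0..T}. w t = 0" using w T by (subst (asm) integral_eq_0_iff) (auto simp: w_def)
  then show ?thesis by (simp add: w_def)
qed

lemma D_graph_representative:
  assumes "(\<xi>, \<zeta>) \<in> D_graph"
  obtains G where "AE t in lborel. t \<in> {0..<2 * pi} \<longrightarrow> \<xi> (circle_pt t) = G t"
    and "continuous_on {0..2 * pi} G"
    and "\<And>\<theta>. \<theta> \<in> {0..2 * pi} \<Longrightarrow> G \<theta> = G 0 + \<i> * (LINT t:{0..\<theta>}|lborel. \<zeta> (circle_pt t))"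
proof -
  obtain g where \<zeta>: "\<zeta> \<in> L2_circle" and ae: "AE z in arc_measure. \<xi> z = g z"
    and g: "\<And>\<theta>. \<theta> \<in> {0..2 * pi} \<Longrightarrow>
        g (circle_pt \<theta>) = g (circle_pt 0) + \<i> * (LINT t:{0..\<theta>}|lborel. \<zeta> (circle_pt t))"
    using assms unfolding D_graph_def mem_Collect_eq prod.case by blast
  have "continuous_on {0..2 * pi}
      (\<lambda>\<theta>. g (circle_pt 0) + \<i> * (LINT t:{0..\<theta>}|lborel. \<zeta> (circle_pt t)))"
    by (intro continuous_intros continuous_indefinite_integral L2_circle_integrable \<zeta>)
  then have "continuous_on {0..2 * pi} (\<lambda>\<theta>. g (circle_pt \<theta>))"
    by (rule continuous_on_eq) (rule g[symmetric])
  then show ?thesis using that[of "\<lambda>\<theta>. g (circle_pt \<theta>)"] AE_arc_measureD[OF ae] g by blast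
qed

text \<open>The derivative with respect to the angle; it is kept as a function on the line, where the calculus
  lemmas apply.\<close>

definition circle_derivative :: "(circle \<Rightarrow> complex) \<Rightarrow> (real \<Rightarrow> complex) \<Rightarrow> bool"
  where "circle_derivative f g \<longleftrightarrow> continuous_on UNIV g \<and>
    (\<forall>\<theta>. ((\<lambda>t. f (circle_pt t)) has_vector_derivative g \<theta>) (at \<theta>))"

text \<open>The product rule \<open>[D, f] \<xi> = -\<i> f' \<xi>\<close>. Absolutely continuous representatives of \<open>\<xi>\<close> and \<open>f \<xi>\<close> are only
  related almost everywhere, but continuity makes the relation hold at each point; both sides of the claim then
  have the same indefinite integral.\<close>

lemma commutator_AE:
  assumes f: "circle_derivative f g"
    and \<xi>: "(\<xi>, \<zeta>) \<in> D_graph" and \<eta>: "(\<lambda>z. f z * \<xi> z, \<eta>) \<in> D_graph"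
  shows "AE t in lborel. t \<in> {0..<2 * pi} \<longrightarrow>
    \<eta> (circle_pt t) - f (circle_pt t) * \<zeta> (circle_pt t) = - \<i> * g t * \<xi> (circle_pt t)"
proof -
  define F where "F t = f (circle_pt t)" for t
  define z where "z t = \<zeta> (circle_pt t)" for t
  define e where "e t = \<eta> (circle_pt t)" for t
  have F: "(F has_vector_derivative g t) (at t)" for t
    using f by (simp add: circle_derivative_def F_def[abs_def])
  have g: "continuous_on S g" for S
    using f by (auto simp: circle_derivative_def intro: continuous_on_subset)
  have F_cont: "continuous_on S F" for S
    by (rule continuous_at_imp_continuous_on) (use F has_vector_derivative_continuous in blast)
  have z: "set_integrable lborel {0..2 * pi} z" and e: "set_integrable lborel {0..2 * pi} e"
    using \<xi> \<eta> L2_circle_integrable unfolding D_graph_def z_def e_def by auto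
  obtain G where G: "AE t in lborel. t \<in> {0..<2 * pi} \<longrightarrow> \<xi> (circle_pt t) = G t"
      "continuous_on {0..2 * pi} G"
      "\<And>\<theta>. \<theta> \<in> {0..2 * pi} \<Longrightarrow> G \<theta> = G 0 + \<i> * (LINT t:{0..\<theta>}|lborel. z t)"
    using D_graph_representative[OF \<xi>] unfolding z_def by blast
  obtain H where H: "AE t in lborel. t \<in> {0..<2 * pi} \<longrightarrow> F t * \<xi> (circle_pt t) = H t"
      "continuous_on {0..2 * pi} H"
      "\<And>\<theta>. \<theta> \<in> {0..2 * pi} \<Longrightarrow> H \<theta> = H 0 + \<i> * (LINT t:{0..\<theta>}|lborel. e t)"
    using D_graph_representative[OF \<eta>] unfolding e_def F_def by blast
  have "AE t in lborel. t \<in> {0..<2 * pi} \<longrightarrow> H t = F t * G t"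
    using G(1) H(1) by eventually_elim auto
  then have "\<forall>t\<in>{0..2 * pi}. H t = F t * G t"
    by (rule eq_on_interval_if_AE_eq[OF H(2) continuous_on_mult[OF F_cont G(2)], rotated]) simp
  then have HFG: "H t = F t * G t" if "t \<in> {0..2 * pi}" for t using that by blast
  have Fz: "set_integrable lborel {0..2 * pi} (\<lambda>t. F t * z t)"
  proof -
    obtain B where B: "\<And>t. t \<in> {0..2 * pi} \<Longrightarrow> cmod (F t) \<le> B"
      using continuous_bounded_on_interval[OF F_cont] by blast
    have [measurable]: "F \<in> borel_measurable borel" by (rule borel_measurable_continuous_onI[OF F_cont])
    define y where "y t = indicator {0..2 * pi} t *\<^sub>R z t" for t
    have y: "integrable lborel y" using z by (simp add: set_integrable_def y_def[abs_def])
    note [measurable] = borel_measurable_integrable[OF y]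
    have "integrable lborel (\<lambda>t. F t * y t)"
    proof (rule Bochner_Integration.integrable_bound[OF integrable_mult_right[OF y, of "of_real B"]])
      have "cmod (F t * y t) \<le> cmod (of_real B * y t)" for t
        using B[of t] by (auto simp: y_def norm_mult indicator_def intro!: mult_right_mono)
      then show "AE t in lborel. cmod (F t * y t) \<le> cmod (of_real B * y t)" by simp
    qed measurable
    then show ?thesis by (simp add: set_integrable_def y_def)
  qed
  have gG: "set_integrable lborel {0..2 * pi} (\<lambda>t. g t * G t)"
    by (intro set_lborel_integral_continuous continuous_intros g G)
  have u: "set_integrable lborel {0..2 * pi} (\<lambda>t. e t - F t * z t + \<i> * (g t * G t))"
    by (intro set_integral_add set_integral_diff set_integrable_mult_right e Fz gG)
  have zero: "(LINT t:{0..\<theta>}|lborel. e t - F t * z t + \<i> * (g t * G t)) = 0"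
    if \<theta>: "\<theta> \<in> {0..2 * pi}" for \<theta>
  proof -
    have sub: "{0..\<theta>} \<subseteq> {0..2 * pi}" using \<theta> by auto
    have sub_int: "set_integrable lborel {0..\<theta>} h" if "set_integrable lborel {0..2 * pi} h" for h :: "real \<Rightarrow> complex"
      using set_integrable_subset[OF that _ sub] by simp
    define Z where "Z t = (LINT s:{0..t}|lborel. z s)" for t
    have gZ: "set_integrable lborel {0..\<theta>} (\<lambda>t. g t * Z t)"
      unfolding Z_def
      by (rule set_lborel_integral_continuous(1), intro continuous_intros g
          continuous_indefinite_integral sub_int[OF z])
    have g\<theta>: "set_integrable lborel {0..\<theta>} g" "(LINT t:{0..\<theta>}|lborel. g t) = F \<theta> - F 0"
    proof -
      show "set_integrable lborel {0..\<theta>} g" by (rule set_lborel_integral_continuous[OF g])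
      have "(LINT t:{0..\<theta>}|lborel. g t) = integral {0..\<theta>} g"
        by (rule set_lborel_integral_continuous[OF g])
      also have "\<dots> = F \<theta> - F 0"
        using \<theta> by (intro integral_unique[OF fundamental_theorem_of_calculus])
          (auto intro: has_vector_derivative_at_within[OF F])
      finally show "(LINT t:{0..\<theta>}|lborel. g t) = F \<theta> - F 0" .
    qed
    have "\<i> * (LINT t:{0..\<theta>}|lborel. e t) = F \<theta> * (G 0 + \<i> * Z \<theta>) - F 0 * G 0"
      using H(3)[OF \<theta>] HFG[OF \<theta>] HFG[of 0] G(3)[OF \<theta>] by (simp add: Z_def algebra_simps)
    also have "\<dots> = (F \<theta> - F 0) * G 0 + \<i> * (F \<theta> * Z \<theta>)" by (simp add: algebra_simps)
    also have "F \<theta> * Z \<theta> = (LINT t:{0..\<theta>}|lborel. F t * z t + g t * Z t)"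
      unfolding Z_def using \<theta> by (intro integral_by_parts_indefinite F g sub_int[OF z]) auto
    also have "\<dots> = (LINT t:{0..\<theta>}|lborel. F t * z t) + (LINT t:{0..\<theta>}|lborel. g t * Z t)"
      by (rule set_integral_add(2)[OF sub_int[OF Fz] gZ])
    finally have by_parts: "\<i> * (LINT t:{0..\<theta>}|lborel. e t) = (F \<theta> - F 0) * G 0
        + \<i> * ((LINT t:{0..\<theta>}|lborel. F t * z t) + (LINT t:{0..\<theta>}|lborel. g t * Z t))" .
    have "(LINT t:{0..\<theta>}|lborel. g t * G t) = (LINT t:{0..\<theta>}|lborel. g t * G 0 + \<i> * (g t * Z t))"
    proof (intro set_lebesgue_integral_cong allI impI)
      fix t assume "t \<in> {0..\<theta>}"
      then show "g t * G t = g t * G 0 + \<i> * (g t * Z t)"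
        using G(3)[of t] \<theta> by (simp add: Z_def algebra_simps)
    qed simp
    also have "\<dots> = (LINT t:{0..\<theta>}|lborel. g t * G 0) + (LINT t:{0..\<theta>}|lborel. \<i> * (g t * Z t))"
      by (intro set_integral_add set_integrable_mult_right set_integrable_mult_left g\<theta> gZ)
    also have "\<dots> = (F \<theta> - F 0) * G 0 + \<i> * (LINT t:{0..\<theta>}|lborel. g t * Z t)"
      by (simp add: g\<theta>)
    finally have gG_eq: "(LINT t:{0..\<theta>}|lborel. g t * G t)
        = (F \<theta> - F 0) * G 0 + \<i> * (LINT t:{0..\<theta>}|lborel. g t * Z t)" .
    have "(LINT t:{0..\<theta>}|lborel. e t - F t * z t + \<i> * (g t * G t))
        = (LINT t:{0..\<theta>}|lborel. e t) - (LINT t:{0..\<theta>}|lborel. F t * z t)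
          + \<i> * (LINT t:{0..\<theta>}|lborel. g t * G t)"
      using sub_int[OF e] sub_int[OF Fz] sub_int[OF gG]
      by (simp add: set_integral_add set_integral_diff)
    also have "\<dots> = - \<i> * (\<i> * (LINT t:{0..\<theta>}|lborel. e t) - \<i> * (LINT t:{0..\<theta>}|lborel. F t * z t)
          - (LINT t:{0..\<theta>}|lborel. g t * G t))"
      by (simp add: algebra_simps)
    also have "\<dots> = 0" unfolding by_parts gG_eq by (simp add: algebra_simps)
    finally show ?thesis .
  qed
  have "AE t in lborel. t \<in> {0..2 * pi} \<longrightarrow> e t - F t * z t + \<i> * (g t * G t) = 0"
    by (rule AE_zero_if_indefinite_integral_zero[OF u _ zero]) auto
  with G(1) show ?thesis
    by eventually_elim (auto simp: e_def F_def z_def add_eq_0_iff algebra_simps)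
qed

lemma circle_derivative_periodic:
  assumes "circle_derivative f g" "circle_pt s = circle_pt t"
  shows "g s = g t"
proof -
  have f: "((\<lambda>t. f (circle_pt t)) has_vector_derivative g \<theta>) (at \<theta>)" for \<theta>
    using assms(1) by (simp add: circle_derivative_def)
  have "circle_pt (x + (t - s)) = circle_pt x" for x
    using assms(2) cis_mult[of "x - s" t] cis_mult[of "x - s" s]
    by (simp add: circle_pt_eq_iff algebra_simps)
  then have "(\<lambda>x. f (circle_pt (x + (t - s)))) = (\<lambda>x. f (circle_pt x))" by simp
  moreover have "((\<lambda>x. f (circle_pt (x + (t - s)))) has_vector_derivative g t) (at s)"
    using vector_diff_chain_at[of "\<lambda>x. x + (t - s)" 1 s "\<lambda>x. f (circle_pt x)" "g t"] f[of t]
    by (simp add: o_def has_vector_derivative_add_const)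
  ultimately show ?thesis using vector_derivative_unique_at f by metis
qed

lemma circle_derivative_continuous:
  assumes "circle_derivative f g"
  shows "continuous_on S (\<lambda>t. f (circle_pt t))"
proof (rule continuous_at_imp_continuous_on, rule ballI)
  fix t
  show "isCont (\<lambda>t. f (circle_pt t)) t"
    using assms by (intro has_vector_derivative_continuous[of _ "g t"]) (simp add: circle_derivative_def)
qed

text \<open>The parametrization of the circle is a quotient map, because it maps closed subsets of the compact
  interval \<open>[0, 2\<pi>]\<close> to closed sets.\<close>

lemma continuous_if_continuous_circle_pt:
  assumes "continuous_on UNIV (\<lambda>t. f (circle_pt t))"
  shows "continuous_on UNIV (f :: circle \<Rightarrow> complex)"
proof -
  have "closed (f -` C)" if "closed C" for C
  proof -
    have "f -` C = circle_pt ` ({0..2 * pi} \<inter> (\<lambda>t. f (circle_pt t)) -` C)"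
      using ex_circle_pt by (force simp: image_iff)
    moreover have "closed ((\<lambda>t. f (circle_pt t)) -` C)"
      using assms that by (simp add: continuous_closed_vimage continuous_on_eq_continuous_at)
    then have "compact ({0..2 * pi} \<inter> (\<lambda>t. f (circle_pt t)) -` C)"
      by (intro compact_Int_closed compact_Icc)
    ultimately show ?thesis
      using compact_imp_closed[OF compact_continuous_image[OF continuous_circle_pt]] by simp
  qed
  then show ?thesis by (simp add: continuous_on_closed_vimage)
qed

lemma lip_norm_le_1_if_derivative_le_1:
  assumes f: "circle_derivative f g" and g: "\<And>\<theta>. cmod (g \<theta>) \<le> 1"
  shows "lip_norm f \<le> 1"
  unfolding lip_norm_def
proof (rule SUP_least, clarify)
  fix \<xi> \<zeta> \<eta> assume \<xi>: "(\<xi>, \<zeta>) \<in> D_graph" and \<eta>: "(\<lambda>z. f z * \<xi> z, \<eta>) \<in> D_graph"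
    and norm: "L2_norm \<xi> \<le> 1"
  have L2: "\<xi> \<in> L2_circle" "\<zeta> \<in> L2_circle" "\<eta> \<in> L2_circle" using \<xi> \<eta> by (auto simp: D_graph_def)
  have [measurable]: "f \<in> borel_measurable borel"
    by (intro borel_measurable_continuous_onI continuous_if_continuous_circle_pt
        circle_derivative_continuous[OF f])
  note [measurable] = L2[THEN L2_circle_measurable]
  have "(\<integral>z. (cmod (\<eta> z - f z * \<zeta> z))\<^sup>2 \<partial>arc_measure)
      = (LINT t:{0..2 * pi}|lborel. (cmod (\<eta> (circle_pt t) - f (circle_pt t) * \<zeta> (circle_pt t)))\<^sup>2)"
    by (rule integral_arc_measure) measurable
  also have "\<dots> \<le> (LINT t:{0..2 * pi}|lborel. (cmod (\<xi> (circle_pt t)))\<^sup>2)"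
    unfolding set_lebesgue_integral_def
  proof (rule integral_mono_AE')
    show "integrable lborel (\<lambda>t. indicator {0..2 * pi} t *\<^sub>R (cmod (\<xi> (circle_pt t)))\<^sup>2)"
      using L2(1) integrable_arc_measure[of "\<lambda>z. (cmod (\<xi> z))\<^sup>2"]
      by (simp add: L2_circle_def set_integrable_def)
    show "AE t in lborel. indicator {0..2 * pi} t *\<^sub>R (cmod (\<eta> (circle_pt t) - f (circle_pt t) * \<zeta> (circle_pt t)))\<^sup>2
        \<le> indicator {0..2 * pi} t *\<^sub>R (cmod (\<xi> (circle_pt t)))\<^sup>2"
      using commutator_AE[OF f \<xi> \<eta>] AE_lborel_singleton[of "2 * pi"]
    proof eventually_elim
      case (elim t)
      have "cmod (g t * \<xi> (circle_pt t)) \<le> cmod (\<xi> (circle_pt t))"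
        using mult_right_mono[OF g[of t] norm_ge_zero[of "\<xi> (circle_pt t)"]] by (simp add: norm_mult)
      then show ?case
        using elim by (auto simp: indicator_def norm_mult intro!: power_mono)
    qed
  qed simp
  also have "\<dots> = (\<integral>z. (cmod (\<xi> z))\<^sup>2 \<partial>arc_measure)"
    by (rule integral_arc_measure[symmetric]) measurable
  finally have "L2_norm (\<lambda>z. \<eta> z - f z * \<zeta> z) \<le> L2_norm \<xi>" by (simp add: L2_norm_def)
  with norm show "ennreal (L2_norm (\<lambda>z. \<eta> z - f z * \<zeta> z)) \<le> 1"
    by (simp add: ennreal_le_1)
qed

lemma continuous_angle_in_L2_circle:
  fixes w :: "real \<Rightarrow> complex"
  assumes "continuous_on UNIV w"
  shows "(\<lambda>z. w (angle z)) \<in> L2_circle"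
proof -
  have [measurable]: "w \<in> borel_measurable borel" by (rule borel_measurable_continuous_onI[OF assms])
  obtain B where B: "\<And>t. t \<in> {0..2 * pi} \<Longrightarrow> cmod (w t) \<le> B"
    using continuous_bounded_on_interval[OF continuous_on_subset[OF assms subset_UNIV]] by blast
  show ?thesis
    by (rule bounded_in_L2_circle[of _ B]) (use B angle_range in \<open>simp_all add: less_imp_le\<close>)
qed

text \<open>Cutting the circle at \<open>1\<close> does no harm when the endpoint values of \<open>u\<close> agree; \<open>v\<close> may jump there.\<close>

lemma D_graph_angle:
  fixes u v :: "real \<Rightarrow> complex"
  assumes u: "\<And>t. (u has_vector_derivative \<i> * v t) (at t)" and v: "continuous_on UNIV v"
    and periodic: "u 0 = u (2 * pi)"
  shows "(\<lambda>z. u (angle z), \<lambda>z. v (angle z)) \<in> D_graph"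
proof -
  have u_cont: "continuous_on UNIV u"
    by (rule continuous_at_imp_continuous_on) (use u has_vector_derivative_continuous in blast)
  have v_on: "continuous_on S v" for S by (rule continuous_on_subset[OF v subset_UNIV])
  have "u (angle (circle_pt \<theta>)) = u (angle (circle_pt 0))
      + \<i> * (LINT t:{0..\<theta>}|lborel. v (angle (circle_pt t)))" if \<theta>: "\<theta> \<in> {0..2 * pi}" for \<theta>
  proof -
    have [measurable]: "v \<in> borel_measurable borel" by (rule borel_measurable_continuous_onI[OF v])
    have "(LINT t:{0..\<theta>}|lborel. v (angle (circle_pt t))) = (LINT t:{0..\<theta>}|lborel. v t)"
      unfolding set_lebesgue_integral_def
    proof (rule integral_cong_AE)
      show "AE t in lborel. indicator {0..\<theta>} t *\<^sub>R v (angle (circle_pt t)) = indicator {0..\<theta>} t *\<^sub>R v t"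
        using AE_lborel_singleton[of "2 * pi"]
        by eventually_elim (use \<theta> in \<open>auto simp: indicator_def angle_circle_pt\<close>)
    qed measurable
    also have "\<dots> = integral {0..\<theta>} v" by (rule set_lborel_integral_continuous[OF v_on])
    finally have "\<i> * (LINT t:{0..\<theta>}|lborel. v (angle (circle_pt t))) = integral {0..\<theta>} (\<lambda>t. \<i> * v t)"
      by simp
    also have "\<dots> = u \<theta> - u 0"
      using \<theta> by (intro integral_unique[OF fundamental_theorem_of_calculus])
        (auto intro: has_vector_derivative_at_within[OF u])
    moreover have "u (angle (circle_pt \<theta>)) = u \<theta>"
      using \<theta> periodic angle_circle_pt[of \<theta>] angle_circle_pt[of 0] by (cases "\<theta> = 2 * pi") auto
    ultimately show ?thesis using angle_circle_pt[of 0] by simp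
  qed
  then show ?thesis
    unfolding D_graph_def mem_Collect_eq prod.case
    by (intro conjI exI[of _ "\<lambda>z. u (angle z)"] ballI AE_I2 refl
        continuous_angle_in_L2_circle[OF u_cont] continuous_angle_in_L2_circle[OF v])
qed

lemma L2_norm_angle:
  fixes w :: "real \<Rightarrow> complex"
  assumes "continuous_on UNIV w"
  shows "L2_norm (\<lambda>z. w (angle z)) = sqrt (integral {0..2 * pi} (\<lambda>t. (cmod (w t))\<^sup>2))"
  unfolding L2_norm_def
  using integral_arc_measure_angle[of "\<lambda>t. (cmod (w t))\<^sup>2"] assms by (simp add: continuous_intros)

lemma has_real_derivative_max_0_squared:
  "((\<lambda>x::real. (max 0 x)\<^sup>2) has_real_derivative 2 * max 0 x) (at x)"
proof (cases "x = 0")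
  case True
  have "((\<lambda>h. ((max 0 h)\<^sup>2 - (max 0 0)\<^sup>2) / h) \<longlongrightarrow> (0::real)) (at 0)"
  proof (rule Lim_null_comparison)
    show "\<forall>\<^sub>F h in at 0. norm (((max 0 h)\<^sup>2 - (max 0 0)\<^sup>2) / h) \<le> \<bar>h :: real\<bar>"
      by (intro always_eventually) (auto simp: max_def power2_eq_square abs_mult)
    show "((\<lambda>h. \<bar>h :: real\<bar>) \<longlongrightarrow> 0) (at 0)" by (intro tendsto_eq_intros) auto
  qed
  then show ?thesis using True by (simp add: DERIV_def)
next
  case False
  then consider "x > 0" | "x < 0" by linarith
  then show ?thesis
  proof cases
    case 1
    have "((\<lambda>x::real. x\<^sup>2) has_real_derivative 2 * x) (at x)" by (auto intro!: derivative_eq_intros)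
    then have "((\<lambda>x::real. (max 0 x)\<^sup>2) has_real_derivative 2 * x) (at x)"
      by (rule has_field_derivative_transform_within_open[of _ _ _ "{0<..}"]) (use 1 in auto)
    then show ?thesis using 1 by simp
  next
    case 2
    have "((\<lambda>x::real. 0) has_real_derivative 0) (at x)" by simp
    then have "((\<lambda>x::real. (max 0 x)\<^sup>2) has_real_derivative 0) (at x)"
      by (rule has_field_derivative_transform_within_open[of _ _ _ "{..<0}"]) (use 2 in auto)
    then show ?thesis using 2 by simp
  qed
qed

definition bump_profile' :: "real \<Rightarrow> real \<Rightarrow> real \<Rightarrow> real"
  where "bump_profile' a c t = 2 * max 0 ((t - a) * (c - t)) * (a + c - 2 * t)"

lemma bump_profile_derivative: "(bump_profile a c has_real_derivative bump_profile' a c t) (at t)"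
proof -
  have "((\<lambda>t. (t - a) * (c - t)) has_real_derivative (a + c - 2 * t)) (at t)"
    by (auto intro!: derivative_eq_intros)
  from DERIV_chain2[OF has_real_derivative_max_0_squared this]
  show ?thesis by (simp add: bump_profile_def[abs_def] bump_profile'_def)
qed

text \<open>On the vector \<open>b\<close> of a bump the commutator is \<open>-\<i> g b\<close>, so \<open>\<parallel>g b\<parallel> \<le> \<parallel>b\<parallel>\<close> in \<open>L\<^sup>2\<close> for all bumps.\<close>

lemma derivative_le_1_if_lip_norm_le_1:
  assumes f: "circle_derivative f g" and lip: "lip_norm f \<le> 1"
  shows "cmod (g \<theta>) \<le> 1"
proof -
  define F where "F t = f (circle_pt t)" for t
  have F: "(F has_vector_derivative g t) (at t)" for t
    using f by (simp add: circle_derivative_def F_def[abs_def])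
  have F_cont: "continuous_on S F" for S
    unfolding F_def by (rule circle_derivative_continuous[OF f])
  have g: "continuous_on S g" for S
    using f by (auto simp: circle_derivative_def intro: continuous_on_subset)
  have bound: "integral {0..2 * pi} (\<lambda>t. (cmod (g t) * bump_profile a c t)\<^sup>2)
      \<le> integral {0..2 * pi} (\<lambda>t. (bump_profile a c t)\<^sup>2)"
    if ac: "0 < a" "a < c" "c < 2 * pi" for a c
  proof -
    define b b' where "b = bump_profile a c" and "b' = bump_profile' a c"
    have b: "(b has_real_derivative b' t) (at t)" for t
      unfolding b_def b'_def by (rule bump_profile_derivative)
    have b_cont: "continuous_on S b" for S unfolding b_def by (rule continuous_bump_profile)
    have b'_cont: "continuous_on S b'" for S
      unfolding b'_def bump_profile'_def[abs_def] by (intro continuous_intros)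
    have b_ends: "b 0 = 0" "b (2 * pi) = 0" using ac bump_profile_eq_0 by (auto simp: b_def)
    have bC: "((\<lambda>t. of_real (b t) :: complex) has_vector_derivative of_real (b' t)) (at t)" for t
      using b[of t] by (intro has_vector_derivative_of_real) (simp add: has_real_derivative_iff_has_vector_derivative)
    define N where "N = sqrt (integral {0..2 * pi} (\<lambda>t. (b t)\<^sup>2))"
    define M where "M = sqrt (integral {0..2 * pi} (\<lambda>t. (cmod (g t) * b t)\<^sup>2))"
    have nonneg: "0 \<le> integral {0..2 * pi} (\<lambda>t. (b t)\<^sup>2)"
      by (intro integral_nonneg integrable_continuous_interval continuous_intros b_cont) simp
    have scaled: "r * M \<le> 1" if r: "0 \<le> r" "r * N \<le> 1" for r
    proof -
      \<comment> \<open>\<open>(u1, v1)\<close> represents \<open>(r b, D (r b))\<close> and \<open>(u2, v2)\<close> represents \<open>(f r b, D (f r b))\<close>.\<close>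
      define u1 v1 u2 v2 where "u1 t = complex_of_real r * of_real (b t)"
        and "v1 t = - \<i> * (of_real r * of_real (b' t))"
        and "u2 t = F t * (of_real r * of_real (b t))"
        and "v2 t = - \<i> * (F t * (of_real r * of_real (b' t)) + g t * (of_real r * of_real (b t)))" for t
      have "(u1 has_vector_derivative \<i> * v1 t) (at t)" for t
        unfolding u1_def[abs_def] v1_def
        using has_vector_derivative_mult_right[OF bC, of "of_real r" t] by (simp add: algebra_simps)
      then have D1: "(\<lambda>z. u1 (angle z), \<lambda>z. v1 (angle z)) \<in> D_graph"
        by (rule D_graph_angle) (auto simp: u1_def v1_def[abs_def] b_ends intro!: continuous_intros b'_cont)
      have "(u2 has_vector_derivative \<i> * v2 t) (at t)" for t
        unfolding u2_def[abs_def] v2_def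
        using has_vector_derivative_mult[OF F has_vector_derivative_mult_right[OF bC, of "of_real r"], of t]
        by (simp add: algebra_simps)
      then have D2: "(\<lambda>z. u2 (angle z), \<lambda>z. v2 (angle z)) \<in> D_graph"
        by (rule D_graph_angle)
          (auto simp: u2_def v2_def[abs_def] b_ends intro!: continuous_intros b_cont b'_cont g F_cont)
      have u2: "(\<lambda>z. u2 (angle z)) = (\<lambda>z. f z * u1 (angle z))"
        by (simp add: u1_def u2_def F_def)
      have n1: "L2_norm (\<lambda>z. u1 (angle z)) = r * N"
      proof -
        have "L2_norm (\<lambda>z. u1 (angle z)) = sqrt (integral {0..2 * pi} (\<lambda>t. (cmod (u1 t))\<^sup>2))"
          by (rule L2_norm_angle) (auto simp: u1_def[abs_def] intro!: continuous_intros b_cont)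
        also have "(\<lambda>t. (cmod (u1 t))\<^sup>2) = (\<lambda>t. r\<^sup>2 * (b t)\<^sup>2)"
          by (simp add: u1_def norm_mult power_mult_distrib)
        finally show ?thesis using r(1) by (simp add: real_sqrt_mult N_def)
      qed
      define w where "w t = - \<i> * g t * (of_real r * of_real (b t))" for t
      have "(\<lambda>z. v2 (angle z) - f z * v1 (angle z)) = (\<lambda>z. w (angle z))"
        by (simp add: v1_def v2_def w_def F_def algebra_simps)
      moreover have "L2_norm (\<lambda>z. w (angle z)) = r * M"
      proof -
        have "L2_norm (\<lambda>z. w (angle z)) = sqrt (integral {0..2 * pi} (\<lambda>t. (cmod (w t))\<^sup>2))"
          by (rule L2_norm_angle) (auto simp: w_def[abs_def] intro!: continuous_intros b_cont g)
        also have "(\<lambda>t. (cmod (w t))\<^sup>2) = (\<lambda>t. r\<^sup>2 * (cmod (g t) * b t)\<^sup>2)"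
          by (simp add: w_def norm_mult power_mult_distrib mult_ac)
        finally show ?thesis using r(1) by (simp add: real_sqrt_mult M_def)
      qed
      ultimately have n2: "L2_norm (\<lambda>z. v2 (angle z) - f z * v1 (angle z)) = r * M" by simp
      have "ennreal (L2_norm (\<lambda>z. v2 (angle z) - f z * v1 (angle z))) \<le> lip_norm f"
        unfolding lip_norm_def
        using D1 D2 n1 r(2) unfolding u2
        by (intro SUP_upper2[of "(\<lambda>z. u1 (angle z), \<lambda>z. v1 (angle z), \<lambda>z. v2 (angle z))"]) auto
      then show ?thesis using lip unfolding n2 by (metis ennreal_le_1 order_trans)
    qed
    \<comment> \<open>The perturbation \<open>\<epsilon>\<close> avoids dividing by \<open>N\<close>, whose positivity would need an argument.\<close>
    have "M \<le> N"
    proof (rule field_le_epsilon)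
      fix \<epsilon> :: real assume \<epsilon>: "\<epsilon> > 0"
      have "0 \<le> N" using nonneg by (simp add: N_def)
      with \<epsilon> scaled[of "1 / (N + \<epsilon>)"] show "M \<le> N + \<epsilon>" by (simp add: field_simps)
    qed
    then show ?thesis by (simp add: N_def M_def b_def)
  qed
  define t where "t = angle (circle_pt \<theta>)"
  have "0 \<le> 1 - (cmod (g t))\<^sup>2"
  proof (rule nonneg_if_bump_integrals_nonneg[where \<Phi> = "\<lambda>t. 1 - (cmod (g t))\<^sup>2"])
    fix a c :: real assume ac: "0 < a" "a < c" "c < 2 * pi"
    have "integral {0..2 * pi} (\<lambda>t. (1 - (cmod (g t))\<^sup>2) * (bump_profile a c t)\<^sup>2)
        = integral {0..2 * pi} (\<lambda>t. (bump_profile a c t)\<^sup>2 - (cmod (g t) * bump_profile a c t)\<^sup>2)"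
      by (simp add: algebra_simps power_mult_distrib)
    also have "\<dots> = integral {0..2 * pi} (\<lambda>t. (bump_profile a c t)\<^sup>2)
        - integral {0..2 * pi} (\<lambda>t. (cmod (g t) * bump_profile a c t)\<^sup>2)"
      by (intro Henstock_Kurzweil_Integration.integral_diff integrable_continuous_interval
          continuous_intros continuous_bump_profile g)
    finally show "0 \<le> integral {0..2 * pi} (\<lambda>t. (1 - (cmod (g t))\<^sup>2) * (bump_profile a c t)\<^sup>2)"
      using bound[OF ac] by simp
  qed (auto simp: t_def angle_range intro!: continuous_intros g)
  moreover have "g \<theta> = g t" by (rule circle_derivative_periodic[OF f]) (simp add: t_def)
  ultimately show ?thesis using power2_le_imp_le[of "cmod (g \<theta>)" 1] by simp
qed


section \<open>Fejer means\<close>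

text \<open>The argument lives on the line because derivatives of functions on the circle do.\<close>

definition fourier :: "(real \<Rightarrow> complex) \<Rightarrow> int \<Rightarrow> complex"
  where "fourier u m = integral {0..2 * pi} (\<lambda>s. u s * cis (- (of_int m * s))) / (2 * pi)"

text \<open>Grouping equal frequencies \<open>m = j - l\<close> gives the usual weights \<open>1 - \<bar>m\<bar> / n\<close>.\<close>

definition fejer_sum :: "nat \<Rightarrow> (real \<Rightarrow> complex) \<Rightarrow> real \<Rightarrow> complex"
  where "fejer_sum n u t =
    (\<Sum>j<n. \<Sum>l<n. fourier u (int j - int l) * cis (of_int (int j - int l) * t)) / n"

definition fejer_mean :: "nat \<Rightarrow> (circle \<Rightarrow> complex) \<Rightarrow> circle \<Rightarrow> complex"
  where "fejer_mean n f z =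
    (\<Sum>j<n. \<Sum>l<n. fourier (\<lambda>t. f (circle_pt t)) (int j - int l) * Rep_circle z powi (int j - int l)) / n"

lemma fejer_mean_circle_pt: "fejer_mean n f (circle_pt t) = fejer_sum n (\<lambda>t. f (circle_pt t)) t"
  by (simp add: fejer_mean_def fejer_sum_def cis_power_int)

lemma has_vector_derivative_cis:
  "((\<lambda>s. cis (c * s)) has_vector_derivative \<i> * of_real c * cis (c * s)) (at s within S)"
proof -
  have "((\<lambda>z. exp (\<i> * (of_real c * z))) has_field_derivative
      \<i> * of_real c * exp (\<i> * (of_real c * of_real s))) (at (of_real s))"
    by (auto intro!: derivative_eq_intros)
  from has_vector_derivative_real_field[OF this, of S] show ?thesis by (simp add: cis_conv_exp)
qed

lemma fourier_add:
  assumes "continuous_on {0..2 * pi} u" "continuous_on {0..2 * pi} v"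
  shows "fourier (\<lambda>s. u s + v s) m = fourier u m + fourier v m"
proof -
  have "integral {0..2 * pi} (\<lambda>s. u s * cis (- (of_int m * s)) + v s * cis (- (of_int m * s)))
      = integral {0..2 * pi} (\<lambda>s. u s * cis (- (of_int m * s)))
        + integral {0..2 * pi} (\<lambda>s. v s * cis (- (of_int m * s)))"
    by (intro Henstock_Kurzweil_Integration.integral_add integrable_continuous_interval
        continuous_intros assms)
  then show ?thesis by (simp add: fourier_def distrib_right add_divide_distrib)
qed

lemma fourier_mult: "fourier (\<lambda>s. c * u s) m = c * fourier u m"
  by (simp add: fourier_def mult.assoc)

lemma fejer_sum_add:
  assumes "continuous_on {0..2 * pi} u" "continuous_on {0..2 * pi} v"
  shows "fejer_sum n (\<lambda>s. u s + v s) t = fejer_sum n u t + fejer_sum n v t"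
  by (simp add: fejer_sum_def fourier_add[OF assms] distrib_right sum.distrib add_divide_distrib)

lemma fejer_sum_mult: "fejer_sum n (\<lambda>s. c * u s) t = c * fejer_sum n u t"
  by (simp add: fejer_sum_def fourier_mult sum_distrib_left mult.assoc)

lemma fejer_sum_sum:
  assumes "finite I" "\<And>i. i \<in> I \<Longrightarrow> continuous_on {0..2 * pi} (u i)"
  shows "fejer_sum n (\<lambda>s. \<Sum>i\<in>I. u i s) t = (\<Sum>i\<in>I. fejer_sum n (u i) t)"
  using assms
proof (induction rule: finite_induct)
  case empty
  show ?case using fejer_sum_mult[of n 0 "\<lambda>_. 0" t] by simp
next
  case (insert i I)
  then show ?case by (simp add: fejer_sum_add continuous_on_sum)
qed

lemma fourier_cis: "fourier (\<lambda>s. cis (of_int k * s)) m = (if k = m then 1 else 0)"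
proof -
  have eq: "cis (of_int k * s) * cis (- (of_int m * s)) = cis (of_int (k - m) * s)" for s
    by (simp add: cis_mult algebra_simps)
  have "integral {0..2 * pi} (\<lambda>s. cis (of_int (k - m) * s)) = (if k = m then 2 * pi else 0)"
  proof (cases "k = m")
    case False
    define c where "c = real_of_int (k - m)"
    have c: "c \<noteq> 0" using False by (simp add: c_def)
    have "((\<lambda>s. cis (c * s)) has_integral cis (c * (2 * pi)) / (\<i> * c) - cis (c * 0) / (\<i> * c)) {0..2 * pi}"
    proof (rule fundamental_theorem_of_calculus)
      show "((\<lambda>s. cis (c * s) / (\<i> * c)) has_vector_derivative cis (c * s)) (at s within {0..2 * pi})" for s
        using has_vector_derivative_divide[OF has_vector_derivative_cis[of c s "{0..2 * pi}"], of "\<i> * c"] c by simp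
    qed simp
    moreover have "cis (c * (2 * pi)) = 1"
      using cis_multiple_2pi[of c] by (simp add: c_def mult.commute)
    ultimately show ?thesis using False by (simp add: c_def integral_unique)
  qed (simp add: scaleR_conv_of_real)
  then show ?thesis by (simp add: fourier_def eq)
qed

lemma fourier_sum:
  assumes "finite I"
  shows "fourier (\<lambda>s. \<Sum>j\<in>I. a j * cis (of_int j * s)) m = (if m \<in> I then a m else 0)"
  using assms
proof (induction rule: finite_induct)
  case empty
  show ?case using fourier_mult[of 0 "\<lambda>_. 0" m] by simp
next
  case (insert i I)
  have "fourier (\<lambda>s. a i * cis (of_int i * s) + (\<Sum>j\<in>I. a j * cis (of_int j * s))) m
      = fourier (\<lambda>s. a i * cis (of_int i * s)) m + fourier (\<lambda>s. \<Sum>j\<in>I. a j * cis (of_int j * s)) m"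
    by (rule fourier_add) (intro continuous_intros)+
  also have "fourier (\<lambda>s. a i * cis (of_int i * s)) m = (if i = m then a i else 0)"
    by (simp add: fourier_mult fourier_cis)
  finally show ?case using insert by auto
qed

lemma fourier_bounded:
  assumes "continuous_on {0..2 * pi} u" "\<And>s. s \<in> {0..2 * pi} \<Longrightarrow> cmod (u s) \<le> B"
  shows "cmod (fourier u m) \<le> B"
proof -
  have "cmod (integral {0..2 * pi} (\<lambda>s. u s * cis (- (of_int m * s)))) \<le> B * (2 * pi - 0)"
    by (rule integral_bound) (use assms in \<open>auto simp: norm_mult intro!: continuous_intros\<close>)
  then show ?thesis by (simp add: fourier_def norm_divide divide_le_eq)
qed

lemma fejer_sum_cis:
  "fejer_sum n (\<lambda>s. cis (of_int k * s)) t
    = of_nat (card {(j, l). j < n \<and> l < n \<and> int j - int l = k}) / n * cis (of_int k * t)"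
proof -
  define A where "A = {p \<in> {..<n} \<times> {..<n}. int (fst p) - int (snd p) = k}"
  have "(\<Sum>j<n. \<Sum>l<n. fourier (\<lambda>s. cis (of_int k * s)) (int j - int l) * cis (of_int (int j - int l) * t))
      = (\<Sum>p\<in>{..<n} \<times> {..<n}. if int (fst p) - int (snd p) = k then cis (of_int k * t) else 0)"
    unfolding sum.cartesian_product by (intro sum.cong) (auto simp: fourier_cis)
  also have "\<dots> = (\<Sum>p\<in>A. cis (of_int k * t))"
    unfolding A_def by (rule sum.inter_filter[symmetric]) simp
  also have "\<dots> = of_nat (card A) * cis (of_int k * t)" by simp
  also have "A = {(j, l). j < n \<and> l < n \<and> int j - int l = k}" by (auto simp: A_def)
  finally show ?thesis by (simp add: fejer_sum_def)
qed

lemma fejer_sum_const: "n \<ge> 1 \<Longrightarrow> fejer_sum n (\<lambda>_. c) t = c"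
proof -
  assume n: "n \<ge> 1"
  have "{(j, l). j < n \<and> l < n \<and> int j - int l = 0} = (\<lambda>j. (j, j)) ` {..<n}" by auto
  then have "card {(j, l). j < n \<and> l < n \<and> int j - int l = 0} = n"
    by (simp add: card_image inj_on_def)
  then show ?thesis
    using fejer_sum_mult[of n c "\<lambda>s. cis (of_int 0 * s)" t] fejer_sum_cis[of n 0 t] n by simp
qed

lemma fejer_sum_cis_1:
  assumes "n \<ge> 1"
  shows "fejer_sum n (\<lambda>s. cis s) t = of_real ((real n - 1) / real n) * cis t"
    and "fejer_sum n (\<lambda>s. cis (- s)) t = of_real ((real n - 1) / real n) * cis (- t)"
proof -
  have "{(j, l). j < n \<and> l < n \<and> int j - int l = 1} = (\<lambda>l. (Suc l, l)) ` {..<n - 1}"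
    by (auto simp: image_iff)
  then have "card {(j, l). j < n \<and> l < n \<and> int j - int l = 1} = n - 1"
    by (simp add: card_image inj_on_def)
  then show "fejer_sum n (\<lambda>s. cis s) t = of_real ((real n - 1) / real n) * cis t"
    using fejer_sum_cis[of n 1 t] assms by (simp add: of_nat_diff)
  have "{(j, l). j < n \<and> l < n \<and> int j - int l = - 1} = (\<lambda>l. (l, Suc l)) ` {..<n - 1}"
    by (auto simp: image_iff)
  then have "card {(j, l). j < n \<and> l < n \<and> int j - int l = - 1} = n - 1"
    by (simp add: card_image inj_on_def)
  then show "fejer_sum n (\<lambda>s. cis (- s)) t = of_real ((real n - 1) / real n) * cis (- t)"
    using fejer_sum_cis[of n "- 1" t] assms by (simp add: of_nat_diff)
qed

definition fejer_kernel :: "nat \<Rightarrow> real \<Rightarrow> real"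
  where "fejer_kernel n x = (cmod (\<Sum>j<n. cis (of_nat j * x)))\<^sup>2 / n"

lemma fejer_kernel_nonneg: "0 \<le> fejer_kernel n x"
  by (simp add: fejer_kernel_def)

lemma continuous_fejer_kernel: "continuous_on S (\<lambda>s. fejer_kernel n (t - s))"
  unfolding fejer_kernel_def divide_inverse by (intro continuous_intros)

lemma fejer_sum_eq_integral:
  assumes u: "continuous_on {0..2 * pi} u"
  shows "fejer_sum n u t = integral {0..2 * pi} (\<lambda>s. u s * of_real (fejer_kernel n (t - s))) / (2 * pi)"
proof -
  have kernel: "of_real (fejer_kernel n x) = (\<Sum>j<n. \<Sum>l<n. cis (of_int (int j - int l) * x)) / n" for x
  proof -
    have "complex_of_real ((cmod (\<Sum>j<n. cis (of_nat j * x)))\<^sup>2)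
        = (\<Sum>j<n. cis (of_nat j * x)) * cnj (\<Sum>l<n. cis (of_nat l * x))"
      by (rule complex_norm_square)
    also have "\<dots> = (\<Sum>j<n. \<Sum>l<n. cis (of_nat j * x) * cis (- (of_nat l * x)))"
      by (simp add: sum_product cis_cnj)
    finally show ?thesis by (simp add: fejer_kernel_def cis_mult algebra_simps)
  qed
  have "integral {0..2 * pi} (\<lambda>s. u s * of_real (fejer_kernel n (t - s)))
      = integral {0..2 * pi} (\<lambda>s. \<Sum>j<n. \<Sum>l<n.
          cis (of_int (int j - int l) * t) / n * (u s * cis (- (of_int (int j - int l) * s))))"
  proof (rule integral_cong)
    fix s
    have cis: "cis (of_int m * (t - s)) = cis (of_int m * t) * cis (- (of_int m * s))" for m
      by (simp add: cis_mult algebra_simps)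
    show "u s * of_real (fejer_kernel n (t - s)) = (\<Sum>j<n. \<Sum>l<n.
        cis (of_int (int j - int l) * t) / n * (u s * cis (- (of_int (int j - int l) * s))))"
      unfolding kernel cis by (simp add: sum_distrib_left sum_divide_distrib mult_ac)
  qed
  also have "\<dots> = (\<Sum>j<n. \<Sum>l<n. cis (of_int (int j - int l) * t) / n *
      integral {0..2 * pi} (\<lambda>s. u s * cis (- (of_int (int j - int l) * s))))"
    by (subst integral_sum, simp, intro integrable_continuous_interval continuous_intros u, intro sum.cong refl,
        subst integral_sum, simp, intro integrable_continuous_interval continuous_intros u, simp)
  finally show ?thesis
    by (simp add: fejer_sum_def fourier_def sum_divide_distrib mult_ac)
qed

lemma fejer_sum_of_real:
  assumes "continuous_on {0..2 * pi} v"
  shows "fejer_sum n (\<lambda>s. of_real (v s)) t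
    = of_real (integral {0..2 * pi} (\<lambda>s. v s * fejer_kernel n (t - s)) / (2 * pi))"
proof -
  have "(\<lambda>s. v s * fejer_kernel n (t - s)) integrable_on {0..2 * pi}"
    by (intro integrable_continuous_interval continuous_on_mult assms continuous_fejer_kernel)
  from integral_linear[OF this bounded_linear_of_real] have "integral {0..2 * pi} (\<lambda>s. complex_of_real (v s * fejer_kernel n (t - s)))
      = of_real (integral {0..2 * pi} (\<lambda>s. v s * fejer_kernel n (t - s)))"
    by (simp add: o_def)
  then show ?thesis
    by (simp add: fejer_sum_eq_integral[OF continuous_on_of_real[OF assms]])
qed

text \<open>Positivity of the kernel makes the Fejer sum monotone.\<close>

lemma fejer_sum_norm_le:
  assumes u: "continuous_on {0..2 * pi} u" and v: "continuous_on {0..2 * pi} v"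
    and le: "\<And>s. s \<in> {0..2 * pi} \<Longrightarrow> cmod (u s) \<le> v s"
  shows "cmod (fejer_sum n u t) \<le> Re (fejer_sum n (\<lambda>s. of_real (v s)) t)"
proof -
  have "cmod (integral {0..2 * pi} (\<lambda>s. u s * of_real (fejer_kernel n (t - s))))
      \<le> integral {0..2 * pi} (\<lambda>s. v s * fejer_kernel n (t - s))"
  proof (rule integral_norm_bound_integral)
    show "cmod (u s * of_real (fejer_kernel n (t - s))) \<le> v s * fejer_kernel n (t - s)"
      if "s \<in> {0..2 * pi}" for s
      using le[OF that] fejer_kernel_nonneg[of n "t - s"] by (simp add: norm_mult mult_right_mono)
  qed (intro integrable_continuous_interval continuous_intros u v continuous_fejer_kernel)+
  then show ?thesis
    by (simp add: fejer_sum_of_real[OF v] fejer_sum_eq_integral[OF u] norm_divide divide_right_mono)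
qed

lemma fejer_sum_bounded:
  assumes "n \<ge> 1" "continuous_on {0..2 * pi} u" "\<And>s. s \<in> {0..2 * pi} \<Longrightarrow> cmod (u s) \<le> B"
  shows "cmod (fejer_sum n u t) \<le> B"
  using fejer_sum_norm_le[OF assms(2) continuous_on_const assms(3), of n t] fejer_sum_const[OF assms(1), of "of_real B" t]
  by simp

lemma fejer_sum_nonneg:
  assumes u: "continuous_on {0..2 * pi} u" and pos: "\<And>s. u s \<in> \<real>\<^sub>\<ge>\<^sub>0"
  shows "fejer_sum n u t \<in> \<real>\<^sub>\<ge>\<^sub>0"
proof -
  have Re_u: "continuous_on {0..2 * pi} (\<lambda>s. Re (u s))" by (intro continuous_intros u)
  have "u = (\<lambda>s. of_real (Re (u s)))"
    using pos by (auto simp: complex_nonneg_Reals_iff complex_eq_iff)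
  then have "fejer_sum n u t
      = of_real (integral {0..2 * pi} (\<lambda>s. Re (u s) * fejer_kernel n (t - s)) / (2 * pi))"
    using fejer_sum_of_real[OF Re_u] by metis
  moreover have "0 \<le> integral {0..2 * pi} (\<lambda>s. Re (u s) * fejer_kernel n (t - s))"
    using pos fejer_kernel_nonneg
    by (intro integral_nonneg integrable_continuous_interval continuous_on_mult Re_u continuous_fejer_kernel)
      (auto simp: complex_nonneg_Reals_iff)
  ultimately show ?thesis by simp
qed

text \<open>The kernel centred at \<open>z\<close> has second moment \<open>\<integral> |z - w|\<^sup>2 = 2 - 2 (1 - 1 / n) = 2 / n\<close>.\<close>

lemma fejer_mean_approximates:
  assumes n: "n \<ge> 1" and f: "continuous_on UNIV f"
    and le: "\<And>w. cmod (f z - f w) \<le> a + b * (dist z w)\<^sup>2"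
  shows "cmod (f z - fejer_mean n f z) \<le> a + 2 * b / n"
proof -
  define q where "q = (real n - 1) / real n"
  obtain t where z: "z = circle_pt t" using ex_circle_pt by blast
  have fc: "continuous_on S (\<lambda>s. f (circle_pt s))" for S by (rule continuous_comp_circle_pt[OF f])
  have c2: "continuous_on {0..2 * pi} (\<lambda>s. (- of_real b * cis t) * cis (- s))"
    and c3: "continuous_on {0..2 * pi} (\<lambda>s. (- of_real b * cis (- t)) * cis s)"
    by (intro continuous_intros)+
  note c1 = continuous_on_add[OF c2 c3]
  have "f z - fejer_mean n f z = - fejer_sum n (\<lambda>s. f (circle_pt s) + (- f z)) t"
    using fejer_sum_const[OF n, of "- f z" t]
    by (subst fejer_sum_add) (auto simp: z fejer_mean_circle_pt intro!: fc)
  then have "cmod (f z - fejer_mean n f z) = cmod (fejer_sum n (\<lambda>s. f (circle_pt s) + (- f z)) t)"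
    by simp
  also have "\<dots> \<le> Re (fejer_sum n (\<lambda>s. of_real (a + b * (dist z (circle_pt s))\<^sup>2)) t)"
  proof (rule fejer_sum_norm_le)
    show "continuous_on {0..2 * pi} (\<lambda>s. a + b * (dist z (circle_pt s))\<^sup>2)"
      by (intro continuous_intros continuous_circle_pt)
    show "cmod (f (circle_pt s) + - f z) \<le> a + b * (dist z (circle_pt s))\<^sup>2" for s
      using le[of "circle_pt s"] by (simp add: norm_minus_commute)
  qed (intro continuous_intros fc)
  also have "(\<lambda>s. complex_of_real (a + b * (dist z (circle_pt s))\<^sup>2))
      = (\<lambda>s. of_real (a + 2 * b) + ((- of_real b * cis t) * cis (- s) + (- of_real b * cis (- t)) * cis s))"
  proof
    fix s
    have "complex_of_real ((dist z (circle_pt s))\<^sup>2) = (cis t - cis s) * cnj (cis t - cis s)"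
      unfolding z dist_circle_def Rep_circle_pt dist_norm by (rule complex_norm_square)
    also have "\<dots> = 2 - cis t * cis (- s) - cis (- t) * cis s"
      by (simp add: cis_cnj cis_mult algebra_simps)
    finally have "complex_of_real ((dist z (circle_pt s))\<^sup>2) = 2 - cis t * cis (- s) - cis (- t) * cis s" .
    then show "complex_of_real (a + b * (dist z (circle_pt s))\<^sup>2)
        = of_real (a + 2 * b) + ((- of_real b * cis t) * cis (- s) + (- of_real b * cis (- t)) * cis s)"
      by (simp only: of_real_add of_real_mult of_real_numeral) (simp add: algebra_simps)
  qed
  also have "fejer_sum n (\<lambda>s. of_real (a + 2 * b)
      + ((- of_real b * cis t) * cis (- s) + (- of_real b * cis (- t)) * cis s)) t = of_real (a + 2 * b)
      + ((- of_real b * cis t) * fejer_sum n (\<lambda>s. cis (- s)) t + (- of_real b * cis (- t)) * fejer_sum n (\<lambda>s. cis s) t)"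
    unfolding fejer_sum_add[OF continuous_on_const c1] fejer_sum_add[OF c2 c3]
      fejer_sum_mult fejer_sum_const[OF n] by (rule refl)
  also have "\<dots> = of_real (a + 2 * b) - of_real (2 * b * q) * (cis t * cis (- t))"
    unfolding fejer_sum_cis_1[OF n] q_def[symmetric] by (simp add: algebra_simps)
  also have "cis t * cis (- t) = 1" by (simp add: cis_mult)
  also have "Re (of_real (a + 2 * b) - of_real (2 * b * q) * 1) = a + 2 * b / n"
    using n by (simp add: q_def field_simps)
  finally show ?thesis .
qed

text \<open>Integration by parts; the boundary terms cancel by periodicity.\<close>

lemma fourier_derivative:
  assumes f: "circle_derivative f g"
  shows "fourier g m = \<i> * of_int m * fourier (\<lambda>t. f (circle_pt t)) m"
proof -
  define F where "F t = f (circle_pt t)" for t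
  have F: "(F has_vector_derivative g t) (at t)" for t
    using f by (simp add: circle_derivative_def F_def[abs_def])
  have F_cont: "continuous_on S F" for S
    unfolding F_def by (rule circle_derivative_continuous[OF f])
  have g: "continuous_on S g" for S
    using f by (auto simp: circle_derivative_def intro: continuous_on_subset)
  define e where "e s = cis (- (of_int m * s))" for s
  have e: "(e has_vector_derivative (- \<i> * of_int m * e t)) (at t)" for t
    using has_vector_derivative_cis[of "- of_int m" t UNIV] by (simp add: e_def[abs_def])
  have e_cont: "continuous_on S e" for S unfolding e_def by (intro continuous_intros)
  have "((\<lambda>t. F t * (- \<i> * of_int m * e t) + g t * e t) has_integral
      F (2 * pi) * e (2 * pi) - F 0 * e 0) {0..2 * pi}"
    by (rule fundamental_theorem_of_calculus)
      (simp, rule has_vector_derivative_at_within[OF has_vector_derivative_mult[OF F e]])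
  moreover have "e (2 * pi) = 1"
    using cis_multiple_2pi[of "- of_int m"] by (simp add: e_def mult_ac)
  moreover have "F (2 * pi) = F 0" "e 0 = 1" by (simp_all add: F_def e_def)
  ultimately have "integral {0..2 * pi} (\<lambda>t. F t * (- \<i> * of_int m * e t) + g t * e t) = 0"
    by (simp add: integral_unique)
  moreover have "integral {0..2 * pi} (\<lambda>t. F t * (- \<i> * of_int m * e t) + g t * e t)
      = integral {0..2 * pi} (\<lambda>t. (- \<i> * of_int m) * (F t * e t)) + integral {0..2 * pi} (\<lambda>t. g t * e t)"
    by (subst Henstock_Kurzweil_Integration.integral_add[symmetric])
      (auto simp: mult_ac intro!: integrable_continuous_interval continuous_intros F_cont e_cont g)
  ultimately have "integral {0..2 * pi} (\<lambda>t. g t * e t) = \<i> * of_int m * integral {0..2 * pi} (\<lambda>t. F t * e t)"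
    by (simp add: add_eq_0_iff)
  then show ?thesis by (simp add: fourier_def e_def F_def)
qed

text \<open>Fejer means commute with differentiation, since both act diagonally on frequencies. This is why they do
  not increase the Lipschitz seminorm.\<close>

lemma fejer_mean_derivative:
  assumes f: "circle_derivative f g"
  shows "circle_derivative (fejer_mean n f) (fejer_sum n g)"
  unfolding circle_derivative_def
proof (intro conjI allI)
  show "continuous_on UNIV (fejer_sum n g)"
    unfolding fejer_sum_def[abs_def] by (cases "n = 0") (auto intro!: continuous_intros)
  fix \<theta>
  have cis: "((\<lambda>t. cis (of_int m * t)) has_vector_derivative \<i> * of_int m * cis (of_int m * \<theta>)) (at \<theta>)" for m
    using has_vector_derivative_cis[of "of_int m" \<theta> UNIV] by simp
  have "((\<lambda>t. \<Sum>j<n. \<Sum>l<n. fourier (\<lambda>t. f (circle_pt t)) (int j - int l) / n * cis (of_int (int j - int l) * t))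
      has_vector_derivative (\<Sum>j<n. \<Sum>l<n. fourier (\<lambda>t. f (circle_pt t)) (int j - int l) / n *
        (\<i> * of_int (int j - int l) * cis (of_int (int j - int l) * \<theta>)))) (at \<theta>)"
    by (intro has_vector_derivative_sum has_vector_derivative_mult_right cis)
  then show "((\<lambda>t. fejer_mean n f (circle_pt t)) has_vector_derivative fejer_sum n g \<theta>) (at \<theta>)"
    unfolding fejer_mean_circle_pt fejer_sum_def fourier_derivative[OF f]
    by (simp add: sum_divide_distrib mult_ac)
qed

lemma fejer_mean_add:
  assumes "continuous_on UNIV f" "continuous_on UNIV g"
  shows "fejer_mean n (\<lambda>z. f z + g z) = (\<lambda>z. fejer_mean n f z + fejer_mean n g z)"
proof
  fix z obtain t where z: "z = circle_pt t" using ex_circle_pt by blast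
  show "fejer_mean n (\<lambda>z. f z + g z) z = fejer_mean n f z + fejer_mean n g z"
    unfolding z fejer_mean_circle_pt 
    by (intro fejer_sum_add continuous_comp_circle_pt[OF assms(1)] continuous_comp_circle_pt[OF assms(2)])
qed

lemma fejer_mean_mult: "fejer_mean n (\<lambda>z. c * f z) = (\<lambda>z. c * fejer_mean n f z)"
  by (simp add: fun_eq_iff fejer_mean_def fourier_mult sum_distrib_left mult.assoc)

lemma fejer_mean_1: "n \<ge> 1 \<Longrightarrow> fejer_mean n (\<lambda>_. 1) = (\<lambda>_. 1)"
proof
  fix z assume n: "n \<ge> 1"
  obtain t where z: "z = circle_pt t" using ex_circle_pt by blast
  show "fejer_mean n (\<lambda>_. 1) z = 1" unfolding z fejer_mean_circle_pt by (rule fejer_sum_const[OF n])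
qed

lemma fejer_mean_bounded:
  assumes "n \<ge> 1" "continuous_on UNIV f" "\<And>z. cmod (f z) \<le> B"
  shows "cmod (fejer_mean n f z) \<le> B"
proof -
  obtain t where z: "z = circle_pt t" using ex_circle_pt by blast
  show ?thesis unfolding z fejer_mean_circle_pt
    by (rule fejer_sum_bounded[OF assms(1) continuous_comp_circle_pt[OF assms(2)] assms(3)])
qed

lemma continuous_fejer_mean: "continuous_on UNIV (fejer_mean n f)"
  unfolding fejer_mean_def[abs_def]
  by (cases "n = 0") (auto intro!: continuous_intros continuous_Rep_circle simp: Rep_circle_nonzero)

text \<open>A Fejer mean is an average of values, so it preserves pointwise positive semidefiniteness.\<close>

lemma fejer_mean_positive_fun_matrix:
  assumes F: "\<And>i j. \<lbrakk>i < m; j < m\<rbrakk> \<Longrightarrow> continuous_on UNIV (F i j)"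
    and pos: "positive_fun_matrix m F"
  shows "positive_fun_matrix m (\<lambda>i j. fejer_mean n (F i j))"
proof -
  have "(\<Sum>i<m. \<Sum>j<m. fejer_mean n (F i j) z * x j * cnj (x i)) \<in> \<real>\<^sub>\<ge>\<^sub>0" for z x
  proof -
    obtain t where z: "z = circle_pt t" using ex_circle_pt by blast
    have cont: "continuous_on {0..2 * pi} (\<lambda>s. x j * cnj (x i) * F i j (circle_pt s))" if "i < m" "j < m" for i j
      by (intro continuous_intros continuous_comp_circle_pt F that)
    have "(\<Sum>i<m. \<Sum>j<m. fejer_mean n (F i j) z * x j * cnj (x i))
        = (\<Sum>i<m. \<Sum>j<m. fejer_sum n (\<lambda>s. x j * cnj (x i) * F i j (circle_pt s)) t)"
      by (simp add: z fejer_mean_circle_pt fejer_sum_mult mult_ac)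
    also have "\<dots> = (\<Sum>i<m. fejer_sum n (\<lambda>s. \<Sum>j<m. x j * cnj (x i) * F i j (circle_pt s)) t)"
      using cont by (intro sum.cong refl fejer_sum_sum[symmetric]) auto
    also have "\<dots> = fejer_sum n (\<lambda>s. \<Sum>i<m. \<Sum>j<m. x j * cnj (x i) * F i j (circle_pt s)) t"
      using cont by (intro fejer_sum_sum[symmetric] continuous_on_sum) auto
    also have "\<dots> \<in> \<real>\<^sub>\<ge>\<^sub>0"
    proof (rule fejer_sum_nonneg)
      show "continuous_on {0..2 * pi} (\<lambda>s. \<Sum>i<m. \<Sum>j<m. x j * cnj (x i) * F i j (circle_pt s))"
        using cont by (intro continuous_on_sum) auto
      have "\<forall>z x. (\<Sum>i<m. \<Sum>j<m. F i j z * x j * cnj (x i)) \<in> \<real>\<^sub>\<ge>\<^sub>0"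
        using pos by (subst (asm) positive_fun_matrix_iff_pointwise) (use F in auto)
      then show "(\<Sum>i<m. \<Sum>j<m. x j * cnj (x i) * F i j (circle_pt s)) \<in> \<real>\<^sub>\<ge>\<^sub>0" for s
        by (simp add: mult_ac)
    qed
    finally show ?thesis .
  qed
  then show ?thesis
    by (subst positive_fun_matrix_iff_pointwise) (auto intro: continuous_fejer_mean)
qed


section \<open>Lipschitz functions on the circle\<close>

text \<open>A chord is at least a quarter of its arc: the chord is \<open>2 sin(|x| / 2)\<close>, and \<open>sin y \<ge> y / 4\<close> on
  \<open>[0, \<pi> / 2]\<close>. The constant is chosen so that \<open>\<pi> < 4\<close> suffices.\<close>

lemma abs_le_4_norm_1_minus_cis:
  assumes "\<bar>x\<bar> \<le> pi"
  shows "\<bar>x\<bar> \<le> 4 * cmod (1 - cis x)"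
proof -
  define y where "y = \<bar>x\<bar> / 2"
  have y: "0 \<le> y" "y \<le> pi / 2" using assms by (auto simp: y_def)
  have "y / 4 \<le> sin y"
  proof (cases "y \<le> pi / 3")
    case True
    have "sin 0 - 0 / 4 \<le> sin y - y / 4"
    proof (rule DERIV_nonneg_imp_nondecreasing[OF y(1)])
      fix s assume "0 \<le> s" "s \<le> y"
      then have "cos (pi / 3) \<le> cos s" using True by (intro cos_monotone_0_pi_le) auto
      then show "\<exists>D. ((\<lambda>s. sin s - s / 4) has_real_derivative D) (at s) \<and> 0 \<le> D"
        by (intro exI[of _ "cos s - 1 / 4"]) (auto simp: cos_60 intro!: derivative_eq_intros)
    qed
    then show ?thesis by simp
  next
    case False
    then have "sin (pi / 3) \<le> sin y" using y by (intro sin_monotone_2pi_le) auto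
    moreover have "1 / 2 \<le> sin (pi / 3)" by (simp add: sin_60 real_le_rsqrt)
    ultimately show ?thesis using y pi_less_4 by linarith
  qed
  moreover have "cmod (1 - cis x) = 2 * \<bar>sin (x / 2)\<bar>"
  proof -
    have "(cmod (1 - cis x))\<^sup>2 = (1 - cos x)\<^sup>2 + (sin x)\<^sup>2" by (simp add: cmod_power2)
    also have "\<dots> = 2 - 2 * cos x"
      using sin_cos_squared_add[of x] by (simp add: power2_diff)
    also have "\<dots> = (2 * \<bar>sin (x / 2)\<bar>)\<^sup>2"
      using cos_double_sin[of "x / 2"] by (simp add: power_mult_distrib)
    finally show ?thesis by (rule power2_eq_imp_eq) simp_all
  qed
  moreover have "\<bar>sin (x / 2)\<bar> = sin y"
    using y sin_ge_zero[of y] by (cases "x \<ge> 0") (auto simp: y_def)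
  ultimately show ?thesis by (simp add: y_def)
qed

text \<open>Integrate the derivative along the shorter arc between the two points.\<close>

lemma lipschitz_if_derivative_le_1:
  assumes f: "circle_derivative f g" and g: "\<And>\<theta>. cmod (g \<theta>) \<le> 1"
  shows "cmod (f z - f w) \<le> 4 * dist z w"
proof -
  obtain s where s: "z = circle_pt s" using ex_circle_pt by blast
  define x where "x = Arg (Rep_circle w / Rep_circle z)"
  have x: "\<bar>x\<bar> \<le> pi" using mpi_less_Arg Arg_le_pi by (auto simp: x_def abs_le_iff minus_le_iff less_imp_le)
  have "cis x = Rep_circle w / Rep_circle z"
    unfolding x_def by (subst cis_Arg) (auto simp: sgn_eq norm_divide Rep_circle_nonzero)
  then have "Rep_circle w = cis (s + x)"
    by (simp add: s cis_mult[symmetric])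
  then have w: "w = circle_pt (s + x)" by (metis Rep_circle_inject Rep_circle_pt)
  have F: "((\<lambda>t. f (circle_pt t)) has_vector_derivative g t) (at t within S)" for t S
    using f by (simp add: circle_derivative_def has_vector_derivative_at_within)
  have step: "cmod (f (circle_pt b) - f (circle_pt a)) \<le> b - a" if "a \<le> b" for a b
  proof -
    have "integral {a..b} g = f (circle_pt b) - f (circle_pt a)"
      by (intro integral_unique fundamental_theorem_of_calculus F that)
    moreover have "cmod (integral {a..b} g) \<le> 1 * (b - a)"
      using f g that by (intro integral_bound) (auto simp: circle_derivative_def intro: continuous_on_subset)
    ultimately show ?thesis by simp
  qed
  have "cmod (f z - f w) \<le> \<bar>x\<bar>"
    using step[of s "s + x"] step[of "s + x" s] unfolding s w
    by (cases "x \<ge> 0") (auto simp: norm_minus_commute)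
  also have "\<dots> \<le> 4 * cmod (1 - cis x)" by (rule abs_le_4_norm_1_minus_cis[OF x])
  also have "cmod (1 - cis x) = dist z w"
  proof -
    have "cis s - cis (s + x) = cis s * (1 - cis x)" by (simp add: cis_mult[symmetric] algebra_simps)
    then show ?thesis by (simp add: dist_circle_def s w dist_norm norm_mult)
  qed
  finally show ?thesis .
qed

text \<open>The modulus of continuity \<open>4 d\<close> is at most \<open>1 / r + 4 r d\<^sup>2\<close> for each \<open>r > 0\<close>, and \<open>r = \<surd>n\<close> balances the first
  term against the second moment \<open>2 / n\<close>.\<close>

lemma fejer_mean_approximates_lipschitz:
  assumes n: "n \<ge> 1" and f: "circle_derivative f g" "\<And>\<theta>. cmod (g \<theta>) \<le> 1"
  shows "cmod (f z - fejer_mean n f z) \<le> 9 / sqrt n"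
proof -
  have "cmod (f z - fejer_mean n f z) \<le> 1 / sqrt n + 2 * (4 * sqrt n) / n"
  proof (rule fejer_mean_approximates[OF n])
    show "continuous_on UNIV f"
      by (intro continuous_if_continuous_circle_pt circle_derivative_continuous[OF f(1)])
    fix w
    define d r where "d = dist z w" and "r = sqrt n"
    have r: "r > 0" using n by (simp add: r_def)
    have "0 \<le> (2 * d * r - 1)\<^sup>2" by simp
    then have "4 * d * r \<le> 1 + 4 * d\<^sup>2 * r\<^sup>2" by (simp add: power2_diff power_mult_distrib)
    then have "4 * d \<le> 1 / r + (4 * r) * d\<^sup>2" using r by (simp add: field_simps power2_eq_square)
    then show "cmod (f z - f w) \<le> 1 / sqrt n + 4 * sqrt n * (dist z w)\<^sup>2"
      using lipschitz_if_derivative_le_1[OF f, of z w] by (simp add: d_def r_def)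
  qed
  also have "\<dots> = 9 / sqrt n" using n by (simp add: field_simps)
  finally show ?thesis .
qed

text \<open>Uniform continuity bounds the oscillation of \<open>f\<close> at distance \<open>d\<close> by \<open>\<epsilon> / 2\<close> plus a multiple of \<open>d\<^sup>2\<close>.\<close>

lemma fejer_mean_converges:
  assumes f: "continuous_on UNIV f" and \<epsilon>: "\<epsilon> > 0"
  shows "\<exists>n\<ge>1. \<forall>z. cmod (f z - fejer_mean n f z) \<le> \<epsilon>"
proof -
  obtain B where B: "\<And>z. cmod (f z) \<le> B" using circle_bounded[OF f] by blast
  have B0: "0 \<le> B" using B[of undefined] norm_ge_zero[of "f undefined"] by linarith
  have "uniformly_continuous_on UNIV f" by (rule compact_uniformly_continuous[OF f compact_UNIV_circle])
  then obtain \<delta> where \<delta>: "\<delta> > 0" "\<And>z w. dist z w < \<delta> \<Longrightarrow> cmod (f z - f w) < \<epsilon> / 2"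
    using \<epsilon> unfolding uniformly_continuous_on_def by (metis UNIV_I dist_commute dist_norm half_gt_zero)
  define b where "b = 2 * B / \<delta>\<^sup>2"
  have b0: "0 \<le> b" using B0 by (simp add: b_def)
  have le: "cmod (f z - f w) \<le> \<epsilon> / 2 + b * (dist z w)\<^sup>2" for z w
  proof (cases "dist z w < \<delta>")
    case True
    then show ?thesis using \<delta>(2)[of z w] b0 by (simp add: add_increasing2 less_imp_le)
  next
    case False
    have "cmod (f z - f w) \<le> 2 * B" using norm_triangle_ineq4[of "f z" "f w"] B[of z] B[of w] by linarith
    also have "\<dots> = b * \<delta>\<^sup>2" using \<delta>(1) by (simp add: b_def)
    also have "\<dots> \<le> b * (dist z w)\<^sup>2" using False \<delta>(1) b0 by (intro mult_left_mono power_mono) auto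
    finally show ?thesis using \<epsilon> by linarith
  qed
  obtain n :: nat where n: "n > max 1 (4 * b / \<epsilon>)" using reals_Archimedean2 by blast
  then have n1: "n \<ge> 1" by simp
  have "2 * b / n \<le> \<epsilon> / 2" using n \<epsilon> by (simp add: field_simps)
  then have "cmod (f z - fejer_mean n f z) \<le> \<epsilon>" for z
    using fejer_mean_approximates[OF n1 f le, of z] by simp
  then show ?thesis using n1 by blast
qed


section \<open>Trigonometric polynomials\<close>

lemma fejer_riesz_monomial:
  assumes "\<bar>k\<bar> \<le> int n - 1"
  shows "(\<lambda>z. Rep_circle z powi k) \<in> fejer_riesz n"
proof -
  have "(\<Sum>l = - (int n - 1)..int n - 1. (if l = k then 1 else 0) * Rep_circle z powi l) = Rep_circle z powi k" for z
  proof -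
    have "(\<Sum>l = - (int n - 1)..int n - 1. (if l = k then 1 else 0) * Rep_circle z powi l)
        = (\<Sum>l = - (int n - 1)..int n - 1. if l = k then Rep_circle z powi l else 0)"
      by (rule sum.cong) auto
    then show ?thesis using assms by (auto simp: sum.delta)
  qed
  then show ?thesis unfolding fejer_riesz_def by (auto intro!: exI[of _ "\<lambda>l. if l = k then 1 else 0"])
qed

lemma fejer_riesz_add:
  assumes "f \<in> fejer_riesz n" "g \<in> fejer_riesz n"
  shows "(\<lambda>z. f z + g z) \<in> fejer_riesz n"
proof -
  obtain a b where "\<And>z. f z = (\<Sum>k = - (int n - 1)..int n - 1. a k * Rep_circle z powi k)"
      "\<And>z. g z = (\<Sum>k = - (int n - 1)..int n - 1. b k * Rep_circle z powi k)"
    using assms unfolding fejer_riesz_def by blast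
  then show ?thesis unfolding fejer_riesz_def
    by (auto intro!: exI[of _ "\<lambda>k. a k + b k"] simp: distrib_right sum.distrib)
qed

lemma fejer_riesz_mult:
  assumes "f \<in> fejer_riesz n"
  shows "(\<lambda>z. c * f z) \<in> fejer_riesz n"
proof -
  obtain a where "\<And>z. f z = (\<Sum>k = - (int n - 1)..int n - 1. a k * Rep_circle z powi k)"
    using assms unfolding fejer_riesz_def by blast
  then show ?thesis unfolding fejer_riesz_def
    by (auto intro!: exI[of _ "\<lambda>k. c * a k"] simp: sum_distrib_left mult.assoc)
qed

lemma fejer_riesz_sum:
  assumes "finite I" "\<And>i. i \<in> I \<Longrightarrow> f i \<in> fejer_riesz n"
  shows "(\<lambda>z. \<Sum>i\<in>I. f i z) \<in> fejer_riesz n"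
  using assms
proof (induction rule: finite_induct)
  case empty
  show ?case unfolding fejer_riesz_def by (auto intro!: exI[of _ "\<lambda>_. 0"])
qed (auto intro: fejer_riesz_add)

lemma fejer_riesz_cnj:
  assumes "f \<in> fejer_riesz n"
  shows "(\<lambda>z. cnj (f z)) \<in> fejer_riesz n"
proof -
  obtain a where a: "\<And>z. f z = (\<Sum>k = - (int n - 1)..int n - 1. a k * Rep_circle z powi k)"
    using assms unfolding fejer_riesz_def by blast
  have cnj_Rep: "cnj (Rep_circle z) = inverse (Rep_circle z)" for z
  proof -
    obtain t where "z = circle_pt t" using ex_circle_pt by blast
    then show ?thesis by (simp add: cis_cnj)
  qed
  have "cnj (f z) = (\<Sum>k = - (int n - 1)..int n - 1. cnj (a k) * Rep_circle z powi (- k))" for z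
    unfolding a by (simp add: cnj_Rep power_int_inverse power_int_minus)
  then have "(\<lambda>z. cnj (f z)) = (\<lambda>z. \<Sum>k = - (int n - 1)..int n - 1. cnj (a k) * Rep_circle z powi (- k))"
    by blast
  also have "\<dots> \<in> fejer_riesz n"
    by (intro fejer_riesz_sum fejer_riesz_mult fejer_riesz_monomial) auto
  finally show ?thesis .
qed

lemma fejer_mean_in_fejer_riesz: "fejer_mean n f \<in> fejer_riesz n"
proof -
  have "(\<lambda>z. inverse (of_nat n) * (\<Sum>j<n. \<Sum>l<n.
      fourier (\<lambda>t. f (circle_pt t)) (int j - int l) * Rep_circle z powi (int j - int l))) \<in> fejer_riesz n"
    by (intro fejer_riesz_mult fejer_riesz_sum fejer_riesz_monomial) auto
  then show ?thesis by (simp add: fejer_mean_def[abs_def] field_simps)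
qed

lemma fejer_riesz_smooth: "fejer_riesz n \<subseteq> circle_smooth"
proof
  fix f assume "f \<in> fejer_riesz n"
  then obtain a where a: "\<And>z. f z = (\<Sum>k = - (int n - 1)..int n - 1. a k * Rep_circle z powi k)"
    unfolding fejer_riesz_def by blast
  define F where "F m \<theta> = (\<Sum>k = - (int n - 1)..int n - 1. a k * (\<i> * of_int k) ^ m * cis (of_int k * \<theta>))"
    for m \<theta>
  have cis: "((\<lambda>t. cis (of_int k * t)) has_vector_derivative \<i> * of_int k * cis (of_int k * \<theta>)) (at \<theta>)" for k \<theta>
    using has_vector_derivative_cis[of "of_int k" \<theta> UNIV] by simp
  have "(F m has_vector_derivative F (Suc m) \<theta>) (at \<theta>)" for m \<theta>
  proof -
    have "(F m has_vector_derivative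
        (\<Sum>k = - (int n - 1)..int n - 1. a k * (\<i> * of_int k) ^ m * (\<i> * of_int k * cis (of_int k * \<theta>)))) (at \<theta>)"
      unfolding F_def[abs_def] by (intro has_vector_derivative_sum has_vector_derivative_mult_right cis)
    then show ?thesis by (simp add: F_def mult_ac)
  qed
  moreover have "F 0 \<theta> = f (circle_pt \<theta>)" for \<theta> by (simp add: F_def a cis_power_int)
  ultimately show "f \<in> circle_smooth" unfolding circle_smooth_def by blast
qed

lemma circle_smooth_derivative:
  assumes "f \<in> circle_smooth"
  obtains g where "circle_derivative f g"
proof -
  obtain F where F: "\<And>\<theta>. F 0 \<theta> = f (circle_pt \<theta>)"
      "\<And>m \<theta>. (F m has_vector_derivative F (Suc m) \<theta>) (at \<theta>)"
    using assms unfolding circle_smooth_def by blast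
  have "F 0 = (\<lambda>t. f (circle_pt t))" using F(1) by blast
  moreover have "continuous_on UNIV (F 1)"
    by (rule continuous_at_imp_continuous_on) (use F(2) has_vector_derivative_continuous in blast)
  ultimately have "circle_derivative f (F 1)"
    using F(2)[of 0] by (simp add: circle_derivative_def)
  then show ?thesis by (rule that)
qed

lemma circle_smooth_continuous: "f \<in> circle_smooth \<Longrightarrow> continuous_on UNIV f"
  by (metis circle_smooth_derivative circle_derivative_continuous continuous_if_continuous_circle_pt)

lemma sup_norm_le_iff:
  assumes "continuous_on UNIV f"
  shows "sup_norm f \<le> c \<longleftrightarrow> (\<forall>z. cmod (f z) \<le> c)"
proof -
  obtain B where "\<And>z. cmod (f z) \<le> B" using circle_bounded[OF assms] by blast
  then have "bdd_above (range (\<lambda>z. cmod (f z)))" by (auto simp: bdd_above_def)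
  then show ?thesis unfolding sup_norm_def by (simp add: cSUP_le_iff)
qed

lemma fejer_riesz_coefficients_bounded:
  assumes "f \<in> fejer_riesz n" "\<And>z. cmod (f z) \<le> B"
  obtains a where "f = (\<lambda>z. \<Sum>j = - (int n - 1)..int n - 1. a j * Rep_circle z powi j)"
    and "\<And>j. j \<in> {- (int n - 1)..int n - 1} \<Longrightarrow> cmod (a j) \<le> B"
proof -
  obtain a where a: "\<And>z. f z = (\<Sum>j = - (int n - 1)..int n - 1. a j * Rep_circle z powi j)"
    using assms(1) unfolding fejer_riesz_def by blast
  have "cmod (a j) \<le> B" if "j \<in> {- (int n - 1)..int n - 1}" for j
  proof -
    have "fourier (\<lambda>t. f (circle_pt t)) j = a j"
      using that fourier_sum[of "{- (int n - 1)..int n - 1}" a j] by (simp add: a cis_power_int)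
    moreover have "cmod (fourier (\<lambda>t. f (circle_pt t)) j) \<le> B"
      using fejer_riesz_smooth assms
      by (intro fourier_bounded continuous_comp_circle_pt circle_smooth_continuous) auto
    ultimately show ?thesis by simp
  qed
  moreover have "f = (\<lambda>z. \<Sum>j = - (int n - 1)..int n - 1. a j * Rep_circle z powi j)"
    using a by blast
  ultimately show ?thesis by (rule that[rotated])
qed


section \<open>Quadratic forms of operators\<close>

lemma cinner_add_right: "cinner x (y + z) = cinner x y + cinner x z"
  by (metis cinner_add_left cinner_commute complex_cnj_add)

lemma cinner_scaleC_right: "cinner x (c *\<^sub>C y) = cnj c * cinner x y"
  by (metis cinner_commute cinner_scaleC_left complex_cnj_mult)

lemma cinner_diff_left: "cinner (x - y) z = cinner x z - cinner y z"
  using cinner_add_left[of "x - y" y z] by simp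

lemma cinner_self: "cinner x x = of_real ((norm x)\<^sup>2)"
proof -
  have "Im (cinner x x) = 0" using cinner_commute[of x x] by (metis Reals_cnj_iff complex_is_Real_iff)
  then show ?thesis by (simp add: complex_eq_iff Re_cinner power2_norm_eq_inner)
qed

lemma norm_scaleC: "norm (c *\<^sub>C x) = cmod c * norm x" for x :: "'a::complex_inner"
proof -
  have "complex_of_real ((norm (c *\<^sub>C x))\<^sup>2) = (c * cnj c) * of_real ((norm x)\<^sup>2)"
    unfolding cinner_self[symmetric] cinner_scaleC_left cinner_scaleC_right by (simp add: mult_ac)
  also have "\<dots> = of_real ((cmod c * norm x)\<^sup>2)"
    by (simp add: complex_norm_square[symmetric] power_mult_distrib)
  finally have "(norm (c *\<^sub>C x))\<^sup>2 = (cmod c * norm x)\<^sup>2" by (simp only: of_real_eq_iff)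
  then show ?thesis by (rule power2_eq_imp_eq) simp_all
qed

lemma cmod_cinner_le: "cmod (cinner x y) \<le> norm x * norm y"
proof -
  obtain c where c: "cmod c = 1" "of_real (cmod (cinner x y)) = c * cinner x y"
  proof (cases "cinner x y = 0")
    case True then show ?thesis using that[of 1] by simp
  next
    case False
    then show ?thesis
      using that[of "of_real (cmod (cinner x y)) / cinner x y"] by (simp add: norm_divide)
  qed
  have "cmod (cinner x y) = Re (cinner (c *\<^sub>C x) y)"
    by (metis Re_complex_of_real c(2) cinner_scaleC_left)
  also have "\<dots> \<le> norm (c *\<^sub>C x) * norm y" unfolding Re_cinner by (rule norm_cauchy_schwarz)
  finally show ?thesis by (simp add: norm_scaleC c)
qed

text \<open>Polarization: over the complex numbers an operator is determined by its quadratic form.\<close>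

lemma operator_eq_0_if_form_eq_0:
  fixes T :: "'k::complex_inner \<Rightarrow>\<^sub>L 'k"
  assumes T: "\<And>c x. blinfun_apply T (c *\<^sub>C x) = c *\<^sub>C blinfun_apply T x"
    and zero: "\<And>x. cinner (blinfun_apply T x) x = 0"
  shows "T = 0"
proof (rule blinfun_eqI)
  fix x
  define y where "y = blinfun_apply T x"
  have "cinner (T x) y + cinner (T y) x = 0"
    using zero[of "x + y"] zero[of x] zero[of y]
    by (simp add: blinfun.add_right cinner_add_left cinner_add_right algebra_simps)
  moreover have "- \<i> * cinner (T x) y + \<i> * cinner (T y) x = 0"
    using zero[of "x + \<i> *\<^sub>C y"] zero[of x] zero[of y]
    by (simp add: blinfun.add_right cinner_add_left cinner_add_right T cinner_scaleC_left
        cinner_scaleC_right algebra_simps)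
  then have "\<i> * (cinner (T y) x - cinner (T x) y) = 0" by (simp add: algebra_simps)
  then have "cinner (T y) x = cinner (T x) y" by simp
  ultimately have "cinner y y = 0" by (simp add: y_def)
  then show "T x = blinfun_apply 0 x" by (simp add: cinner_self y_def)
qed

text \<open>A quadratic form is continuous and homogeneous, so it vanishes once it vanishes on a dense subset
  of the unit ball.\<close>

lemma form_eq_0_if_eq_0_on_dense:
  fixes T :: "'k::complex_inner \<Rightarrow>\<^sub>L 'k"
  assumes T: "\<And>c x. blinfun_apply T (c *\<^sub>C x) = c *\<^sub>C blinfun_apply T x"
    and dense: "cball 0 1 \<subseteq> closure S" and zero: "\<And>x. x \<in> S \<Longrightarrow> cinner (blinfun_apply T x) x = 0"
  shows "cinner (blinfun_apply T x) x = 0"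
proof -
  have ball: "cinner (T x) x = 0" if x: "norm x \<le> 1" for x
  proof -
    have "x \<in> closure S" using dense x by auto
    then obtain y where y: "\<And>i. y i \<in> S" "y \<longlonglongrightarrow> x" unfolding closure_sequential by blast
    have "(\<lambda>i. cmod (cinner (T x) x)) \<longlonglongrightarrow> 0"
    proof (rule Lim_null_comparison)
      have "norm (cmod (cinner (T x) x)) \<le> norm (T (x - y i)) * norm x + norm (T (y i)) * norm (x - y i)" for i
      proof -
        have "cinner (T x) x = cinner (T (x - y i)) x + cinner (T (y i)) (x - y i) + cinner (T (y i)) (y i)"
          by (simp add: blinfun.diff_right cinner_diff_left cinner_add_right[symmetric] add.assoc)
        then have "cinner (T x) x = cinner (T (x - y i)) x + cinner (T (y i)) (x - y i)"
          using zero[OF y(1)] by simp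
        then show ?thesis
          using norm_triangle_ineq[of "cinner (T (x - y i)) x" "cinner (T (y i)) (x - y i)"]
            cmod_cinner_le[of "T (x - y i)" x] cmod_cinner_le[of "T (y i)" "x - y i"] by simp
      qed
      then show "\<forall>\<^sub>F i in sequentially. norm (cmod (cinner (T x) x))
          \<le> norm (T (x - y i)) * norm x + norm (T (y i)) * norm (x - y i)" by simp
      have "(\<lambda>i. norm (T (x - y i)) * norm x + norm (T (y i)) * norm (x - y i))
          \<longlonglongrightarrow> norm (T (x - x)) * norm x + norm (T x) * norm (x - x)"
        by (intro tendsto_intros y)
      then show "(\<lambda>i. norm (T (x - y i)) * norm x + norm (T (y i)) * norm (x - y i)) \<longlonglongrightarrow> 0" by simp
    qed
    then show ?thesis using LIMSEQ_unique[OF tendsto_const] by fastforce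
  qed
  show ?thesis
  proof (cases "x = 0")
    case False
    define r where "r = complex_of_real (1 / norm x)"
    have "cinner (T (r *\<^sub>C x)) (r *\<^sub>C x) = 0" using False by (intro ball) (simp add: norm_scaleC r_def norm_divide)
    then show ?thesis using False by (simp add: T cinner_scaleC_left cinner_scaleC_right r_def)
  qed (simp add: cinner_self[symmetric] cinner_self)
qed


section \<open>Unital completely positive maps\<close>

locale function_system =
  fixes E :: "(circle \<Rightarrow> complex) set"
  assumes cont: "f \<in> E \<Longrightarrow> continuous_on UNIV f"
    and one: "(\<lambda>_. 1) \<in> E"
    and add: "\<lbrakk>f \<in> E; g \<in> E\<rbrakk> \<Longrightarrow> (\<lambda>z. f z + g z) \<in> E"
    and mult: "f \<in> E \<Longrightarrow> (\<lambda>z. c * f z) \<in> E"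
    and cnj: "f \<in> E \<Longrightarrow> (\<lambda>z. cnj (f z)) \<in> E"
begin

lemma const: "(\<lambda>_. c) \<in> E"
  using mult[OF one, of c] by simp

lemma diff: "f \<in> E \<Longrightarrow> g \<in> E \<Longrightarrow> (\<lambda>z. f z - g z) \<in> E"
  using add[OF _ mult[of g "- 1"], of f] by simp

text \<open>Real functions are compared with constants. For complex \<open>f\<close>, rotate \<open>f\<close> so that \<open>s f\<close> becomes positive, hence equal to \<open>s\<close> of a real part.\<close>

lemma positive_functional_bound:
  assumes s_add: "\<And>f g. \<lbrakk>f \<in> E; g \<in> E\<rbrakk> \<Longrightarrow> s (\<lambda>z. f z + g z) = s f + s g"
    and s_mult: "\<And>f c. f \<in> E \<Longrightarrow> s (\<lambda>z. c * f z) = c * s f"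
    and s_pos: "\<And>f. \<lbrakk>f \<in> E; \<And>z. f z \<in> \<real>\<^sub>\<ge>\<^sub>0\<rbrakk> \<Longrightarrow> s f \<in> \<real>\<^sub>\<ge>\<^sub>0"
    and f: "f \<in> E" "\<And>z. cmod (f z) \<le> B"
  shows "cmod (s f) \<le> B * Re (s (\<lambda>_. 1))"
proof -
  have s1: "s (\<lambda>_. 1) \<in> \<real>\<^sub>\<ge>\<^sub>0" by (rule s_pos[OF one]) simp
  have real: "s h \<in> \<real>" "Re (s h) \<le> B * Re (s (\<lambda>_. 1))"
    if h: "h \<in> E" "\<And>z. h z \<in> \<real>" "\<And>z. cmod (h z) \<le> B" for h
  proof -
    have "Re (h z) \<le> B" "- B \<le> Re (h z)" "Im (h z) = 0" for z
      using abs_Re_le_cmod[of "h z"] h(2,3)[of z] by (auto simp: complex_is_Real_iff)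
    then have pos: "of_real B + - 1 * h z \<in> \<real>\<^sub>\<ge>\<^sub>0" for z by (simp add: complex_nonneg_Reals_iff)
    have "s (\<lambda>z. of_real B * 1 + - 1 * h z) = of_real B * s (\<lambda>_. 1) + - 1 * s h"
      unfolding s_add[OF mult[OF one] mult[OF h(1)]] s_mult[OF one] s_mult[OF h(1)] ..
    moreover have "s (\<lambda>z. of_real B * 1 + - 1 * h z) \<in> \<real>\<^sub>\<ge>\<^sub>0"
      using pos by (intro s_pos add mult one h) simp
    ultimately have "of_real B * s (\<lambda>_. 1) - s h \<in> \<real>\<^sub>\<ge>\<^sub>0" by simp
    with s1 show "s h \<in> \<real>" "Re (s h) \<le> B * Re (s (\<lambda>_. 1))"
      by (auto simp: complex_nonneg_Reals_iff complex_is_Real_iff)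
  qed
  obtain c where c: "cmod c = 1" "of_real (cmod (s f)) = c * s f"
  proof (cases "s f = 0")
    case True then show ?thesis using that[of 1] by simp
  next
    case False
    then show ?thesis using that[of "of_real (cmod (s f)) / s f"] by (simp add: norm_divide)
  qed
  define h1 h2 where "h1 z = complex_of_real (Re (c * f z))" and "h2 z = complex_of_real (Im (c * f z))" for z
  have cf: "(\<lambda>z. c * f z) \<in> E" by (rule mult[OF f(1)])
  have "h1 = (\<lambda>z. (1 / 2) * (c * f z + cnj (c * f z)))" by (simp only: h1_def fun_eq_iff complex_add_cnj) simp
  then have h1: "h1 \<in> E" using mult[OF add[OF cf cnj[OF cf]], of "1 / 2"] by simp
  have "h2 = (\<lambda>z. (- \<i> / 2) * (c * f z - cnj (c * f z)))" by (simp only: h2_def fun_eq_iff complex_diff_cnj) (simp add: algebra_simps)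
  then have h2: "h2 \<in> E" using mult[OF diff[OF cf cnj[OF cf]], of "- \<i> / 2"] by simp
  have bound: "cmod (c * f z) \<le> B" for z using f(2)[of z] c(1) by (simp add: norm_mult)
  have h1_le: "cmod (h1 z) \<le> B" and h2_le: "cmod (h2 z) \<le> B" for z
    unfolding h1_def h2_def norm_of_real
    by (rule order_trans[OF abs_Re_le_cmod bound], rule order_trans[OF abs_Im_le_cmod bound])
  have "(\<lambda>z. c * f z) = (\<lambda>z. h1 z + \<i> * h2 z)"
    unfolding h1_def h2_def by (intro ext complex_eq)
  then have "c * s f = s h1 + \<i> * s h2"
    using s_mult[OF f(1), of c] s_add[OF h1 mult[OF h2, of \<i>]] s_mult[OF h2, of \<i>] by simp
  moreover have "s h2 \<in> \<real>"
    by (rule real(1)[OF h2 _ h2_le]) (simp add: h2_def)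
  ultimately have "cmod (s f) = Re (s h1)"
    using c(2) by (metis Re_complex_of_real Re_i_times complex_is_Real_iff add.right_neutral diff_0_right minus_zero plus_complex.sel(1))
  also have "\<dots> \<le> B * Re (s (\<lambda>_. 1))"
    by (rule real(2)[OF h1 _ h1_le]) (simp add: h1_def)
  finally show ?thesis .
qed

end

definition form :: "((circle \<Rightarrow> complex) \<Rightarrow> 'k \<Rightarrow>\<^sub>L 'k::complex_inner) \<Rightarrow> (circle \<Rightarrow> complex) \<Rightarrow> 'k \<Rightarrow> complex"
  where "form \<phi> f x = cinner (blinfun_apply (\<phi> f) x) x"

lemma ucp_mapsD:
  assumes "\<phi> \<in> ucp_maps E"
  shows "\<phi> \<in> extensional E"
    and "f \<in> E \<Longrightarrow> blinfun_apply (\<phi> f) (c *\<^sub>C x) = c *\<^sub>C blinfun_apply (\<phi> f) x"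
    and "\<lbrakk>f \<in> E; g \<in> E\<rbrakk> \<Longrightarrow> form \<phi> (\<lambda>z. f z + g z) x = form \<phi> f x + form \<phi> g x"
    and "f \<in> E \<Longrightarrow> form \<phi> (\<lambda>z. c * f z) x = c * form \<phi> f x"
    and "form \<phi> (\<lambda>_. 1) x = of_real ((norm x)\<^sup>2)"
    and "completely_positive E \<phi>"
  using assms
  by (auto simp: ucp_maps_def PiE_def bounded_operators_def form_def cinner_add_left blinfun.add_left
      cinner_scaleC_left cinner_self)

lemma ucp_mapsI:
  assumes "\<phi> \<in> E \<rightarrow>\<^sub>E bounded_operators"
    and "\<And>f g. \<lbrakk>f \<in> E; g \<in> E\<rbrakk> \<Longrightarrow> \<phi> (\<lambda>z. f z + g z) = \<phi> f + \<phi> g"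
    and "\<And>f c x. f \<in> E \<Longrightarrow> blinfun_apply (\<phi> (\<lambda>z. c * f z)) x = c *\<^sub>C blinfun_apply (\<phi> f) x"
    and "\<phi> (\<lambda>_. 1) = id_blinfun"
    and "completely_positive E \<phi>"
  shows "\<phi> \<in> ucp_maps E"
  using assms by (simp add: ucp_maps_def)

context function_system
begin

lemma form_sum:
  assumes \<phi>: "\<phi> \<in> ucp_maps E" and "finite I" "\<And>i. i \<in> I \<Longrightarrow> f i \<in> E"
  shows "(\<lambda>z. \<Sum>i\<in>I. c i * f i z) \<in> E \<and> form \<phi> (\<lambda>z. \<Sum>i\<in>I. c i * f i z) x = (\<Sum>i\<in>I. c i * form \<phi> (f i) x)"
  using assms(2,3)
proof (induction rule: finite_induct)
  case empty
  show ?case using const[of 0] ucp_mapsD(4)[OF \<phi> one, of 0 x] by simp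
next
  case (insert i I)
  then have f: "(\<lambda>z. c i * f i z) \<in> E" "(\<lambda>z. \<Sum>i\<in>I. c i * f i z) \<in> E" by (auto intro: mult)
  show ?case
    using insert add[OF f] ucp_mapsD(3)[OF \<phi> f, of x] ucp_mapsD(4)[OF \<phi>, of "f i" "c i" x] by simp
qed

lemma form_diff:
  assumes "\<phi> \<in> ucp_maps E" "f \<in> E" "g \<in> E"
  shows "form \<phi> (\<lambda>z. f z - g z) x = form \<phi> f x - form \<phi> g x"
  using ucp_mapsD(3)[OF assms(1,2) mult[OF assms(3), of "- 1"], of x] ucp_mapsD(4)[OF assms(1,3), of "- 1" x]
  by simp

text \<open>The vector functional of \<open>x\<close> is positive, by complete positivity for \<open>1 \<times> 1\<close> matrices.\<close>

lemma form_bound: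
  assumes \<phi>: "\<phi> \<in> ucp_maps E" and f: "f \<in> E" "\<And>z. cmod (f z) \<le> B" and x: "norm x \<le> 1"
  shows "cmod (form \<phi> f x) \<le> B"
proof -
  have "cmod (form \<phi> f x) \<le> B * Re (form \<phi> (\<lambda>_. 1) x)"
  proof (rule positive_functional_bound[where s = "\<lambda>f. form \<phi> f x", OF _ _ _ f])
    fix g assume g: "g \<in> E" "\<And>z. g z \<in> \<real>\<^sub>\<ge>\<^sub>0"
    have "positive_fun_matrix 1 (\<lambda>_ _. g)"
    proof (subst positive_fun_matrix_iff_pointwise)
      have "g z * y * cnj y \<in> \<real>\<^sub>\<ge>\<^sub>0" for z y
      proof -
        have "y * cnj y \<in> \<real>\<^sub>\<ge>\<^sub>0" unfolding complex_norm_square[symmetric] by simp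
        then show ?thesis using nonneg_Reals_mult_I[OF g(2)[of z]] by (simp add: mult.assoc)
      qed
      then show "\<forall>z x. (\<Sum>i<1::nat. \<Sum>j<1::nat. g z * x j * cnj (x i)) \<in> \<real>\<^sub>\<ge>\<^sub>0"
        by simp
    qed (rule cont[OF g(1)])
    then have "positive_op_matrix 1 (\<lambda>_ _. \<phi> g)"
      using ucp_mapsD(6)[OF \<phi>, unfolded completely_positive_def, THEN spec[of _ 1],
          THEN spec[of _ "\<lambda>_ _. g"]] g(1) by simp
    then show "form \<phi> g x \<in> \<real>\<^sub>\<ge>\<^sub>0"
      unfolding positive_op_matrix_def form_def by (elim allE[of _ "\<lambda>_. x"]) simp
  qed (use ucp_mapsD[OF \<phi>] in auto)
  also have "\<dots> = B * (norm x)\<^sup>2" unfolding ucp_mapsD(5)[OF \<phi>] by simp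
  also have "\<dots> \<le> B * 1"
  proof (rule mult_left_mono)
    show "(norm x)\<^sup>2 \<le> 1" using x by (simp add: power_le_one)
    show "0 \<le> B" using f(2)[of undefined] norm_ge_zero[of "f undefined"] by linarith
  qed
  finally show ?thesis by simp
qed

end

lemma restrict_ucp_maps:
  assumes \<phi>: "\<phi> \<in> ucp_maps E" and sub: "E' \<subseteq> E" and E': "function_system E'"
  shows "restrict \<phi> E' \<in> ucp_maps E'"
proof -
  interpret E': function_system E' by fact
  have in_E: "f \<in> E" if "f \<in> E'" for f using that sub by blast
  show ?thesis
  proof (rule ucp_mapsI)
    show "completely_positive E' (restrict \<phi> E')"
      unfolding completely_positive_def
    proof (intro allI impI)
      fix m F assume F: "\<forall>i<m. \<forall>j<m. F i j \<in> E'" and pos: "positive_fun_matrix m F"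
      have "\<forall>i<m. \<forall>j<m. F i j \<in> E" using F sub by blast
      then have "positive_op_matrix m (\<lambda>i j. \<phi> (F i j))"
        using ucp_mapsD(6)[OF \<phi>] pos by (simp add: completely_positive_def)
      then show "positive_op_matrix m (\<lambda>i j. restrict \<phi> E' (F i j))"
        using F by (simp add: positive_op_matrix_def)
    qed
  qed (use \<phi> in_E E'.one E'.add E'.mult in \<open>auto simp: ucp_maps_def\<close>)
qed

lemma function_system_continuous: "function_system circle_continuous"
  by unfold_locales (auto simp: circle_continuous_def intro: continuous_intros)

lemma function_system_fejer_riesz: "n \<ge> 1 \<Longrightarrow> function_system (fejer_riesz n)"
proof
  assume n: "n \<ge> 1"
  show "(\<lambda>_. 1) \<in> fejer_riesz n" using fejer_riesz_monomial[of 0 n] n by simp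
qed (use fejer_riesz_smooth circle_smooth_continuous in \<open>auto intro: fejer_riesz_add fejer_riesz_mult fejer_riesz_cnj\<close>)

text \<open>The Fejer mean is unital and completely positive, so composing with it preserves both properties.\<close>

lemma fejer_mean_ucp_maps:
  assumes n: "n \<ge> 1" and \<phi>: "\<phi> \<in> ucp_maps (fejer_riesz n)"
  shows "(\<lambda>f\<in>circle_continuous. \<phi> (fejer_mean n f)) \<in> ucp_maps circle_continuous"
proof (rule ucp_mapsI)
  interpret function_system circle_continuous by (rule function_system_continuous)
  have cont: "continuous_on UNIV f" if "f \<in> circle_continuous" for f
    using that by (simp add: circle_continuous_def)
  show "completely_positive circle_continuous (\<lambda>f\<in>circle_continuous. \<phi> (fejer_mean n f))"
    unfolding completely_positive_def
  proof (intro allI impI)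
    fix m F assume F: "\<forall>i<m. \<forall>j<m. F i j \<in> circle_continuous" and pos: "positive_fun_matrix m F"
    have "positive_fun_matrix m (\<lambda>i j. fejer_mean n (F i j))"
      by (rule fejer_mean_positive_fun_matrix[OF _ pos]) (use F cont in blast)
    then have "positive_op_matrix m (\<lambda>i j. \<phi> (fejer_mean n (F i j)))"
      using ucp_mapsD(6)[OF \<phi>] fejer_mean_in_fejer_riesz by (simp add: completely_positive_def)
    then show "positive_op_matrix m (\<lambda>i j. (\<lambda>f\<in>circle_continuous. \<phi> (fejer_mean n f)) (F i j))"
      using F by (simp add: positive_op_matrix_def)
  qed
qed (use n \<phi> fejer_mean_in_fejer_riesz function_system.one[OF function_system_continuous]
    function_system.add[OF function_system_continuous] function_system.mult[OF function_system_continuous]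
    in \<open>auto simp: ucp_maps_def circle_continuous_def fejer_mean_add fejer_mean_mult fejer_mean_1\<close>)


section \<open>The metrics\<close>

definition weighted_sum :: "(nat \<Rightarrow> real) \<Rightarrow> real"
  where "weighted_sum a = (\<Sum>p. 1 / 2 ^ Suc p * a p)"

lemma weighted_sums_const: "(\<lambda>p. 1 / 2 ^ Suc p * c) sums (c :: real)"
  using sums_mult2[OF power_half_series, of c] by (simp add: power_divide)

lemma weighted_summable:
  assumes "\<And>p. 0 \<le> a p" "\<And>p. a p \<le> B"
  shows "summable (\<lambda>p. 1 / 2 ^ Suc p * a p :: real)"
  by (rule summable_comparison_test'[OF sums_summable[OF weighted_sums_const[of B]], of 0])
    (use assms in \<open>simp add: divide_right_mono\<close>)

lemma weighted_sum_mono: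
  assumes "\<And>p. 0 \<le> a p" "\<And>p. a p \<le> b p" "\<And>p. b p \<le> B"
  shows "weighted_sum a \<le> weighted_sum b"
  unfolding weighted_sum_def
  by (intro suminf_le weighted_summable[of _ B] mult_left_mono)
    (use assms in \<open>auto intro: order_trans\<close>)

lemma weighted_sum_const: "weighted_sum (\<lambda>_. c) = c"
  unfolding weighted_sum_def by (rule sums_unique[OF weighted_sums_const, symmetric])

lemma weighted_sum_nonneg:
  assumes "\<And>p. 0 \<le> a p" "\<And>p. a p \<le> B"
  shows "0 \<le> weighted_sum a"
  using weighted_sum_mono[of "\<lambda>_. 0" a B] assms weighted_sum_const[of 0] by simp

lemma weighted_sum_add:
  assumes "\<And>p. 0 \<le> a p" "\<And>p. a p \<le> B" "\<And>p. 0 \<le> b p" "\<And>p. b p \<le> B"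
  shows "weighted_sum (\<lambda>p. a p + b p) = weighted_sum a + weighted_sum b"
  unfolding weighted_sum_def distrib_left
  by (rule suminf_add[symmetric]) (rule weighted_summable[of _ B]; use assms in simp)+

lemma weighted_sum_eq_0D:
  assumes "\<And>p. 0 \<le> a p" "\<And>p. a p \<le> B" "weighted_sum a = 0"
  shows "a p = 0"
  using assms(3) suminf_eq_zero_iff[OF weighted_summable[OF assms(1,2)]] assms(1)
  unfolding weighted_sum_def by simp

text \<open>The tail beyond \<open>P\<close> contributes at most \<open>2 / 2^P\<close>.\<close>

lemma weighted_sum_less:
  assumes "\<delta> > 0"
  shows "\<exists>P. \<forall>a. (\<forall>p. 0 \<le> a p \<and> a p \<le> 2) \<longrightarrow> (\<forall>p<P. a p \<le> \<delta> / 2) \<longrightarrow> weighted_sum a < \<delta>"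
proof -
  obtain P where P: "(1 / 2) ^ P < \<delta> / 4" using real_arch_pow_inv[of "\<delta> / 4" "1 / 2"] assms by auto
  have "weighted_sum a < \<delta>" if a: "\<forall>p. 0 \<le> a p \<and> a p \<le> 2" and init: "\<forall>p<P. a p \<le> \<delta> / 2" for a
  proof -
    define tail where "tail p = (if p < P then 0 else 2 :: real)" for p
    have sums: "(\<lambda>p. 1 / 2 ^ Suc p * tail p) sums (2 * (1 / 2) ^ P)"
    proof (rule sums_iff_shift'[THEN iffD1, where n1 = P])
      have "(\<lambda>p. (1 / 2) ^ P * (1 / 2 ^ Suc p * 2)) sums ((1 / 2) ^ P * 2 :: real)"
        by (intro sums_mult weighted_sums_const)
      then show "(\<lambda>p. 1 / 2 ^ Suc (p + P) * tail (p + P)) sums (2 * (1 / 2) ^ P - (\<Sum>p<P. 1 / 2 ^ Suc p * tail p))"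
        by (simp add: tail_def power_add power_divide mult.commute)
    qed
    have "weighted_sum a \<le> weighted_sum (\<lambda>p. \<delta> / 2 + tail p)"
      using a init assms by (intro weighted_sum_mono[of _ _ "\<delta> / 2 + 2"]) (auto simp: tail_def add_increasing)
    also have "\<dots> = weighted_sum (\<lambda>_. \<delta> / 2) + weighted_sum tail"
      using assms by (intro weighted_sum_add[of _ "max 2 (\<delta> / 2)"]) (auto simp: tail_def)
    also have "\<dots> = \<delta> / 2 + 2 * (1 / 2) ^ P"
      using sums_unique[OF sums] by (simp add: weighted_sum_const weighted_sum_def)
    finally show ?thesis using P by simp
  qed
  then show ?thesis by blast
qed

definition lip_ball :: "(circle \<Rightarrow> complex) set \<Rightarrow> (circle \<Rightarrow> complex) set"
  where "lip_ball A = {f \<in> A. sup_norm f \<le> 1 \<and> lip_norm f \<le> 1}"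

definition gap :: "(nat \<Rightarrow> 'k::complex_inner) \<Rightarrow> ((circle \<Rightarrow> complex) \<Rightarrow> 'k \<Rightarrow>\<^sub>L 'k) \<Rightarrow>
    ((circle \<Rightarrow> complex) \<Rightarrow> 'k \<Rightarrow>\<^sub>L 'k) \<Rightarrow> (circle \<Rightarrow> complex) \<Rightarrow> nat \<Rightarrow> real"
  where "gap k \<phi> \<psi> f p = cmod (form \<phi> f (k (Suc p)) - form \<psi> f (k (Suc p)))"

lemma ucp_dist_eq_SUP_gap: "ucp_dist k A \<phi> \<psi> = (SUP f\<in>lip_ball A. weighted_sum (gap k \<phi> \<psi> f))"
  by (simp add: ucp_dist_def lip_ball_def weighted_sum_def gap_def form_def blinfun.diff_left cinner_diff_left)

text \<open>What makes \<^const>\<open>ucp_dist\<close> a metric on the unital completely positive maps of \<open>E\<close>: \<open>A\<close> is the domain of the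
  Lipschitz seminorm.\<close>

locale lipschitz_system = function_system E for E +
  fixes A :: "(circle \<Rightarrow> complex) set" and k :: "nat \<Rightarrow> 'k::complex_inner"
  assumes A_subset: "A \<subseteq> E" and A_smooth: "A \<subseteq> circle_smooth"
    and A_one: "(\<lambda>_. 1) \<in> A" and A_mult: "f \<in> A \<Longrightarrow> (\<lambda>z. c * f z) \<in> A"
    and A_dense: "\<lbrakk>f \<in> E; \<epsilon> > 0\<rbrakk> \<Longrightarrow> \<exists>g\<in>A. \<forall>z. cmod (f z - g z) \<le> \<epsilon>"
    and k_norm: "norm (k (Suc p)) \<le> 1"
    and k_dense: "cball 0 1 \<subseteq> closure (k ` {1..})"
begin

lemma lip_ballD:
  assumes "f \<in> lip_ball A"
  shows "f \<in> E" "cmod (f z) \<le> 1"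
  using assms A_subset sup_norm_le_iff[of f 1] cont[of f] by (auto simp: lip_ball_def)

lemma ex_scaled_in_lip_ball:
  assumes f: "f \<in> A"
  shows "\<exists>c>0. (\<lambda>z. of_real c * f z) \<in> lip_ball A"
proof -
  obtain g where g: "circle_derivative f g" using circle_smooth_derivative A_smooth f by blast
  have f_cont: "continuous_on UNIV f" using f A_smooth circle_smooth_continuous by blast
  obtain B where B: "\<And>z. cmod (f z) \<le> B" using circle_bounded[OF f_cont] by blast
  have "continuous_on {0..2 * pi} g"
    using g by (auto simp: circle_derivative_def intro: continuous_on_subset)
  then obtain B' where B': "\<And>t. t \<in> {0..2 * pi} \<Longrightarrow> cmod (g t) \<le> B'"
    using continuous_bounded_on_interval by blast
  have g_le: "cmod (g t) \<le> B'" for t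
  proof -
    have "g t = g (angle (circle_pt t))" by (rule circle_derivative_periodic[OF g]) simp
    then show ?thesis using B'[of "angle (circle_pt t)"] angle_range[of "circle_pt t"] by simp
  qed
  define c where "c = 1 / (1 + B + B')"
  have "0 \<le> B" "0 \<le> B'"
    using B[of undefined] g_le[of 0] norm_ge_zero[of "f undefined"] norm_ge_zero[of "g 0"] by linarith+
  then have c: "c > 0" "c * B \<le> 1" "c * B' \<le> 1" by (auto simp: c_def field_simps)
  have "cmod (of_real c * f z) \<le> 1" for z
    using order_trans[OF mult_left_mono[OF B less_imp_le] c(2)] c(1) by (simp add: norm_mult)
  then have "sup_norm (\<lambda>z. of_real c * f z) \<le> 1"
    by (subst sup_norm_le_iff) (auto intro!: continuous_intros f_cont)
  moreover have "lip_norm (\<lambda>z. of_real c * f z) \<le> 1"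
  proof (rule lip_norm_le_1_if_derivative_le_1)
    show "circle_derivative (\<lambda>z. of_real c * f z) (\<lambda>t. of_real c * g t)"
      using g by (auto simp: circle_derivative_def intro!: continuous_intros has_vector_derivative_mult_right)
    show "cmod (of_real c * g t) \<le> 1" for t
      using order_trans[OF mult_left_mono[OF g_le less_imp_le] c(3)] c(1) by (simp add: norm_mult)
  qed
  ultimately show ?thesis using c(1) A_mult[OF f] by (auto simp: lip_ball_def)
qed

lemma lip_ball_nonempty: "lip_ball A \<noteq> {}"
  using ex_scaled_in_lip_ball[OF A_one] by blast

lemma gap_nonneg: "0 \<le> gap k \<phi> \<psi> f p"
  by (simp add: gap_def)

lemma gap_le:
  assumes "\<phi> \<in> ucp_maps E" "\<psi> \<in> ucp_maps E" "f \<in> E" "\<And>z. cmod (f z) \<le> B"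
  shows "gap k \<phi> \<psi> f p \<le> 2 * B"
  using form_bound[OF assms(1,3,4) k_norm, of p] form_bound[OF assms(2,3,4) k_norm, of p]
    norm_triangle_ineq4[of "form \<phi> f (k (Suc p))" "form \<psi> f (k (Suc p))"]
  unfolding gap_def by linarith

lemma gap_le_2:
  assumes "\<phi> \<in> ucp_maps E" "\<psi> \<in> ucp_maps E" "f \<in> lip_ball A"
  shows "gap k \<phi> \<psi> f p \<le> 2"
  using gap_le[OF assms(1,2) lip_ballD[OF assms(3)]] by simp

lemma weighted_gap_le_2:
  assumes "\<phi> \<in> ucp_maps E" "\<psi> \<in> ucp_maps E" "f \<in> lip_ball A"
  shows "weighted_sum (gap k \<phi> \<psi> f) \<le> 2"
  using weighted_sum_mono[of "gap k \<phi> \<psi> f" "\<lambda>_. 2" 2] gap_le_2[OF assms] gap_nonneg weighted_sum_const[of 2]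
  by simp

lemma weighted_gap_le_dist:
  assumes "\<phi> \<in> ucp_maps E" "\<psi> \<in> ucp_maps E" "f \<in> lip_ball A"
  shows "weighted_sum (gap k \<phi> \<psi> f) \<le> ucp_dist k A \<phi> \<psi>"
  unfolding ucp_dist_eq_SUP_gap
  using weighted_gap_le_2[OF assms(1,2)] by (intro cSUP_upper assms) (auto simp: bdd_above_def)

lemma dist_le:
  assumes "\<And>f. f \<in> lip_ball A \<Longrightarrow> weighted_sum (gap k \<phi> \<psi> f) \<le> c"
  shows "ucp_dist k A \<phi> \<psi> \<le> c"
  unfolding ucp_dist_eq_SUP_gap using assms lip_ball_nonempty by (intro cSUP_least)

text \<open>Vanishing distance means equal quadratic forms at the vectors \<open>k\<^sub>p\<close> on the Lipschitz ball, by scaling on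
  \<open>A\<close>, and by density and contractivity on \<open>E\<close>. Density of the \<open>k\<^sub>p\<close> and polarization give the operators.\<close>

lemma ucp_dist_eq_0D:
  assumes \<phi>: "\<phi> \<in> ucp_maps E" and \<psi>: "\<psi> \<in> ucp_maps E" and zero: "ucp_dist k A \<phi> \<psi> = 0"
  shows "\<phi> = \<psi>"
proof (rule extensionalityI)
  fix f assume f: "f \<in> E"
  have k_eq: "form \<phi> g (k (Suc p)) = form \<psi> g (k (Suc p))" if g: "g \<in> A" for g p
  proof -
    obtain c where c: "c > 0" and cg: "(\<lambda>z. of_real c * g z) \<in> lip_ball A"
      using ex_scaled_in_lip_ball[OF g] by blast
    have "weighted_sum (gap k \<phi> \<psi> (\<lambda>z. of_real c * g z)) \<le> 0"
      using weighted_gap_le_dist[OF \<phi> \<psi> cg] zero by simp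
    moreover have "0 \<le> weighted_sum (gap k \<phi> \<psi> (\<lambda>z. of_real c * g z))"
      by (rule weighted_sum_nonneg[OF gap_nonneg gap_le_2[OF \<phi> \<psi> cg]])
    ultimately have "gap k \<phi> \<psi> (\<lambda>z. of_real c * g z) p = 0"
      by (intro weighted_sum_eq_0D[OF gap_nonneg gap_le_2[OF \<phi> \<psi> cg]] antisym)
    then show ?thesis
      using c g A_subset ucp_mapsD(4)[OF \<phi>, of g] ucp_mapsD(4)[OF \<psi>, of g] by (auto simp: gap_def)
  qed
  have f_eq: "form \<phi> f (k (Suc p)) = form \<psi> f (k (Suc p))" for p
  proof -
    have "cmod (form \<phi> f (k (Suc p)) - form \<psi> f (k (Suc p))) \<le> \<epsilon>" if "\<epsilon> > 0" for \<epsilon>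
    proof -
      obtain g where g: "g \<in> A" and near: "\<And>z. cmod (f z - g z) \<le> \<epsilon> / 2"
        using A_dense[OF f half_gt_zero[OF \<open>\<epsilon> > 0\<close>]] by blast
      have gE: "g \<in> E" using g A_subset by blast
      show ?thesis
        using gap_le[OF \<phi> \<psi> diff[OF f gE] near, of p] k_eq[OF g]
        by (simp add: gap_def form_diff[OF \<phi> f gE] form_diff[OF \<psi> f gE])
    qed
    then have "cmod (form \<phi> f (k (Suc p)) - form \<psi> f (k (Suc p))) \<le> 0"
      by (rule field_le_epsilon) simp
    then show ?thesis by simp
  qed
  have zero_k: "cinner (blinfun_apply (\<phi> f - \<psi> f) x) x = 0" if x: "x \<in> k ` {1..}" for x
  proof -
    obtain q where "q \<ge> 1" "x = k q" using x by auto
    then show ?thesis using f_eq[of "q - 1"] by (simp add: form_def blinfun.diff_left cinner_diff_left)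
  qed
  have lin: "blinfun_apply (\<phi> f - \<psi> f) (c *\<^sub>C x) = c *\<^sub>C blinfun_apply (\<phi> f - \<psi> f) x" for c x
  proof -
    have "c *\<^sub>C (\<phi> f x - \<psi> f x) + c *\<^sub>C \<psi> f x = c *\<^sub>C \<phi> f x"
      by (simp add: scaleC_add_right[symmetric])
    then show ?thesis
      by (simp add: blinfun.diff_left ucp_mapsD(2)[OF \<phi> f] ucp_mapsD(2)[OF \<psi> f] algebra_simps)
  qed
  have "\<phi> f - \<psi> f = 0"
    by (rule operator_eq_0_if_form_eq_0[OF lin form_eq_0_if_eq_0_on_dense[OF lin k_dense zero_k]])
  then show "\<phi> f = \<psi> f" by simp
qed (use \<phi> \<psi> ucp_mapsD(1) in auto)

lemma Metric_space_ucp_maps: "Metric_space (ucp_maps E) (dist_on (ucp_maps E) (ucp_dist k A))"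
proof (rule Metric_space_dist_on)
  fix \<phi> \<psi> :: "(circle \<Rightarrow> complex) \<Rightarrow> 'k \<Rightarrow>\<^sub>L 'k"
  assume \<phi>: "\<phi> \<in> ucp_maps E" and \<psi>: "\<psi> \<in> ucp_maps E"
  obtain f where f: "f \<in> lip_ball A" using lip_ball_nonempty by blast
  have "0 \<le> weighted_sum (gap k \<phi> \<psi> f)"
    by (rule weighted_sum_nonneg[OF gap_nonneg gap_le_2[OF \<phi> \<psi> f]])
  then show nonneg: "0 \<le> ucp_dist k A \<phi> \<psi>" using weighted_gap_le_dist[OF \<phi> \<psi> f] by linarith
  show "ucp_dist k A \<phi> \<psi> = ucp_dist k A \<psi> \<phi>"
    unfolding ucp_dist_eq_SUP_gap gap_def[abs_def] by (simp add: norm_minus_commute)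
  have "ucp_dist k A \<phi> \<phi> \<le> 0"
    by (rule dist_le) (simp add: gap_def[abs_def] weighted_sum_const)
  then show "ucp_dist k A \<phi> \<psi> = 0 \<longleftrightarrow> \<phi> = \<psi>"
    using ucp_dist_eq_0D[OF \<phi> \<psi>] nonneg by (auto intro: antisym)
  fix \<tau> :: "(circle \<Rightarrow> complex) \<Rightarrow> 'k \<Rightarrow>\<^sub>L 'k" assume \<tau>: "\<tau> \<in> ucp_maps E"
  show "ucp_dist k A \<phi> \<tau> \<le> ucp_dist k A \<phi> \<psi> + ucp_dist k A \<psi> \<tau>"
  proof (rule dist_le)
    fix f assume f: "f \<in> lip_ball A"
    have "weighted_sum (gap k \<phi> \<tau> f) \<le> weighted_sum (\<lambda>p. gap k \<phi> \<psi> f p + gap k \<psi> \<tau> f p)"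
    proof (rule weighted_sum_mono[of _ _ 4])
      show "gap k \<phi> \<tau> f p \<le> gap k \<phi> \<psi> f p + gap k \<psi> \<tau> f p" for p
        using norm_triangle_ineq[of "form \<phi> f (k (Suc p)) - form \<psi> f (k (Suc p))"
            "form \<psi> f (k (Suc p)) - form \<tau> f (k (Suc p))"] by (simp add: gap_def)
      show "gap k \<phi> \<psi> f p + gap k \<psi> \<tau> f p \<le> 4" for p
        using gap_le_2[OF \<phi> \<psi> f, of p] gap_le_2[OF \<psi> \<tau> f, of p] by linarith
    qed (rule gap_nonneg)
    also have "\<dots> = weighted_sum (gap k \<phi> \<psi> f) + weighted_sum (gap k \<psi> \<tau> f)"
      by (rule weighted_sum_add[OF gap_nonneg gap_le_2[OF \<phi> \<psi> f] gap_nonneg gap_le_2[OF \<psi> \<tau> f]])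
    also have "\<dots> \<le> ucp_dist k A \<phi> \<psi> + ucp_dist k A \<psi> \<tau>"
      by (intro add_mono weighted_gap_le_dist \<phi> \<psi> \<tau> f)
    finally show "weighted_sum (gap k \<phi> \<tau> f) \<le> ucp_dist k A \<phi> \<psi> + ucp_dist k A \<psi> \<tau>" .
  qed
qed

end


text \<open>Up to a small error, a map on trigonometric polynomials is given by the finitely many numbers
  \<open>\<langle>\<phi>(z^j) k_p, k_p\<rangle>\<close> in the unit disc; rounding them to a grid gives finite fibres.\<close>

lemma totally_bounded_ucp_maps_fejer_riesz:
  fixes k :: "nat \<Rightarrow> 'k::complex_inner"
  assumes n: "n \<ge> 1" and lip: "lipschitz_system (fejer_riesz n) (fejer_riesz n) k"
  shows "Metric_space.mtotally_bounded (ucp_maps (fejer_riesz n))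
    (dist_on (ucp_maps (fejer_riesz n)) (ucp_dist k (fejer_riesz n))) (ucp_maps (fejer_riesz n))"
proof -
  interpret lipschitz_system "fejer_riesz n" "fejer_riesz n" k by fact
  let ?E = "fejer_riesz n"
  interpret M: Metric_space "ucp_maps ?E :: ((circle \<Rightarrow> complex) \<Rightarrow> 'k \<Rightarrow>\<^sub>L 'k) set"
    "dist_on (ucp_maps ?E) (ucp_dist k ?E)" by (rule Metric_space_ucp_maps)
  define J where "J = {- (int n - 1)..int n - 1}"
  define e where "e j z = Rep_circle z powi j" for j :: int and z
  have e: "e j \<in> ?E" if "j \<in> J" for j
    using that fejer_riesz_monomial[of j n] by (auto simp: J_def e_def[abs_def])
  have e_le: "cmod (e j z) \<le> 1" for j z by (simp add: e_def norm_power_int)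
  show ?thesis
  proof (rule M.mtotally_bounded_if_finite_fibres)
    fix \<delta> :: real assume \<delta>: "\<delta> > 0"
    obtain P where P: "\<And>a. (\<forall>p. 0 \<le> a p \<and> a p \<le> 2) \<Longrightarrow> (\<forall>p<P. a p \<le> \<delta> / 2 / 2) \<Longrightarrow> weighted_sum a < \<delta> / 2"
      using weighted_sum_less[OF half_gt_zero[OF \<delta>]] by blast
    \<comment> \<open>Each of the fewer than \<open>2 n\<close> coefficients contributes at most \<open>2 c\<close>, in total at most \<open>\<delta> / 4\<close>.\<close>
    define c where "c = \<delta> / (16 * n)"
    have c: "c > 0" using \<delta> n by (simp add: c_def)
    define v where "v \<phi> jp = form \<phi> (e (fst jp)) (k (Suc (snd jp)))"
      for \<phi> :: "(circle \<Rightarrow> complex) \<Rightarrow> 'k \<Rightarrow>\<^sub>L 'k" and jp :: "int \<times> nat"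
    define h where "h \<phi> = (\<lambda>jp\<in>J \<times> {..<P}. (\<lfloor>Re (v \<phi> jp) / c\<rfloor>, \<lfloor>Im (v \<phi> jp) / c\<rfloor>))"
      for \<phi> :: "(circle \<Rightarrow> complex) \<Rightarrow> 'k \<Rightarrow>\<^sub>L 'k"
    define R where "R = {\<lfloor>- 1 / c\<rfloor>..\<lfloor>1 / c\<rfloor>}"
    have floor: "\<lfloor>x / c\<rfloor> \<in> R" if "\<bar>x\<bar> \<le> 1" for x
    proof -
      have "- 1 / c \<le> x / c" "x / c \<le> 1 / c" using that c by (intro divide_right_mono; simp)+
      then show ?thesis unfolding R_def atLeastAtMost_iff by (intro conjI floor_mono)
    qed
    have "h ` ucp_maps ?E \<subseteq> (J \<times> {..<P}) \<rightarrow>\<^sub>E R \<times> R"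
    proof (rule image_subsetI)
      fix \<phi> :: "(circle \<Rightarrow> complex) \<Rightarrow> 'k \<Rightarrow>\<^sub>L 'k" assume \<phi>: "\<phi> \<in> ucp_maps ?E"
      have "cmod (v \<phi> jp) \<le> 1" if "jp \<in> J \<times> {..<P}" for jp
        unfolding v_def using that by (intro form_bound[OF \<phi> e e_le k_norm]) auto
      then have "\<bar>Re (v \<phi> jp)\<bar> \<le> 1" "\<bar>Im (v \<phi> jp)\<bar> \<le> 1" if "jp \<in> J \<times> {..<P}" for jp
        using that abs_Re_le_cmod[of "v \<phi> jp"] abs_Im_le_cmod[of "v \<phi> jp"] by (meson order_trans)+
      then show "h \<phi> \<in> (J \<times> {..<P}) \<rightarrow>\<^sub>E R \<times> R" using floor by (auto simp: h_def)
    qed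
    moreover have "finite ((J \<times> {..<P}) \<rightarrow>\<^sub>E R \<times> R)"
      by (intro finite_PiE) (auto simp: J_def R_def)
    ultimately have fin: "finite (h ` ucp_maps ?E)" by (rule finite_subset)
    have "ucp_dist k ?E \<phi> \<psi> \<le> \<delta> / 2"
      if \<phi>: "\<phi> \<in> ucp_maps ?E" and \<psi>: "\<psi> \<in> ucp_maps ?E" and eq: "h \<phi> = h \<psi>" for \<phi> \<psi>
    proof (rule dist_le)
      fix f assume f: "f \<in> lip_ball ?E"
      obtain a where a: "f = (\<lambda>z. \<Sum>j\<in>J. a j * e j z)" "\<And>j. j \<in> J \<Longrightarrow> cmod (a j) \<le> 1"
        using fejer_riesz_coefficients_bounded[OF lip_ballD[OF f]] unfolding J_def e_def by metis
      have v_close: "cmod (v \<phi> jp - v \<psi> jp) \<le> 2 * c" if jp: "jp \<in> J \<times> {..<P}" for jp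
      proof -
        have close: "\<bar>x - y\<bar> \<le> c" if "\<lfloor>x / c\<rfloor> = \<lfloor>y / c\<rfloor>" for x y
        proof -
          have "\<bar>x / c - y / c\<bar> < 1" using that by linarith
          then have "\<bar>(x - y) / c\<bar> < 1" by (simp add: diff_divide_distrib)
          then show ?thesis using c by (simp add: abs_divide)
        qed
        have "h \<phi> jp = h \<psi> jp" using eq by simp
        then have "\<bar>Re (v \<phi> jp - v \<psi> jp)\<bar> \<le> c" "\<bar>Im (v \<phi> jp - v \<psi> jp)\<bar> \<le> c"
          using jp close by (auto simp: h_def)
        then show ?thesis using cmod_le[of "v \<phi> jp - v \<psi> jp"] by linarith
      qed
      have "gap k \<phi> \<psi> f p \<le> \<delta> / 2 / 2" if p: "p < P" for p
      proof -
        have "form \<theta> f (k (Suc p)) = (\<Sum>j\<in>J. a j * v \<theta> (j, p))"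
          if "\<theta> \<in> ucp_maps ?E" for \<theta>
          unfolding a(1) v_def using form_sum[where I = J and f = e, OF that _ e] by (simp add: J_def)
        then have "gap k \<phi> \<psi> f p = cmod (\<Sum>j\<in>J. a j * (v \<phi> (j, p) - v \<psi> (j, p)))"
          using \<phi> \<psi> by (simp add: gap_def sum_subtractf right_diff_distrib)
        also have "\<dots> \<le> (\<Sum>j\<in>J. 2 * c)"
        proof (rule sum_norm_le)
          fix j assume j: "j \<in> J"
          have "cmod (a j) * cmod (v \<phi> (j, p) - v \<psi> (j, p)) \<le> 1 * (2 * c)"
            using j p by (intro mult_mono a(2) v_close) auto
          then show "cmod (a j * (v \<phi> (j, p) - v \<psi> (j, p))) \<le> 2 * c" by (simp add: norm_mult)
        qed
        also have "\<dots> = real (2 * n - 1) * (2 * c)" using n by (simp add: J_def nat_diff_distrib)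
        also have "\<dots> \<le> (2 * real n) * (2 * c)" using c n by (intro mult_right_mono) auto
        also have "\<dots> = \<delta> / 2 / 2" using n by (simp add: c_def)
        finally show ?thesis .
      qed
      then have "weighted_sum (gap k \<phi> \<psi> f) < \<delta> / 2"
        using gap_nonneg gap_le_2[OF \<phi> \<psi> f] by (intro P) blast+
      then show "weighted_sum (gap k \<phi> \<psi> f) \<le> \<delta> / 2" by simp
    qed
    then have "\<forall>\<phi>\<in>ucp_maps ?E. \<forall>\<psi>\<in>ucp_maps ?E. h \<phi> = h \<psi> \<longrightarrow>
        dist_on (ucp_maps ?E) (ucp_dist k ?E) \<phi> \<psi> < \<delta>"
      using \<delta> by (force simp: dist_on_def)
    with fin show "\<exists>h :: _ \<Rightarrow> int \<times> nat \<Rightarrow> int \<times> int. finite (h ` ucp_maps ?E) \<and>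
        (\<forall>\<phi>\<in>ucp_maps ?E. \<forall>\<psi>\<in>ucp_maps ?E. h \<phi> = h \<psi> \<longrightarrow>
          dist_on (ucp_maps ?E) (ucp_dist k ?E) \<phi> \<psi> < \<delta>)" by blast
  qed
qed


section \<open>Convergence\<close>

theorem corollary4p1:
  fixes k :: "nat \<Rightarrow> 'k::{complex_inner, polish_space}"
  assumes "k ` {1..} \<subseteq> cball 0 1"
    and "cball 0 1 \<subseteq> closure (k ` {1..})"
  shows "(\<lambda>n. gromov_hausdorff_distance
            (ucp_maps (fejer_riesz n)) (ucp_dist k (fejer_riesz n))
            (ucp_maps circle_continuous) (ucp_dist k circle_smooth)) \<longlonglongrightarrow> 0"
proof -
  let ?C = circle_continuous and ?S = circle_smooth and ?F = fejer_riesz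
  let ?X = "ucp_maps ?C :: ((circle \<Rightarrow> complex) \<Rightarrow> 'k \<Rightarrow>\<^sub>L 'k) set"
  let ?Y = "\<lambda>n. ucp_maps (?F n) :: ((circle \<Rightarrow> complex) \<Rightarrow> 'k \<Rightarrow>\<^sub>L 'k) set"
  let ?dX = "ucp_dist k ?S" and ?dY = "\<lambda>n. ucp_dist k (?F n)"
  define \<gamma> where "\<gamma> n = 9 / sqrt n" for n :: nat
  have k_norm: "norm (k (Suc p)) \<le> 1" for p using assms(1) by (auto simp: image_subset_iff)
  have sub: "?F n \<subseteq> ?C" for n
    using fejer_riesz_smooth circle_smooth_continuous by (auto simp: circle_continuous_def)
  have one_F: "(\<lambda>_. 1) \<in> ?F n" if "n \<ge> 1" for n
    by (rule function_system.one[OF function_system_fejer_riesz[OF that]])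
  have lip_F: "lipschitz_system (?F n) (?F n) k" if "n \<ge> 1" for n
  proof (intro lipschitz_system.intro lipschitz_system_axioms.intro function_system_fejer_riesz that
      subset_refl fejer_riesz_smooth fejer_riesz_mult one_F k_norm assms)
    show "\<exists>g\<in>?F n. \<forall>z. cmod (f z - g z) \<le> \<epsilon>" if "f \<in> ?F n" "\<epsilon> > 0" for f \<epsilon>
      using that by (intro bexI[of _ f]) auto
  qed
  have "lipschitz_system ?C ?S k"
  proof (intro lipschitz_system.intro lipschitz_system_axioms.intro function_system_continuous
      subset_refl k_norm assms)
    show "?S \<subseteq> ?C" using circle_smooth_continuous by (auto simp: circle_continuous_def)
    show "(\<lambda>_. 1) \<in> ?S" using one_F[of 1] fejer_riesz_smooth by blast
    show "(\<lambda>z. c * f z) \<in> ?S" if "f \<in> ?S" for f c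
    proof -
      obtain F where F: "\<And>\<theta>. F 0 \<theta> = f (circle_pt \<theta>)"
          "\<And>m \<theta>. (F m has_vector_derivative F (Suc m) \<theta>) (at \<theta>)"
        using \<open>f \<in> ?S\<close> unfolding circle_smooth_def by blast
      then show ?thesis unfolding circle_smooth_def
        by (auto intro!: exI[of _ "\<lambda>m \<theta>. c * F m \<theta>"] has_vector_derivative_mult_right)
    qed
    show "\<exists>g\<in>?S. \<forall>z. cmod (f z - g z) \<le> \<epsilon>" if "f \<in> ?C" "\<epsilon> > 0" for f \<epsilon>
    proof -
      obtain n where "\<forall>z. cmod (f z - fejer_mean n f z) \<le> \<epsilon>"
        using fejer_mean_converges[of f \<epsilon>] \<open>f \<in> ?C\<close> \<open>\<epsilon> > 0\<close> by (auto simp: circle_continuous_def)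
      then show ?thesis using fejer_mean_in_fejer_riesz fejer_riesz_smooth by blast
    qed
  qed
  then interpret C: lipschitz_system ?C ?S k .
  have mean: "fejer_mean n f \<in> lip_ball (?F n)" "cmod (f z - fejer_mean n f z) \<le> \<gamma> n"
    if n: "n \<ge> 1" and f: "f \<in> lip_ball ?S" for n f z
  proof -
    obtain g where g: "circle_derivative f g" using circle_smooth_derivative f by (auto simp: lip_ball_def)
    have g_le: "cmod (g t) \<le> 1" for t
      using derivative_le_1_if_lip_norm_le_1[OF g] f by (simp add: lip_ball_def)
    have f_cont: "continuous_on UNIV f" using C.lip_ballD(1)[OF f] by (rule C.cont)
    show "cmod (f z - fejer_mean n f z) \<le> \<gamma> n"
      unfolding \<gamma>_def by (rule fejer_mean_approximates_lipschitz[OF n g g_le])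
    have "cmod (fejer_sum n g t) \<le> 1" for t
      by (rule fejer_sum_bounded[OF n]) (use g g_le in \<open>auto simp: circle_derivative_def intro: continuous_on_subset\<close>)
    then have "lip_norm (fejer_mean n f) \<le> 1"
      by (rule lip_norm_le_1_if_derivative_le_1[OF fejer_mean_derivative[OF g]])
    moreover have "sup_norm (fejer_mean n f) \<le> 1"
      using sup_norm_le_iff[OF continuous_fejer_mean] fejer_mean_bounded[OF n f_cont C.lip_ballD(2)[OF f]] by blast
    ultimately show "fejer_mean n f \<in> lip_ball (?F n)"
      by (simp add: lip_ball_def fejer_mean_in_fejer_riesz)
  qed
  have ball: "lip_ball (?F n) \<subseteq> lip_ball ?S" for n
    using fejer_riesz_smooth by (auto simp: lip_ball_def)
  have restr: "restrict \<phi> (?F n) \<in> ?Y n" if "n \<ge> 1" "\<phi> \<in> ?X" for n \<phi>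
    by (rule restrict_ucp_maps[OF that(2) sub function_system_fejer_riesz[OF that(1)]])
  have gap_restr: "gap k (restrict \<phi> (?F n)) (restrict \<psi> (?F n)) f = gap k \<phi> \<psi> f" if "f \<in> ?F n" for \<phi> \<psi> f n
    using that by (simp add: gap_def[abs_def] form_def)
  \<comment> \<open>The Lipschitz ball of trigonometric polynomials is part of the smooth one, so its supremum is smaller.\<close>
  have decrease: "?dY n (restrict \<phi> (?F n)) (restrict \<psi> (?F n)) \<le> ?dX \<phi> \<psi>"
    if n: "n \<ge> 1" and \<phi>: "\<phi> \<in> ?X" and \<psi>: "\<psi> \<in> ?X" for n \<phi> \<psi>
  proof -
    interpret F: lipschitz_system "?F n" "?F n" k by (rule lip_F[OF n])
    show ?thesis
    proof (rule F.dist_le)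
      fix f assume f: "f \<in> lip_ball (?F n)"
      then show "weighted_sum (gap k (restrict \<phi> (?F n)) (restrict \<psi> (?F n)) f) \<le> ?dX \<phi> \<psi>"
        using C.weighted_gap_le_dist[OF \<phi> \<psi>] ball gap_restr[OF F.lip_ballD(1)[OF f]] by auto
    qed
  qed
  \<comment> \<open>Replacing \<open>f\<close> by its Fejer mean costs \<open>\<gamma> n\<close> for each of the two maps.\<close>
  have increase: "?dX \<phi> \<psi> \<le> ?dY n (restrict \<phi> (?F n)) (restrict \<psi> (?F n)) + 2 * \<gamma> n"
    if n: "n \<ge> 1" and \<phi>: "\<phi> \<in> ?X" and \<psi>: "\<psi> \<in> ?X" for n \<phi> \<psi>
  proof (rule C.dist_le)
    interpret F: lipschitz_system "?F n" "?F n" k by (rule lip_F[OF n])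
    fix f assume f: "f \<in> lip_ball ?S"
    define g where "g = fejer_mean n f"
    have g: "g \<in> lip_ball (?F n)" "\<And>z. cmod (f z - g z) \<le> \<gamma> n" using mean[OF n f] by (simp_all add: g_def)
    have fC: "f \<in> ?C" and gC: "g \<in> ?C" using f g ball C.lip_ballD(1) by blast+
    have "weighted_sum (gap k \<phi> \<psi> f) \<le> weighted_sum (\<lambda>p. gap k \<phi> \<psi> g p + 2 * \<gamma> n)"
    proof (rule weighted_sum_mono)
      show "gap k \<phi> \<psi> f p \<le> gap k \<phi> \<psi> g p + 2 * \<gamma> n" for p
      proof -
        have "gap k \<phi> \<psi> f p \<le> gap k \<phi> \<psi> g p + gap k \<phi> \<psi> (\<lambda>z. f z - g z) p"
          unfolding gap_def C.form_diff[OF \<phi> fC gC] C.form_diff[OF \<psi> fC gC]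
          using norm_triangle_ineq[of "form \<phi> g (k (Suc p)) - form \<psi> g (k (Suc p))"
              "form \<phi> f (k (Suc p)) - form \<phi> g (k (Suc p)) - (form \<psi> f (k (Suc p)) - form \<psi> g (k (Suc p)))"]
          by (simp add: algebra_simps)
        then show ?thesis using C.gap_le[OF \<phi> \<psi> C.diff[OF fC gC] g(2), of p] by linarith
      qed
      show "gap k \<phi> \<psi> g p + 2 * \<gamma> n \<le> 2 + 2 * \<gamma> n" for p
        using C.gap_le_2[OF \<phi> \<psi>, of g p] g(1) ball by auto
    qed (rule C.gap_nonneg)
    also have "\<dots> = weighted_sum (gap k \<phi> \<psi> g) + weighted_sum (\<lambda>_. 2 * \<gamma> n)"
    proof (rule weighted_sum_add[of _ "max 2 (2 * \<gamma> n)"])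
      show "gap k \<phi> \<psi> g p \<le> max 2 (2 * \<gamma> n)" for p
        using C.gap_le_2[OF \<phi> \<psi>, of g p] g(1) ball by (auto simp: le_max_iff_disj)
    qed (auto simp: C.gap_nonneg \<gamma>_def)
    also have "\<dots> = weighted_sum (gap k (restrict \<phi> (?F n)) (restrict \<psi> (?F n)) g) + 2 * \<gamma> n"
      by (simp add: weighted_sum_const gap_restr[OF F.lip_ballD(1)[OF g(1)]])
    also have "\<dots> \<le> ?dY n (restrict \<phi> (?F n)) (restrict \<psi> (?F n)) + 2 * \<gamma> n"
      by (intro add_right_mono F.weighted_gap_le_dist restr n \<phi> \<psi> g)
    finally show "weighted_sum (gap k \<phi> \<psi> f) \<le> ?dY n (restrict \<phi> (?F n)) (restrict \<psi> (?F n)) + 2 * \<gamma> n" .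
  qed
  \<comment> \<open>\<open>\<psi>\<close> is close to the restriction of its composition with the Fejer mean.\<close>
  have dense: "\<exists>\<phi>\<in>?X. ?dY n (restrict \<phi> (?F n)) \<psi> \<le> \<gamma> n" if n: "n \<ge> 1" and \<psi>: "\<psi> \<in> ?Y n" for n \<psi>
  proof (rule bexI)
    interpret F: lipschitz_system "?F n" "?F n" k by (rule lip_F[OF n])
    let ?\<phi> = "\<lambda>f\<in>?C. \<psi> (fejer_mean n f)"
    show \<phi>: "?\<phi> \<in> ?X" by (rule fejer_mean_ucp_maps[OF n \<psi>])
    show "?dY n (restrict ?\<phi> (?F n)) \<psi> \<le> \<gamma> n"
    proof (rule F.dist_le)
      fix f assume f: "f \<in> lip_ball (?F n)"
      have fF: "f \<in> ?F n" by (rule F.lip_ballD(1)[OF f])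
      have fS: "f \<in> lip_ball ?S" using f ball by blast
      have "gap k (restrict ?\<phi> (?F n)) \<psi> f p \<le> \<gamma> n" for p
      proof -
        have "gap k (restrict ?\<phi> (?F n)) \<psi> f p = cmod (form \<psi> (\<lambda>z. f z - fejer_mean n f z) (k (Suc p)))"
          using fF sub F.form_diff[OF \<psi> fF fejer_mean_in_fejer_riesz, of f "k (Suc p)"]
          by (auto simp: gap_def form_def norm_minus_commute)
        also have "\<dots> \<le> \<gamma> n"
          by (rule F.form_bound[OF \<psi> F.diff[OF fF fejer_mean_in_fejer_riesz] mean(2)[OF n fS] k_norm])
        finally show ?thesis .
      qed
      then have "weighted_sum (gap k (restrict ?\<phi> (?F n)) \<psi> f) \<le> weighted_sum (\<lambda>_. \<gamma> n)"
        by (intro weighted_sum_mono[of _ _ "\<gamma> n"] F.gap_nonneg) auto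
      then show "weighted_sum (gap k (restrict ?\<phi> (?F n)) \<psi> f) \<le> \<gamma> n" by (simp add: weighted_sum_const)
    qed
  qed
  have \<gamma>_lim: "\<gamma> \<longlonglongrightarrow> 0"
  proof -
    have "filterlim (\<lambda>n. sqrt (real n)) at_top sequentially"
      by (rule filterlim_compose[OF sqrt_at_top filterlim_real_sequentially])
    then show ?thesis unfolding \<gamma>_def[abs_def] by (intro tendsto_divide_0[OF tendsto_const] filterlim_at_top_imp_at_infinity)
  qed
  \<comment> \<open>The index is shifted because \<open>?F 0\<close> does not contain the constants.\<close>
  have tb_X: "Metric_space.mtotally_bounded ?X (dist_on ?X ?dX) ?X"
  proof (rule totally_bounded_if_almost_isometries[where
        Y = "\<lambda>n. ?Y (Suc n)" and dY = "\<lambda>n. dist_on (?Y (Suc n)) (?dY (Suc n))" and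
        r = "\<lambda>n \<phi>. restrict \<phi> (?F (Suc n))" and \<epsilon> = "\<lambda>n. 2 * \<gamma> (Suc n)"])
    show "(\<lambda>n. 2 * \<gamma> (Suc n)) \<longlonglongrightarrow> 0"
      using tendsto_mult_right[OF LIMSEQ_Suc[OF \<gamma>_lim], of 2] by simp
    show "dist_on ?X ?dX \<phi> \<psi> \<le> dist_on (?Y (Suc n)) (?dY (Suc n)) (restrict \<phi> (?F (Suc n))) (restrict \<psi> (?F (Suc n)))
        + 2 * \<gamma> (Suc n)" if "\<phi> \<in> ?X" "\<psi> \<in> ?X" for n \<phi> \<psi>
      using that increase[of "Suc n"] restr[of "Suc n"] by (simp add: dist_on_def)
  qed (use C.Metric_space_ucp_maps lipschitz_system.Metric_space_ucp_maps[OF lip_F]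
      totally_bounded_ucp_maps_fejer_riesz[OF _ lip_F] restr in auto)
  have GH: "gromov_hausdorff_distance (?Y n) (?dY n) ?X ?dX \<le> ennreal (2 * \<gamma> n)" if n: "n \<ge> 1" for n
  proof -
    have "gromov_hausdorff_distance (?Y n) (dist_on (?Y n) (?dY n)) ?X (dist_on ?X ?dX) \<le> ennreal (2 * \<gamma> n)"
    proof (rule gromov_hausdorff_le_if_almost_isometry[where r = "\<lambda>\<phi>. restrict \<phi> (?F n)"])
      show "\<gamma> n > 0" using n by (simp add: \<gamma>_def)
      show "\<bar>dist_on (?Y n) (?dY n) (restrict \<phi> (?F n)) (restrict \<psi> (?F n)) - dist_on ?X ?dX \<phi> \<psi>\<bar> \<le> 2 * \<gamma> n"
        if "\<phi> \<in> ?X" "\<psi> \<in> ?X" for \<phi> \<psi>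
      proof -
        have "0 \<le> 2 * \<gamma> n" by (simp add: \<gamma>_def)
        then show ?thesis
          using that decrease[OF n that] increase[OF n that] restr[OF n] by (simp add: dist_on_def abs_le_iff)
      qed
      show "\<exists>\<phi>\<in>?X. dist_on (?Y n) (?dY n) (restrict \<phi> (?F n)) \<psi> \<le> \<gamma> n" if \<psi>: "\<psi> \<in> ?Y n" for \<psi>
        using dense[OF n \<psi>] restr[OF n] \<psi> by (auto simp: dist_on_def)
    qed (use n C.Metric_space_ucp_maps tb_X lipschitz_system.Metric_space_ucp_maps[OF lip_F]
        totally_bounded_ucp_maps_fejer_riesz[OF _ lip_F] restr in auto)
    then show ?thesis by (simp only: gromov_hausdorff_distance_dist_on)
  qed
  have "(\<lambda>n. ennreal (2 * \<gamma> n)) \<longlonglongrightarrow> ennreal (2 * 0)"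
    by (intro tendsto_ennrealI tendsto_mult tendsto_const \<gamma>_lim)
  then have "(\<lambda>n. ennreal (2 * \<gamma> n)) \<longlonglongrightarrow> 0" by simp
  then show ?thesis
    by (rule tendsto_sandwich[OF _ _ tendsto_const, rotated 2])
      (auto simp: eventually_sequentially intro!: exI[of _ 1] GH)
qed

end
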